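(* Let $n\geq 4$ be even and let $\xi\in\mathbb{R}$ be transcendental. First assume that $\underline{\xi}=(\xi,\xi^{2},\ldots,\xi^{n})$ induces equality in the Marnat–Moshchevitin inequality, i.e. \[ \widehat{\lambda}_{n}(\xi)+\frac{\widehat{\lambda}_{n}(\xi)^{2}}{\lambda_{n}(\xi)}+\cdots+\frac{\widehat{\lambda}_{n}(\xi)^{n}}{\lambda_{n}(\xi)^{n-1}}=1. \] If $n\in\{4,6,8\}$, then \[ \widehat{\lambda}_{4}(\xi)< 0.3588, \qquad \widehat{\lambda}_{6}(\xi)< 0.2540,\qquad \widehat{\lambda}_{8}(\xi)< 0.1968, \] and as $n\to\infty$ we have the asymptotical bound \[ \widehat{\lambda}_{n}(\xi)\leq \frac{\Theta+o(1)}{n}, \qquad n\to\infty, \] where $\Theta=1.7564\ldots$ is the solution to $e^{t}/t=2\sqrt{e}$ with $t>1$. When this equality assumption is dropped, we still have the following continuity result. There is $n_{0}$ such that for $n\geq n_{0}$ and every $\varepsilon>0$ there exists $\delta_{n}>0$ such that if $\alpha=\widehat{\lambda}_{n}(\xi)\in[1/n,1]$ and $\beta=\lambda_{n}(\xi)\in[1/n,\infty]$ satisfy \[ \epsilon_{\alpha,\beta}:=1-\left(\alpha+\frac{\alpha^{2}}{\beta}+\cdots+\frac{\alpha^{n}}{\beta^{n-1}}\right)<\delta_{n}, \] then \[ \widehat{\lambda}_{n}(\xi) \leq \frac{\Theta+\varepsilon}{n}. \]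
   Context: For $\underline{\xi}=(\xi_{1},\ldots,\xi_{n})\in\mathbb{R}^{n}$ and an integer vector $\underline{x}=(x,y_{1},\ldots,y_{n})$ put $Y_{\underline{x}}=\max_{1\leq i\leq n}|x\xi_{i}-y_{i}|$. Let $\omega(\underline{\xi})$ be the supremum of $\omega$ such that $Y_{\underline{x}}\leq x^{-\omega}$ has infinitely many integer solutions, and $\widehat{\omega}(\underline{\xi})$ the supremum of $\omega$ such that $0<x\leq X$, $Y_{\underline{x}}\leq X^{-\omega}$ has a solution for all large $X$. For $\xi$ real transcendental and $\underline{\xi}=(\xi,\xi^{2},\ldots,\xi^{n})$ on the Veronese curve write $\lambda_{n}(\xi)=\omega(\underline{\xi})$ and $\widehat{\lambda}_{n}(\xi)=\widehat{\omega}(\underline{\xi})$. Marnat and Moshchevitin proved $\widehat{\omega}+\widehat{\omega}^{2}/\omega+\cdots+\widehat{\omega}^{n}/\omega^{n-1}\leq 1$ for $\underline{\xi}$ with $\mathbb{Q}$-linearly independent coordinates together with $1$; equality corresponds to the "regular graph" case, i.e. $\epsilon_{\alpha,\beta}=0$ with $\alpha=\widehat{\lambda}_{n}(\xi)$, $\beta=\lambda_{n}(\xi)$. *)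

theory Defs
  imports "HOL-Analysis.Analysis" "HOL-Computational_Algebra.Polynomial"
begin

text \<open>
  A point of \<open>\<real>\<^sup>n\<close> is a function \<open>nat \<Rightarrow> real\<close> of which only the values at \<open>1, \<dots>, n\<close> are used.
  An integer vector \<open>(x, y\<^sub>1, \<dots>, y\<^sub>n)\<close> is a function \<open>v\<close> in \<open>int_vectors n\<close> with \<open>v 0 = x\<close> and
  \<open>v i = y\<^sub>i\<close>; extensionality outside \<open>{0..n}\<close> makes ``infinitely many'' count vectors and not
  irrelevant values of \<open>v\<close>.
\<close>

definition int_vectors :: "nat \<Rightarrow> (nat \<Rightarrow> int) set" where
  "int_vectors n = {0..n} \<rightarrow>\<^sub>E UNIV"

definition approx_err :: "nat \<Rightarrow> (nat \<Rightarrow> real) \<Rightarrow> (nat \<Rightarrow> int) \<Rightarrow> real" where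
  "approx_err n \<xi> v = Max ((\<lambda>i. \<bar>of_int (v 0) * \<xi> i - of_int (v i)\<bar>) ` {1..n})"

text \<open>
  The exponents may be infinite, so the suprema are taken in the extended reals.
  Positivity of \<open>v 0\<close> in the ordinary exponent is what makes the power \<open>x\<^sup>-\<^sup>w\<close> meaningful.
\<close>

definition ordinary_exponent :: "nat \<Rightarrow> (nat \<Rightarrow> real) \<Rightarrow> ereal" where
  "ordinary_exponent n \<xi> = Sup (ereal ` {w.
     infinite {v \<in> int_vectors n. 0 < v 0 \<and> approx_err n \<xi> v \<le> of_int (v 0) powr (- w)}})"

definition uniform_exponent :: "nat \<Rightarrow> (nat \<Rightarrow> real) \<Rightarrow> ereal" where
  "uniform_exponent n \<xi> = Sup (ereal ` {w. \<forall>\<^sub>F X in at_top.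
     \<exists>v \<in> int_vectors n. 0 < v 0 \<and> of_int (v 0) \<le> X \<and> approx_err n \<xi> v \<le> X powr (- w)})"

definition lambda_ord :: "nat \<Rightarrow> real \<Rightarrow> ereal" where
  "lambda_ord n \<xi> = ordinary_exponent n (\<lambda>i. \<xi> ^ i)"

definition lambda_unif :: "nat \<Rightarrow> real \<Rightarrow> ereal" where
  "lambda_unif n \<xi> = uniform_exponent n (\<lambda>i. \<xi> ^ i)"

text \<open>
  The left-hand side \<open>\<alpha> + \<alpha>\<^sup>2/\<beta> + \<dots> + \<alpha>\<^sup>n/\<beta>\<^sup>n\<^sup>-\<^sup>1\<close> of the Marnat--Moshchevitin inequality.
  For \<open>\<beta> = \<infinity>\<close> (and \<open>\<alpha>\<close> finite) it is \<open>\<alpha>\<close>, since \<open>a / \<infinity> = 0\<close> and \<open>\<infinity> ^ 0 = 1\<close> in \<open>ereal\<close>.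
\<close>

definition MM_sum :: "nat \<Rightarrow> ereal \<Rightarrow> ereal \<Rightarrow> ereal" where
  "MM_sum n \<alpha> \<beta> = (\<Sum>k = 1..n. \<alpha> ^ k / \<beta> ^ (k - 1))"

definition MM_defect :: "nat \<Rightarrow> ereal \<Rightarrow> ereal \<Rightarrow> ereal" where
  "MM_defect n \<alpha> \<beta> = 1 - MM_sum n \<alpha> \<beta>"

definition Theta :: real where
  "Theta = (THE t. 1 < t \<and> exp t / t = 2 * sqrt (exp 1))"

lemma exp_div_strict_mono:
  fixes s t :: real
  assumes "1 \<le> s" "s < t"
  shows "exp s / s < exp t / t"
proof -
  have "exp s * t < exp t * s"
  proof -
    have "t / s = 1 + (t - s) / s" using assms by (simp add: field_simps)
    also have "\<dots> \<le> 1 + (t - s)" using assms divide_left_mono[of 1 s "t - s"] by simp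
    also have "\<dots> < exp (t - s)"
      using exp_lower_Taylor_quadratic[of "t - s"] zero_less_power[of "t - s" 2] assms by linarith
    finally have "t / s < exp t / exp s" by (simp add: exp_diff)
    then show ?thesis using assms by (simp add: field_simps)
  qed
  then show ?thesis using assms by (simp add: field_simps)
qed

lemma Theta_ex1: "\<exists>!t::real. 1 < t \<and> exp t / t = 2 * sqrt (exp 1)"
proof -
  define c :: real where "c = exp (1/2)"
  have sq: "sqrt (exp 1) = c"
    unfolding c_def by (rule real_sqrt_unique) (simp_all flip: exp_of_nat_mult)
  have e1: "exp 1 = c ^ 2" and e2: "exp 2 = c ^ 4"
    unfolding c_def by (simp_all flip: exp_of_nat_mult)
  have c_lo: "8/5 < c"
    using exp_lower_Taylor_quadratic[of "1/2"] by (simp add: c_def power2_eq_square)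
  have c_hi: "c < 2"
    using exp_le e1 by (intro power2_less_imp_less[of c 2]) auto
  have "exp 1 / 1 \<le> 2 * c" using c_lo c_hi by (simp add: e1 power2_eq_square)
  moreover have "2 * c \<le> exp 2 / 2"
  proof -
    have "(8/5)^3 \<le> c ^ 3" using c_lo by (intro power_mono) auto
    then have "4 * c \<le> c ^ 3 * c" using c_lo by (intro mult_right_mono) (auto simp: power3_eq_cube)
    then show ?thesis by (simp add: e2 numeral_eq_Suc mult_ac)
  qed
  moreover have "continuous_on {1..2} (\<lambda>t::real. exp t / t)"
    by (intro continuous_intros) auto
  ultimately obtain t where t: "1 \<le> t" "t \<le> 2" "exp t / t = 2 * c"
    using IVT'[of "\<lambda>t::real. exp t / t" 1 "2 * c" 2] by auto
  have "t \<noteq> 1"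
  proof
    assume "t = 1"
    then have "c * c = 2 * c" using t e1 by (simp add: power2_eq_square)
    then show False using c_lo c_hi by simp
  qed
  show ?thesis
  proof (rule ex1I[of _ t])
    show "1 < t \<and> exp t / t = 2 * sqrt (exp 1)" using t sq \<open>t \<noteq> 1\<close> by auto
  next
    fix s :: real
    assume s: "1 < s \<and> exp s / s = 2 * sqrt (exp 1)"
    then show "s = t"
      using exp_div_strict_mono[of s t] exp_div_strict_mono[of t s] t sq
      by (cases s t rule: linorder_cases) auto
  qed
qed

lemma Theta_gt_1: "1 < Theta"
  and Theta_eq: "exp Theta / Theta = 2 * sqrt (exp 1)"
  using theI'[OF Theta_ex1] unfolding Theta_def by auto

end

(*
  Let \<alpha> and \<beta> be the two exponents, r = \<alpha>/\<beta>, and let x_m be the minimal points of (1, \<xi>, ..., \<xi>^n).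
  Starting from x_k, choose greedily the next minimal point outside the span of the previous ones;
  estimating the exterior products of these n + 1 integer points gives
  \<alpha> (1 + r + ... + r^(n-1)) \<le> 1, and near equality forces the heights of the chosen points to grow
  like a geometric progression with ratio 1/r.  The exterior product of the first n of them is then
  an integer polynomial which is small at \<xi>, and letting k vary one obtains a sequence of polynomials
  with ordinary exponent about w = 1/(\<alpha> - 1 + r) and uniform exponent about r w.
  By a resultant estimate (Bugeaud, Schleischitz) such a sequence exists only if
  r w \<le> max (2n - 2, n + (n - 1) r), which bounds r from below and hence \<alpha> from above.
  Asymptotically r = 1 - s/n and \<alpha> = t/n, where t (1 - e^(-s)) = s and t - s \<ge> 1/2;
  the extremal case is t = \<Theta>.
*)

theory Submission
  imports Defs "Jordan_Normal_Form.Char_Poly"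
begin

section \<open>Lengths of polynomials\<close>

text \<open>The exponents are suprema and need not be attained, so the argument runs with
  \<open>a\<close> just below the uniform and \<open>b\<close> just above the ordinary exponent. The
  equality case is thus no easier than near equality; it is the instance of defect 0. The tolerance
  \<delta> may depend on n but not on \<xi>. Its size is governed by lower bounds for r = a/b, so
  the ordinary exponent has to stay bounded; this is why exponents above 1 are treated separately,
  where the uniform exponent drops to at most 1/n. The upper bound is organised around a threshold
  r0: a uniform exponent above 1 / (1 + r0 + ... + r0^(n-1)) forces r \<le> r0, and it remains to
  exclude all those r at once, which works because the limiting resultant condition is monotone in
  r. The 1/2 behind \<Theta> arises since r w is about n/(t-s) and is compared with about 2n; s = t
  - 1/2 turns the other relation into e^(t-1/2) = 2t. For this r0 the leading terms cancel exactly,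
  so the sign is decided at relative order 1/n. It is favourable for every n \<ge> 4, which removes
  the error term.\<close>

definition plen :: "real poly \<Rightarrow> real" where
  "plen p = (\<Sum>i\<le>degree p. \<bar>coeff p i\<bar>)"

lemma plen_eq:
  assumes "degree p \<le> n"
  shows "plen p = (\<Sum>i\<le>n. \<bar>coeff p i\<bar>)"
  unfolding plen_def
  by (rule sum.mono_neutral_left) (use assms in \<open>auto simp: coeff_eq_0\<close>)

lemma plen_nonneg: "0 \<le> plen p"
  by (simp add: plen_def sum_nonneg)

lemma coeff_le_plen: "\<bar>coeff p i\<bar> \<le> plen p"
proof (cases "i \<le> degree p")
  case True
  then show ?thesis unfolding plen_def by (intro member_le_sum) auto
next
  case False
  then show ?thesis by (simp add: coeff_eq_0 plen_nonneg)
qed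

lemma poly_le_plen:
  assumes "degree p \<le> n"
  shows "\<bar>poly p t\<bar> \<le> plen p * max 1 \<bar>t\<bar> ^ n"
proof -
  have "\<bar>poly p t\<bar> \<le> (\<Sum>i\<le>degree p. \<bar>coeff p i * t ^ i\<bar>)"
    unfolding poly_altdef by (rule sum_abs)
  also have "\<dots> \<le> (\<Sum>i\<le>degree p. \<bar>coeff p i\<bar> * max 1 \<bar>t\<bar> ^ n)"
  proof (rule sum_mono)
    fix i assume "i \<in> {..degree p}"
    then have "\<bar>t\<bar> ^ i \<le> max 1 \<bar>t\<bar> ^ i" "max 1 \<bar>t\<bar> ^ i \<le> max 1 \<bar>t\<bar> ^ n"
      using assms by (auto intro!: power_mono power_increasing)
    then show "\<bar>coeff p i * t ^ i\<bar> \<le> \<bar>coeff p i\<bar> * max 1 \<bar>t\<bar> ^ n"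
      unfolding abs_mult power_abs by (intro mult_left_mono) auto
  qed
  finally show ?thesis by (simp add: plen_def sum_distrib_right)
qed

lemma plen_ge_1:
  fixes P :: "int poly"
  assumes "P \<noteq> 0"
  shows "1 \<le> plen (of_int_poly P)"
proof -
  have "lead_coeff P \<noteq> 0" using assms by simp
  then have "1 \<le> \<bar>lead_coeff P\<bar>" by linarith
  then have "1 \<le> \<bar>coeff (of_int_poly P :: real poly) (degree P)\<bar>" by simp
  also have "\<dots> \<le> plen (of_int_poly P)" by (rule coeff_le_plen)
  finally show ?thesis .
qed

text \<open>By Lagrange interpolation the coefficients of \<open>p\<close> are linear in its values
  on \<open>T\<close>, with factors that depend on \<open>T\<close> alone.\<close>

lemma plen_le_interpolation:
  fixes T :: "real set"
  assumes "finite T" "card T = Suc n"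
  obtains K where "0 < K" "\<And>p. degree p \<le> n \<Longrightarrow> plen p \<le> K * (\<Sum>t\<in>T. \<bar>poly p t\<bar>)"
proof -
  define L where "L t = (\<Prod>u\<in>T-{t}. Polynomial.smult (1 / (t - u)) [:- u, 1:])" for t
  have degL: "degree (L t) \<le> n" if "t \<in> T" for t
  proof -
    have "degree (L t) \<le> sum (degree \<circ> (\<lambda>u. Polynomial.smult (1 / (t - u)) [:- u, 1:])) (T-{t})"
      unfolding L_def by (rule degree_prod_sum_le) (use assms in auto)
    also have "\<dots> \<le> (\<Sum>u\<in>T-{t}. 1)" by (rule sum_mono) auto
    also have "\<dots> = n" using assms that by simp
    finally show ?thesis .
  qed
  have Lval: "poly (L t) u = (if u = t then 1 else 0)" if "t \<in> T" "u \<in> T" for t u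
  proof (cases "u = t")
    case True
    have "poly (L t) t = (\<Prod>u\<in>T-{t}. 1)"
      unfolding L_def poly_prod by (rule prod.cong) (auto simp flip: diff_divide_distrib)
    then show ?thesis using True by simp
  next
    case False
    then have "poly (L t) u = 0"
      unfolding L_def poly_prod using that assms by (intro prod_zero) auto
    then show ?thesis using False by simp
  qed
  define K where "K = 1 + (\<Sum>t\<in>T. plen (L t))"
  have Kpos: "0 < K" 
    unfolding K_def by (intro add_pos_nonneg sum_nonneg) (auto simp: plen_nonneg)
  have main: "plen p \<le> K * (\<Sum>t\<in>T. \<bar>poly p t\<bar>)" if p: "degree p \<le> n" for p
  proof -
    define q where "q = (\<Sum>t\<in>T. Polynomial.smult (poly p t) (L t))"
    have dq: "degree q \<le> n" unfolding q_def
      by (rule degree_sum_le) (use assms degL in \<open>auto intro: order_trans[OF degree_smult_le]\<close>)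
    have "p = q"
    proof (rule poly_eqI_degree[of T])
      fix u assume u: "u \<in> T"
      have "poly q u = (\<Sum>t\<in>T. if u = t then poly p t else 0)"
        unfolding q_def poly_sum by (rule sum.cong) (auto simp: Lval u)
      also have "\<dots> = poly p u" using u assms by simp
      finally show "poly p u = poly q u" by simp
    qed (use assms p dq in auto)
    have "plen p = (\<Sum>i\<le>n. \<bar>\<Sum>t\<in>T. poly p t * coeff (L t) i\<bar>)"
      unfolding plen_eq[OF p] by (subst \<open>p = q\<close>) (simp add: q_def coeff_sum)
    also have "\<dots> \<le> (\<Sum>i\<le>n. \<Sum>t\<in>T. \<bar>poly p t\<bar> * \<bar>coeff (L t) i\<bar>)"
      by (intro sum_mono order_trans[OF sum_abs]) (simp add: abs_mult)
    also have "\<dots> = (\<Sum>t\<in>T. \<bar>poly p t\<bar> * plen (L t))"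
      by (subst sum.swap) (simp add: sum_distrib_left degL plen_eq[where n = n])
    also have "\<dots> \<le> (\<Sum>t\<in>T. \<bar>poly p t\<bar> * K)"
    proof (intro sum_mono mult_left_mono)
      fix t assume "t \<in> T"
      then have "plen (L t) \<le> (\<Sum>t\<in>T. plen (L t))"
        using assms(1) by (intro member_le_sum) (auto simp: plen_nonneg)
      then show "plen (L t) \<le> K" unfolding K_def by simp
    qed auto
    finally show ?thesis by (simp add: sum_distrib_left mult.commute)
  qed
  show ?thesis by (rule that[OF Kpos main])
qed

text \<open>
  Among \<open>2n+1\<close> points a polynomial of degree at most \<open>n\<close> is small compared with its length at
  no more than \<open>n\<close> of them, so some point is good for both factors.
\<close>

lemma plen_mult_ge:
  obtains C where "1 \<le> C"
    "\<And>p q. degree p \<le> n \<Longrightarrow> degree q \<le> n \<Longrightarrow> degree (p * q) \<le> n \<Longrightarrow>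
      plen p * plen q \<le> C * plen (p * q)"
proof -
  define U where "U = real ` {..2*n}"
  have finU: "finite U" and cU: "card U = 2*n+1"
    unfolding U_def by (auto simp: card_image inj_on_def)
  have "\<forall>T\<in>{T. T \<subseteq> U \<and> card T = Suc n}. \<exists>K>0. \<forall>p. degree p \<le> n \<longrightarrow> plen p \<le> K * (\<Sum>t\<in>T. \<bar>poly p t\<bar>)"
  proof
    fix T assume "T \<in> {T. T \<subseteq> U \<and> card T = Suc n}"
    then have "finite T" "card T = Suc n" using finU finite_subset by auto
    then show "\<exists>K>0. \<forall>p. degree p \<le> n \<longrightarrow> plen p \<le> K * (\<Sum>t\<in>T. \<bar>poly p t\<bar>)"
      by (rule plen_le_interpolation) blast
  qed
  then obtain K where K0: "\<forall>T\<in>{T. T \<subseteq> U \<and> card T = Suc n}.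
      0 < K T \<and> (\<forall>p. degree p \<le> n \<longrightarrow> plen p \<le> K T * (\<Sum>t\<in>T. \<bar>poly p t\<bar>))"
    by (rule bchoice[elim_format]) blast
  have K: "\<And>T. T \<subseteq> U \<Longrightarrow> card T = Suc n \<Longrightarrow> 0 < K T"
    "\<And>T p. T \<subseteq> U \<Longrightarrow> card T = Suc n \<Longrightarrow> degree p \<le> n \<Longrightarrow> plen p \<le> K T * (\<Sum>t\<in>T. \<bar>poly p t\<bar>)"
    using K0 by simp_all
  \<comment> \<open>One constant for all sets of n+1 nodes in \<open>U\<close>; a sum serves as an
    upper bound for the maximum.\<close>
  define M where "M = 1 + (\<Sum>T | T \<subseteq> U \<and> card T = Suc n. K T)"
  have finT: "finite {T. T \<subseteq> U \<and> card T = Suc n}" using finU by simp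
  have KM: "K T \<le> M" if "T \<subseteq> U" "card T = Suc n" for T
  proof -
    have "K T \<le> (\<Sum>T | T \<subseteq> U \<and> card T = Suc n. K T)"
      using that finT by (intro member_le_sum) (auto intro: less_imp_le K(1))
    then show ?thesis unfolding M_def by simp
  qed
  have M1: "1 \<le> M" 
  proof -
    have "0 \<le> (\<Sum>T | T \<subseteq> U \<and> card T = Suc n. K T)"
      by (rule sum_nonneg) (simp add: K(1) less_imp_le)
    then show ?thesis unfolding M_def by simp
  qed
  \<comment> \<open>The points where \<open>p\<close> is small against its length. If there were n+1
    of them, interpolation at these would make the length smaller than itself.\<close>
  define B where "B p = {t\<in>U. \<bar>poly p t\<bar> * (M * real (Suc n)) < plen p}" for p
  have finB: "finite (B p)" for p unfolding B_def using finU by auto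
  have cB: "card (B p) \<le> n" if p: "degree p \<le> n" for p
  proof (rule ccontr)
    assume "\<not> card (B p) \<le> n"
    then obtain T where T: "T \<subseteq> B p" "card T = Suc n"
      by (meson not_less_eq_eq obtain_subset_with_card_n)
    have TU: "T \<subseteq> U" using T unfolding B_def by auto
    have finT: "finite T" using T by (metis card.infinite nat.distinct(1))
    have "plen p \<le> K T * (\<Sum>t\<in>T. \<bar>poly p t\<bar>)" by (rule K(2)[OF TU T(2) p])
    also have "\<dots> \<le> M * (\<Sum>t\<in>T. \<bar>poly p t\<bar>)"
      by (intro mult_right_mono KM TU T sum_nonneg) auto
    also have "\<dots> = (\<Sum>t\<in>T. \<bar>poly p t\<bar> * M)" by (simp add: sum_distrib_left mult.commute)
    also have "\<dots> < (\<Sum>t\<in>T. plen p / real (Suc n))"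
    proof (rule sum_strict_mono)
      fix t assume "t \<in> T"
      then have "\<bar>poly p t\<bar> * (M * real (Suc n)) < plen p" using T unfolding B_def by auto
      then show "\<bar>poly p t\<bar> * M < plen p / real (Suc n)" by (simp add: field_simps)
    qed (use T finT in auto)
    also have "\<dots> = plen p" using T by simp
    finally show False by simp
  qed
  \<comment> \<open>At a point bad for neither factor, each factor loses
    \<open>M * real (Suc n)\<close>; passing from the value of the product back to its length loses
    \<open>max 1 \<bar>t\<bar> ^ n\<close>, and the points are at most 2n.\<close>
  define C where "C = (M * real (Suc n))\<^sup>2 * (real (2*n+1)) ^ n"
  have C1: "1 \<le> C" unfolding C_def
  proof (rule mult_ge1_I)
    show "1 \<le> (M * real (Suc n))\<^sup>2" using M1 by (intro one_le_power mult_ge1_I) auto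
    show "1 \<le> real (2 * n + 1) ^ n" by (intro one_le_power) auto
  qed
  have main: "plen p * plen q \<le> C * plen (p * q)"
    if p: "degree p \<le> n" and q: "degree q \<le> n" and pq: "degree (p * q) \<le> n" for p q
  proof -
    have "card (B p \<union> B q) \<le> 2*n" using card_Un_le[of "B p" "B q"] cB[OF p] cB[OF q] by linarith
    then have "\<not> U \<subseteq> B p \<union> B q" using cU finB card_mono[of "B p \<union> B q" U] by auto
    then obtain t where t: "t \<in> U" "t \<notin> B p" "t \<notin> B q" by auto
    define D where "D = M * real (Suc n)"
    have D: "0 \<le> D" unfolding D_def using M1 by auto
    have 1: "plen p \<le> \<bar>poly p t\<bar> * D" "plen q \<le> \<bar>poly q t\<bar> * D"
      using t unfolding B_def D_def by auto
    have "max 1 \<bar>t\<bar> \<le> real (2*n+1)" using t(1) unfolding U_def by auto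
    then have 2: "max 1 \<bar>t\<bar> ^ n \<le> real (2*n+1) ^ n" by (intro power_mono) auto
    have "plen p * plen q \<le> (\<bar>poly p t\<bar> * D) * (\<bar>poly q t\<bar> * D)"
      using 1 by (intro mult_mono) (auto simp: plen_nonneg D)
    also have "\<dots> = D\<^sup>2 * \<bar>poly (p * q) t\<bar>" by (simp add: power2_eq_square abs_mult)
    also have "\<dots> \<le> D\<^sup>2 * (plen (p * q) * max 1 \<bar>t\<bar> ^ n)"
      by (intro mult_left_mono poly_le_plen[OF pq]) auto
    also have "\<dots> \<le> D\<^sup>2 * (plen (p * q) * real (2*n+1) ^ n)"
      using 2 by (intro mult_left_mono) (auto simp: plen_nonneg)
    finally show ?thesis unfolding C_def D_def by (simp add: mult_ac)
  qed
  show ?thesis by (rule that[OF C1 main])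
qed

text \<open>Factoring over the integers instead of the rationals keeps cofactors integral, hence of
  length at least 1. The factor of positive degree must be looked for, because prime numbers are
  prime elements here as well.\<close>

lemma int_poly_prime_divisor:
  fixes P :: "int poly"
  assumes "0 < degree P"
  obtains Q where "prime_elem Q" "Q dvd P" "0 < degree Q"
proof -
  have "0 < degree P \<longrightarrow> (\<exists>Q. prime_elem Q \<and> Q dvd P \<and> 0 < degree Q)"
  proof (induction P rule: prime_divisors_induct)
    case (unit x)
    then show ?case by (simp add: poly_dvd_1)
  next
    case (factor p x)
    show ?case
    proof
      assume px: "0 < degree (p * x)"
      show "\<exists>Q. prime_elem Q \<and> Q dvd p * x \<and> 0 < degree Q"
      proof (cases "degree p = 0")
        case False
        then show ?thesis using factor(1) by (auto intro!: exI[of _ p])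
      next
        case True
        then have "0 < degree x" using px by (metis add_0 degree_mult_le less_le_trans)
        then show ?thesis using factor(2) by (auto intro: dvd_mult)
      qed
    qed
  qed auto
  then show ?thesis using assms that by blast
qed

text \<open>Serves to take a positive minimum of \<open>\<bar>Q(\<xi>)\<bar>\<close> over the short
  polynomials, and so to push a prime factor beyond any prescribed length.\<close>

lemma finite_int_polys_bounded: "finite {P :: int poly. degree P \<le> n \<and> plen (of_int_poly P) \<le> M}"
proof -
  let ?S = "{xs. set xs \<subseteq> {-\<lceil>M\<rceil>..\<lceil>M\<rceil>} \<and> length xs = Suc n}"
  have "{P :: int poly. degree P \<le> n \<and> plen (of_int_poly P) \<le> M} \<subseteq> Poly ` ?S"
  proof
    fix P :: "int poly" assume "P \<in> {P. degree P \<le> n \<and> plen (of_int_poly P) \<le> M}"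
    then have P: "degree P \<le> n" "plen (of_int_poly P) \<le> M" by auto
    have c: "\<bar>coeff P i\<bar> \<le> \<lceil>M\<rceil>" for i
    proof -
      have "\<bar>coeff (of_int_poly P :: real poly) i\<bar> \<le> M" using coeff_le_plen P(2) order_trans by blast
      then show ?thesis by (simp add: le_ceiling_iff)
    qed
    have "P = Poly (map (coeff P) [0..<Suc n])"
      by (rule poly_eqI) (use P in \<open>auto simp: nth_default_def coeff_eq_0 simp del: upt_Suc\<close>)
    moreover have "map (coeff P) [0..<Suc n] \<in> ?S"
    proof -
      have "coeff P i \<in> {-\<lceil>M\<rceil>..\<lceil>M\<rceil>}" for i using c[of i] by auto
      then show ?thesis by (auto simp del: upt_Suc)
    qed
    ultimately show "P \<in> Poly ` ?S" by blast
  qed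
  then show ?thesis by (rule finite_subset) (intro finite_imageI finite_lists_length_eq, simp)
qed

section \<open>Resultants and uniform polynomial approximation\<close>

lemma coeff_le_plen_int: "\<bar>real_of_int (coeff P i)\<bar> \<le> plen (of_int_poly P)"
  using coeff_le_plen[of "of_int_poly P" i] by simp

lemma int_poly_nonroot:
  fixes \<xi> :: real
  assumes "\<not> algebraic \<xi>" "Q \<noteq> 0"
  shows "poly (of_int_poly Q) \<xi> \<noteq> 0"
  using assms algebraicI[of "of_int_poly Q" \<xi>] by auto

text \<open>Values at \<xi> are multiplicative, and lengths are so up to a constant; hence the
  exponent \<open>v\<close> survives products and only the constant deteriorates, once per prime
  factor of positive degree. Read backwards: an unusually good polynomial has an almost equally good
  prime factor.\<close>

lemma poly_ge_of_primes_ge: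
  fixes \<xi> :: real
  assumes \<kappa>: "0 < \<kappa>" and v: "0 \<le> v"
    and prim: "\<And>Q :: int poly. prime_elem Q \<Longrightarrow> 0 < degree Q \<Longrightarrow> degree Q \<le> n \<Longrightarrow>
      \<kappa> * plen (of_int_poly Q) powr - v \<le> \<bar>poly (of_int_poly Q) \<xi>\<bar>"
  obtains \<kappa>' where "0 < \<kappa>'" "\<And>P :: int poly. P \<noteq> 0 \<Longrightarrow> degree P \<le> n \<Longrightarrow>
      \<kappa>' * plen (of_int_poly P) powr - v \<le> \<bar>poly (of_int_poly P) \<xi>\<bar>"
proof -
  obtain C where C: "1 \<le> C" "\<And>p q. degree p \<le> n \<Longrightarrow> degree q \<le> n \<Longrightarrow> degree (p * q) \<le> n \<Longrightarrow>
      plen p * plen q \<le> C * plen (p * q)"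
    by (rule plen_mult_ge[of n]) blast
  \<comment> \<open>The price of splitting off one factor: \<kappa> from its own lower bound and
    \<open>C powr - v\<close> from the length of a product. The \<open>min 1\<close> makes powers of
    \<open>c\<close> decrease, so that the degree may serve as the number of factors.\<close>
  define c where "c = min 1 \<kappa> * C powr - v"
  have c: "0 < c" "c \<le> 1"
    using \<kappa> C(1) v by (auto simp: c_def powr_minus_divide field_simps ge_one_powr_ge_zero min_def
        intro: order_trans[of _ 1])
  have main: "c ^ degree P * plen (of_int_poly P) powr - v \<le> \<bar>poly (of_int_poly P) \<xi>\<bar>"
    if "P \<noteq> 0" "degree P \<le> n" for P :: "int poly"
    using that
  proof (induction "degree P" arbitrary: P rule: less_induct)
    case less
    show ?case
    proof (cases "degree P = 0")
      case True
      then obtain a where P: "P = [:a:]" by (rule degree_eq_zeroE)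
      then have a: "1 \<le> \<bar>real_of_int a\<bar>" using less.prems by auto
      then have "\<bar>real_of_int a\<bar> powr - v \<le> 1" using v powr_mono[of "-v" 0 "\<bar>real_of_int a\<bar>"] by (auto split: if_splits)
      then show ?thesis using a by (simp add: P plen_def)
    next
      case False
      then obtain Q where Q: "prime_elem Q" "Q dvd P" "0 < degree Q"
        using int_poly_prime_divisor[of P] by auto
      then obtain R where P: "P = Q * R" by auto
      have nz: "Q \<noteq> 0" "R \<noteq> 0" using less.prems P by auto
      have deg: "degree P = degree Q + degree R" using nz by (simp add: P degree_mult_eq)
      define q r where "q = plen (of_int_poly Q)" and "r = plen (of_int_poly R)"
      have q: "1 \<le> q" and r: "1 \<le> r" unfolding q_def r_def using nz plen_ge_1 by auto
      have IH: "c ^ degree R * r powr - v \<le> \<bar>poly (of_int_poly R) \<xi>\<bar>"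
        unfolding r_def using less.hyps[of R] nz less.prems deg Q(3) by auto
      have Qb: "\<kappa> * q powr - v \<le> \<bar>poly (of_int_poly Q) \<xi>\<bar>"
        unfolding q_def using prim Q deg less.prems by auto
      have "q * r \<le> C * plen (of_int_poly P)"
        unfolding q_def r_def P of_int_poly_hom.hom_mult
        using deg less.prems by (intro C(2)) (simp_all add: P flip: of_int_poly_hom.hom_mult)
      then have "(C * plen (of_int_poly P)) powr - v \<le> (q * r) powr - v"
        using q r v by (intro powr_mono2') auto
      then have qr: "C powr - v * plen (of_int_poly P) powr - v \<le> q powr - v * r powr - v"
        using q r C(1) plen_nonneg by (simp add: powr_mult)
      have "c ^ degree P \<le> c ^ Suc (degree R)"
        using deg Q(3) c by (intro power_decreasing) auto
      then have "c ^ degree P * plen (of_int_poly P) powr - v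
          \<le> c ^ Suc (degree R) * plen (of_int_poly P) powr - v"
        by (intro mult_right_mono) auto
      also have "\<dots> = min 1 \<kappa> * c ^ degree R * (C powr - v * plen (of_int_poly P) powr - v)"
        by (simp add: c_def)
      also have "\<dots> \<le> \<kappa> * c ^ degree R * (q powr - v * r powr - v)"
        using \<kappa> c by (intro mult_mono[OF _ qr] mult_right_mono) auto
      also have "\<dots> = (\<kappa> * q powr - v) * (c ^ degree R * r powr - v)" by simp
      also have "\<dots> \<le> \<bar>poly (of_int_poly Q) \<xi>\<bar> * \<bar>poly (of_int_poly R) \<xi>\<bar>"
        using IH Qb c by (intro mult_mono) auto
      finally show ?thesis by (simp add: P of_int_poly_hom.hom_mult abs_mult)
    qed
  qed
  show ?thesis
  proof (rule that[of "c ^ n"])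
    fix P :: "int poly" assume P: "P \<noteq> 0" "degree P \<le> n"
    have "c ^ n \<le> c ^ degree P" using c P by (intro power_decreasing) auto
    then show "c ^ n * plen (of_int_poly P) powr - v \<le> \<bar>poly (of_int_poly P) \<xi>\<bar>"
      using main[OF P] by (meson mult_right_mono order_trans powr_ge_zero)
  qed (use c in auto)
qed

text \<open>The Sylvester matrix with coefficients in ascending order. Column 0 holds the constant
  terms and is the one later replaced by values at \<xi>.\<close>

definition sylv :: "int poly \<Rightarrow> int poly \<Rightarrow> int mat" where
  "sylv P Q = mat (degree Q + degree P) (degree Q + degree P)
     (\<lambda>(i, j). if i < degree Q then coeff (monom 1 i * P) j else coeff (monom 1 (i - degree Q) * Q) j)"

text \<open>A linear relation between the rows is an identity \<open>U * P + V * Q = 0\<close> with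
  \<open>degree U < degree Q\<close> unless \<open>U = 0\<close>. The prime \<open>Q\<close> divides
  \<open>U * P\<close> but not \<open>P\<close>, so it divides \<open>U\<close>, which must vanish;
  then so does \<open>V\<close>.\<close>

lemma det_sylv_nonzero:
  assumes Q: "prime_elem Q" and nd: "\<not> Q dvd P"
  shows "det (sylv P Q) \<noteq> 0"
proof
  define d p N where "d = degree Q" and "p = degree P" and "N = d + p"
  have nz: "P \<noteq> 0" "Q \<noteq> 0" using nd Q by auto
  have carr: "sylv P Q \<in> carrier_mat N N" by (simp add: sylv_def N_def d_def p_def)
  assume "det (sylv P Q) = 0"
  then have "det (sylv P Q)\<^sup>T = 0" using det_transpose[OF carr] by simp
  then obtain v where v: "v \<in> carrier_vec N" "v \<noteq> 0\<^sub>v N" "(sylv P Q)\<^sup>T *\<^sub>v v = 0\<^sub>v N"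
    using det_0_iff_vec_prod_zero[of "(sylv P Q)\<^sup>T" N] carr by auto
  \<comment> \<open>The two blocks of the kernel vector, read as coefficient sequences.\<close>
  define U V where "U = (\<Sum>i<d. monom (v $ i) i)" and "V = (\<Sum>i<p. monom (v $ (d + i)) i)"
  have cU: "coeff U i = (if i < d then v $ i else 0)" for i
    by (simp add: U_def coeff_sum)
  have cV: "coeff V i = (if i < p then v $ (d + i) else 0)" for i
    by (simp add: V_def coeff_sum)
  have UV: "U * P + V * Q = 0"
  proof (rule poly_eqI)
    fix j
    show "coeff (U * P + V * Q) j = coeff 0 j"
    proof (cases "j < N")
      case True
      have U1: "coeff (U * P) j = (\<Sum>i<d. v $ i * coeff (monom 1 i * P) j)"
        by (simp add: U_def sum_distrib_right coeff_sum coeff_monom_mult if_distrib cong: if_cong)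
      have V1: "coeff (V * Q) j = (\<Sum>i<p. v $ (d + i) * coeff (monom 1 i * Q) j)"
        by (simp add: V_def sum_distrib_right coeff_sum coeff_monom_mult if_distrib cong: if_cong)
      have "0 = ((sylv P Q)\<^sup>T *\<^sub>v v) $ j" using v True by simp
      also have "\<dots> = (\<Sum>i<N. sylv P Q $$ (i, j) * v $ i)"
        using True carr v(1) by (simp add: scalar_prod_def atLeast0LessThan)
      also have "\<dots> = (\<Sum>i<d. sylv P Q $$ (i, j) * v $ i) + (\<Sum>i<p. sylv P Q $$ (d + i, j) * v $ (d + i))"
        unfolding N_def using sum.shift_bounds_nat_ivl[of "\<lambda>i. sylv P Q $$ (i, j) * v $ i" 0 d p]
        by (simp add: lessThan_atLeast0 sum.atLeastLessThan_concat[symmetric, of 0 d "d+p"] add.commute)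
      also have "\<dots> = coeff (U * P) j + coeff (V * Q) j"
        unfolding U1 V1 using True
        by (intro arg_cong2[of _ _ _ _ "(+)"] sum.cong) (auto simp: sylv_def N_def d_def p_def)
      finally show ?thesis by simp
    next
      case False
      have "degree (U * P) < N" if "d > 0"
      proof -
        have "degree U \<le> d - 1" by (rule degree_le) (use that in \<open>auto simp: cU\<close>)
        then show ?thesis using degree_mult_le[of U P] that by (auto simp: N_def p_def)
      qed
      moreover have "U = 0" if "d = 0" using that by (simp add: U_def)
      ultimately have 1: "coeff (U * P) j = 0" using False by (cases "d = 0") (auto intro!: coeff_eq_0)
      have "degree (V * Q) < N" if "p > 0"
      proof -
        have "degree V \<le> p - 1" by (rule degree_le) (use that in \<open>auto simp: cV\<close>)
        then show ?thesis using degree_mult_le[of V Q] that by (auto simp: N_def d_def)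
      qed
      moreover have "V = 0" if "p = 0" using that by (simp add: V_def)
      ultimately have 2: "coeff (V * Q) j = 0" using False by (cases "p = 0") (auto intro!: coeff_eq_0)
      show ?thesis using 1 2 by simp
    qed
  qed
  then have "Q dvd U * P" by (metis add_eq_0_iff dvd_minus_iff dvd_triv_right)
  then have "Q dvd U" using Q nd prime_elem_dvd_mult_iff by blast
  have U0: "U = 0"
  proof (rule ccontr)
    assume U: "U \<noteq> 0"
    then have "d \<le> degree U" using \<open>Q dvd U\<close> dvd_imp_degree_le d_def by blast
    then have "coeff U (degree U) = 0" by (simp add: cU)
    then show False using U by simp
  qed
  then have V0: "V = 0" using UV nz by simp
  have "v = 0\<^sub>v N"
  proof (rule eq_vecI)
    fix i assume "i < dim_vec (0\<^sub>v N)"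
    then have i: "i < N" by simp
    show "v $ i = 0\<^sub>v N $ i"
    proof (cases "i < d")
      case True
      then show ?thesis using cU[of i] U0 i by simp
    next
      case False
      then show ?thesis using cV[of "i - d"] V0 i by (simp add: N_def split: if_splits)
    qed
  qed (use v in auto)
  then show False using v by simp
qed

text \<open>The resultant is a nonzero integer, so at least 1 in absolute value. Adding
  \<open>\<xi> ^ j\<close> times column j to column 0 does not change it and turns column 0 into
  multiples of \<open>P(\<xi>)\<close> and \<open>Q(\<xi>)\<close>. Each term of the Leibniz
  expansion then has exactly one such small entry.\<close>

lemma resultant_bound:
  fixes \<xi> :: real
  obtains C where "0 < C"
    "\<And>P Q :: int poly. prime_elem Q \<Longrightarrow> \<not> Q dvd P \<Longrightarrow> 0 < degree P \<Longrightarrow> degree P \<le> n \<Longrightarrow>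
      0 < degree Q \<Longrightarrow> degree Q \<le> n \<Longrightarrow>
      1 \<le> C * (plen (of_int_poly P) ^ (degree Q - 1) * plen (of_int_poly Q) ^ degree P * \<bar>poly (of_int_poly P) \<xi>\<bar>
             + plen (of_int_poly P) ^ degree Q * plen (of_int_poly Q) ^ (degree P - 1) * \<bar>poly (of_int_poly Q) \<xi>\<bar>)"
proof -
  define X where "X = max 1 \<bar>\<xi>\<bar>"
  have X: "1 \<le> X" by (simp add: X_def)
  define C where "C = fact (2 * n) * X ^ (2 * n)"
  have main: "1 \<le> C * (plen (of_int_poly P) ^ (degree Q - 1) * plen (of_int_poly Q) ^ degree P * \<bar>poly (of_int_poly P) \<xi>\<bar>
             + plen (of_int_poly P) ^ degree Q * plen (of_int_poly Q) ^ (degree P - 1) * \<bar>poly (of_int_poly Q) \<xi>\<bar>)"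
    if Q: "prime_elem Q" and nd: "\<not> Q dvd P" and dP: "0 < degree P" "degree P \<le> n"
      and dQ: "0 < degree Q" "degree Q \<le> n" for P Q :: "int poly"
  proof -
    define d p N where "d = degree Q" and "p = degree P" and "N = d + p"
    define a b where "a = plen (of_int_poly P)" and "b = plen (of_int_poly Q)"
    define \<alpha> \<beta> where "\<alpha> = \<bar>poly (of_int_poly P) \<xi>\<bar>" and "\<beta> = \<bar>poly (of_int_poly Q) \<xi>\<bar>"
    have nz: "P \<noteq> 0" "Q \<noteq> 0" using nd Q by auto
    have ab: "1 \<le> a" "1 \<le> b" unfolding a_def b_def using nz plen_ge_1 by auto
    define M :: "real mat" where "M = map_mat real_of_int (sylv P Q)"
    \<comment> \<open>Right multiplication by this unitriangular matrix performs the column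
      operation.\<close>
    define E :: "real mat" where "E = mat N N (\<lambda>(j, l). if l = 0 then \<xi> ^ j else if j = l then 1 else 0)"
    define W where "W = M * E"
    have carr: "M \<in> carrier_mat N N" "E \<in> carrier_mat N N"
      by (simp_all add: M_def E_def sylv_def N_def d_def p_def)
    then have carrW: "W \<in> carrier_mat N N" unfolding W_def by simp
    have "det E = 1"
    proof -
      have "det E = prod_list (diag_mat E)"
        using carr(2) by (rule det_lower_triangular[rotated]) (auto simp: E_def)
      also have "diag_mat E = map (\<lambda>i. 1) [0..<N]"
        by (auto simp: diag_mat_def E_def intro!: map_cong)
      also have "prod_list \<dots> = 1" by (induction N) auto
      finally show ?thesis .
    qed
    moreover have "det M = of_int (det (sylv P Q))" unfolding M_def by (simp add: of_int_hom.hom_det)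
    ultimately have detW: "det W = of_int (det (sylv P Q))"
      unfolding W_def using det_mult[OF carr(1,2)] by simp
    have "1 \<le> \<bar>det W\<bar>"
    proof -
      have "1 \<le> \<bar>det (sylv P Q)\<bar>" using det_sylv_nonzero[OF Q nd] by linarith
      then show ?thesis unfolding detW by linarith
    qed
    have M_entry: "M $$ (i, j) = (if i < d then coeff (monom 1 i * of_int_poly P) j
        else coeff (monom 1 (i - d) * of_int_poly Q) j)" if "i < N" "j < N" for i j
      using that by (simp add: M_def sylv_def N_def d_def p_def coeff_monom_mult)
    have W_sum: "W $$ (i, l) = (\<Sum>j<N. M $$ (i, j) * E $$ (j, l))" if "i < N" "l < N" for i l
      using that carr unfolding W_def by (simp add: scalar_prod_def atLeast0LessThan)
    have W_other: "\<bar>W $$ (i, l)\<bar> \<le> (if i < d then a else b)" if "i < N" "l < N" "l \<noteq> 0" for i l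
    proof -
      have "W $$ (i, l) = (\<Sum>j<N. if j = l then M $$ (i, j) else 0)"
        unfolding W_sum[OF that(1,2)] using that by (intro sum.cong) (auto simp: E_def)
      also have "\<dots> = M $$ (i, l)" using that by simp
      finally show ?thesis using that ab
        by (auto simp: M_entry coeff_monom_mult a_def b_def coeff_le_plen_int)
    qed
    have W_zero: "W $$ (i, 0) = (if i < d then \<xi> ^ i * poly (of_int_poly P) \<xi>
        else \<xi> ^ (i - d) * poly (of_int_poly Q) \<xi>)" if "i < N" for i
    proof -
      define r where "r = (if i < d then monom 1 i * of_int_poly P else monom 1 (i - d) * of_int_poly Q :: real poly)"
      have "degree r < N"
        using that degree_mult_le[of "monom 1 i" "of_int_poly P :: real poly"]
          degree_mult_le[of "monom 1 (i - d)" "of_int_poly Q :: real poly"]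
        by (auto simp: r_def N_def d_def p_def degree_monom_eq)
      have "W $$ (i, 0) = (\<Sum>j<N. coeff r j * \<xi> ^ j)"
        unfolding W_sum[OF that, of 0, OF order.strict_trans1[OF le0 that]]
        using that by (intro sum.cong) (auto simp: E_def M_entry r_def)
      also have "\<dots> = poly r \<xi>" unfolding poly_altdef
        by (rule sum.mono_neutral_right) (use \<open>degree r < N\<close> in \<open>auto intro: coeff_eq_0\<close>)
      finally show ?thesis by (simp add: r_def poly_monom)
    qed
    define S where "S = a ^ (d - 1) * b ^ p * \<alpha> + a ^ d * b ^ (p - 1) * \<beta>"
    have N2: "N \<le> 2 * n" using dP dQ by (simp add: N_def d_def p_def)
    \<comment> \<open>The row sent to column 0 contributes a value at \<xi>, every other row at most
      a length. Whether that row belongs to \<open>P\<close> or to \<open>Q\<close> decides which of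
      the two summands of \<open>S\<close> bounds the product.\<close>
    have bound: "(\<Prod>i = 0..<N. \<bar>W $$ (i, \<pi> i)\<bar>) \<le> X ^ (2 * n) * S" if \<pi>: "\<pi> permutes {0..<N}" for \<pi>
    proof -
      have N0: "0 < N" using dP by (simp add: N_def p_def)
      obtain i0 where i0: "i0 < N" "\<pi> i0 = 0"
        using permutes_surj[OF \<pi>] permutes_in_image[OF \<pi>] N0
        by (metis atLeastLessThan_iff le0 permutes_def \<pi>)
      define f where "f i = (if i < d then a else b)" for i
      have fpos: "0 < f i" for i using ab by (auto simp: f_def)
      have prodf: "(\<Prod>i = 0..<N. f i) = a ^ d * b ^ p"
      proof -
        have "(\<Prod>i = 0..<N. f i) = (\<Prod>i = 0..<d. f i) * (\<Prod>i = d..<N. f i)"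
          by (simp add: prod.atLeastLessThan_concat N_def)
        also have "(\<Prod>i = 0..<d. f i) = (\<Prod>i = 0..<d. a)" by (rule prod.cong) (auto simp: f_def)
        also have "(\<Prod>i = d..<N. f i) = (\<Prod>i = d..<N. b)" by (rule prod.cong) (auto simp: f_def)
        finally show ?thesis by (simp add: N_def)
      qed
      have rest: "(\<Prod>i\<in>{0..<N}-{i0}. \<bar>W $$ (i, \<pi> i)\<bar>) \<le> (\<Prod>i\<in>{0..<N}-{i0}. f i)"
      proof (rule prod_mono)
        fix i assume i: "i \<in> {0..<N} - {i0}"
        then have "\<pi> i \<noteq> 0" using i0 permutes_inj[OF \<pi>] by (metis Diff_iff insert_iff inj_eq)
        moreover have "\<pi> i < N" using permutes_in_image[OF \<pi>, of i] i by auto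
        ultimately show "0 \<le> \<bar>W $$ (i, \<pi> i)\<bar> \<and> \<bar>W $$ (i, \<pi> i)\<bar> \<le> f i"
          using W_other i by (auto simp: f_def)
      qed
      have prest: "f i0 * (\<Prod>i\<in>{0..<N}-{i0}. f i) = a ^ d * b ^ p"
        unfolding prodf[symmetric] using i0 by (subst prod.remove[of _ i0]) auto
      have xi: "\<bar>\<xi>\<bar> ^ k \<le> X ^ (2 * n)" if "k \<le> N" for k
      proof -
        have "\<bar>\<xi>\<bar> ^ k \<le> X ^ k" by (intro power_mono) (auto simp: X_def)
        also have "\<dots> \<le> X ^ (2 * n)" using X that N2 by (intro power_increasing) auto
        finally show ?thesis .
      qed
      have "(\<Prod>i = 0..<N. \<bar>W $$ (i, \<pi> i)\<bar>) = \<bar>W $$ (i0, 0)\<bar> * (\<Prod>i\<in>{0..<N}-{i0}. \<bar>W $$ (i, \<pi> i)\<bar>)"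
        using i0 by (subst prod.remove[of _ i0]) auto
      also have "\<dots> \<le> \<bar>W $$ (i0, 0)\<bar> * (\<Prod>i\<in>{0..<N}-{i0}. f i)"
        using rest by (intro mult_left_mono) auto
      also have "\<dots> \<le> X ^ (2 * n) * S"
      proof (cases "i0 < d")
        case True
        have "a * (\<Prod>i\<in>{0..<N}-{i0}. f i) = a * (a ^ (d - 1) * b ^ p)"
          using prest True by (simp add: f_def power_eq_if)
        then have pr: "(\<Prod>i\<in>{0..<N}-{i0}. f i) = a ^ (d - 1) * b ^ p" using ab by simp
        have "\<bar>W $$ (i0, 0)\<bar> = \<bar>\<xi>\<bar> ^ i0 * \<alpha>"
          using W_zero[OF i0(1)] True by (simp add: abs_mult power_abs \<alpha>_def)
        also have "\<dots> \<le> X ^ (2 * n) * \<alpha>"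
          using xi[of i0] i0 by (intro mult_right_mono) (auto simp: \<alpha>_def)
        finally have "\<bar>W $$ (i0, 0)\<bar> * (a ^ (d - 1) * b ^ p) \<le> X ^ (2 * n) * \<alpha> * (a ^ (d - 1) * b ^ p)"
          using ab by (intro mult_right_mono) auto
        also have "\<dots> = X ^ (2 * n) * (a ^ (d - 1) * b ^ p * \<alpha>)" by simp
        also have "\<dots> \<le> X ^ (2 * n) * S"
          using X ab by (intro mult_left_mono) (auto simp: S_def \<beta>_def)
        finally show ?thesis unfolding pr .
      next
        case False
        have p0: "p \<noteq> 0" using dP by (simp add: p_def)
        have "b * (\<Prod>i\<in>{0..<N}-{i0}. f i) = b * (a ^ d * b ^ (p - 1))"
          using prest False p0 by (simp add: f_def power_eq_if)
        then have pr: "(\<Prod>i\<in>{0..<N}-{i0}. f i) = a ^ d * b ^ (p - 1)" using ab by simp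
        have "\<bar>W $$ (i0, 0)\<bar> = \<bar>\<xi>\<bar> ^ (i0 - d) * \<beta>"
          using W_zero[OF i0(1)] False by (simp add: abs_mult power_abs \<beta>_def)
        also have "\<dots> \<le> X ^ (2 * n) * \<beta>"
          using xi[of "i0 - d"] i0 by (intro mult_right_mono) (auto simp: \<beta>_def)
        finally have "\<bar>W $$ (i0, 0)\<bar> * (a ^ d * b ^ (p - 1)) \<le> X ^ (2 * n) * \<beta> * (a ^ d * b ^ (p - 1))"
          using ab by (intro mult_right_mono) auto
        also have "\<dots> = X ^ (2 * n) * (a ^ d * b ^ (p - 1) * \<beta>)" by simp
        also have "\<dots> \<le> X ^ (2 * n) * S"
          using X ab by (intro mult_left_mono) (auto simp: S_def \<alpha>_def)
        finally show ?thesis unfolding pr .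
      qed
      finally show ?thesis .
    qed
    have S0: "0 \<le> S" using ab by (auto simp: S_def \<alpha>_def \<beta>_def)
    have "\<bar>det W\<bar> \<le> (\<Sum>\<pi> | \<pi> permutes {0..<N}. \<bar>signof \<pi> * (\<Prod>i = 0..<N. W $$ (i, \<pi> i))\<bar>)"
      unfolding det_def'[OF carrW] by (rule sum_abs)
    also have "\<dots> \<le> (\<Sum>\<pi> | \<pi> permutes {0..<N}. X ^ (2 * n) * S)"
    proof (rule sum_mono)
      fix \<pi> assume "\<pi> \<in> {\<pi>. \<pi> permutes {0..<N}}"
      moreover have "\<bar>signof \<pi> :: real\<bar> = 1" by (simp add: sign_def)
      ultimately show "\<bar>signof \<pi> * (\<Prod>i = 0..<N. W $$ (i, \<pi> i))\<bar> \<le> X ^ (2 * n) * S"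
        using bound[of \<pi>] by (simp add: abs_mult abs_prod)
    qed
    also have "\<dots> = fact N * (X ^ (2 * n) * S)" by (simp add: card_permutations[of _ N])
    also have "\<dots> \<le> fact (2 * n) * (X ^ (2 * n) * S)"
      using N2 S0 X by (intro mult_right_mono fact_mono) auto
    finally show ?thesis using \<open>1 \<le> \<bar>det W\<bar>\<close>
      unfolding C_def S_def a_def b_def d_def p_def \<alpha>_def \<beta>_def by (simp add: mult_ac)
  qed
  have "0 < C" using X by (simp add: C_def)
  then show ?thesis using main that by blast
qed

text \<open>Otherwise every prime polynomial obeys a lower bound with exponent \<open>v\<close>: the
  long ones by assumption, the finitely many short ones after shrinking the constant. By
  multiplicativity \<open>P k\<close> obeys it too, so its value is at least a constant times
  \<open>exp (- h * v * A k)\<close>; this contradicts \<open>h * v < u\<close> for large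
  \<open>A k\<close>.\<close>

lemma prime_elem_good_approximation:
  fixes \<xi> :: real and P :: "nat \<Rightarrow> int poly" and A :: "nat \<Rightarrow> real"
  assumes tr: "\<not> algebraic \<xi>"
    and P: "\<And>k. k \<ge> k0 \<Longrightarrow> P k \<noteq> 0 \<and> degree (P k) \<le> n"
    and len: "\<And>k. k \<ge> k0 \<Longrightarrow> plen (of_int_poly (P k)) \<le> exp (h * A k)"
    and val: "\<And>k. k \<ge> k0 \<Longrightarrow> \<bar>poly (of_int_poly (P k)) \<xi>\<bar> \<le> exp (- u * A k)"
    and lim: "filterlim A at_top sequentially"
    and v: "0 \<le> v" "h * v < u"
  obtains Q :: "int poly" where "prime_elem Q" "0 < degree Q" "degree Q \<le> n" "M < plen (of_int_poly Q)"
    "\<bar>poly (of_int_poly Q) \<xi>\<bar> < plen (of_int_poly Q) powr - v"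
proof -
  have "\<exists>Q :: int poly. prime_elem Q \<and> 0 < degree Q \<and> degree Q \<le> n \<and> M < plen (of_int_poly Q) \<and>
    \<bar>poly (of_int_poly Q) \<xi>\<bar> < plen (of_int_poly Q) powr - v"
  proof (rule ccontr)
    assume neg: "\<not> ?thesis"
    define F where "F = {Q :: int poly. degree Q \<le> n \<and> plen (of_int_poly Q) \<le> M}"
    \<comment> \<open>The inserted 1 makes the set nonempty and its minimum at most 1; transcendence
      makes the minimum positive.\<close>
    define G where "G = insert 1 ((\<lambda>Q. \<bar>poly (of_int_poly Q) \<xi>\<bar>) ` (F - {0}))"
    have finG: "finite G" unfolding G_def F_def using finite_int_polys_bounded by auto
    have nz: "poly (of_int_poly Q) \<xi> \<noteq> 0" if "Q \<noteq> 0" for Q :: "int poly"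
      using int_poly_nonroot[OF tr that] .
    define \<kappa> where "\<kappa> = Min G"
    have \<kappa>: "0 < \<kappa>" unfolding \<kappa>_def using finG nz by (subst Min_gr_iff) (auto simp: G_def)
    have \<kappa>1: "\<kappa> \<le> 1" unfolding \<kappa>_def using finG by (intro Min_le) (auto simp: G_def)
    have prim: "\<kappa> * plen (of_int_poly Q) powr - v \<le> \<bar>poly (of_int_poly Q) \<xi>\<bar>"
      if Q: "prime_elem Q" "0 < degree Q" "degree Q \<le> n" for Q :: "int poly"
    proof (cases "plen (of_int_poly Q) \<le> M")
      case True
      have "1 \<le> plen (of_int_poly Q)" using Q plen_ge_1 by auto
      then have "plen (of_int_poly Q) powr - v \<le> 1"
        using v powr_mono[of "-v" 0 "plen (of_int_poly Q)"] by (auto split: if_splits)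
      then have "\<kappa> * plen (of_int_poly Q) powr - v \<le> \<kappa> * 1" using \<kappa> by (intro mult_left_mono) auto
      also have "\<kappa> * 1 \<le> \<bar>poly (of_int_poly Q) \<xi>\<bar>"
        unfolding \<kappa>_def mult_1_right using finG True Q by (intro Min_le) (auto simp: G_def F_def)
      finally show ?thesis .
    next
      case False
      then have "plen (of_int_poly Q) powr - v \<le> \<bar>poly (of_int_poly Q) \<xi>\<bar>" using neg Q by force
      moreover have "\<kappa> * plen (of_int_poly Q) powr - v \<le> 1 * plen (of_int_poly Q) powr - v"
        using \<kappa>1 by (intro mult_right_mono) auto
      ultimately show ?thesis by simp
    qed
    obtain c where c: "0 < c" "\<And>P :: int poly. P \<noteq> 0 \<Longrightarrow> degree P \<le> n \<Longrightarrow>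
        c * plen (of_int_poly P) powr - v \<le> \<bar>poly (of_int_poly P) \<xi>\<bar>"
      using poly_ge_of_primes_ge[OF \<kappa> v(1) prim] by blast
    have ev: "c \<le> exp (- (u - h * v) * A k)" if k: "k \<ge> k0" for k
    proof -
      have "exp (h * A k) powr - v \<le> plen (of_int_poly (P k)) powr - v"
        using len[OF k] plen_ge_1[of "P k"] P[OF k] v by (intro powr_mono2') auto
      then have "c * exp (h * A k) powr - v \<le> c * plen (of_int_poly (P k)) powr - v"
        using c(1) by simp
      also have "\<dots> \<le> exp (- u * A k)" using c(2) P[OF k] val[OF k] order_trans by blast
      finally have "c * exp (- (v * (h * A k))) \<le> exp (- u * A k)" by (simp add: powr_def)
      then have "c * exp (- (v * (h * A k))) * exp (v * (h * A k)) \<le> exp (- u * A k) * exp (v * (h * A k))"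
        by (intro mult_right_mono) auto
      then show ?thesis by (simp add: mult.assoc flip: exp_add) (simp add: algebra_simps)
    qed
    have "filterlim (\<lambda>k. (u - h * v) * A k) at_top sequentially"
      using v lim by (intro filterlim_tendsto_pos_mult_at_top[OF tendsto_const]) auto
    then have "filterlim (\<lambda>k. - ((u - h * v) * A k)) at_bot sequentially"
      by (simp add: filterlim_uminus_at_bot)
    then have "((\<lambda>k. exp (- ((u - h * v) * A k))) \<longlongrightarrow> 0) sequentially"
      by (rule filterlim_compose[OF exp_at_bot])
    then have "eventually (\<lambda>k. exp (- ((u - h * v) * A k)) < c) sequentially"
      using c(1) by (rule order_tendstoD)
    then have "eventually (\<lambda>k. k \<ge> k0 \<and> exp (- ((u - h * v) * A k)) < c) sequentially"
      using eventually_ge_at_top[of k0] by eventually_elim auto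
    then obtain k where "k \<ge> k0" "exp (- ((u - h * v) * A k)) < c"
      by (auto dest!: eventually_happens)
    with ev[of k] show False by (simp add: algebra_simps)
  qed
  then show ?thesis using that by blast
qed

lemma first_crossing:
  fixes R :: "nat \<Rightarrow> bool"
  assumes "eventually R sequentially" "\<not> R k1"
  shows "\<exists>k\<ge>k1. \<not> R k \<and> R (Suc k)"
proof (rule ccontr)
  assume neg: "\<not> ?thesis"
  obtain K where K: "R k" if "K \<le> k" for k using assms(1) by (auto simp: eventually_sequentially)
  have "\<not> R (k1 + j)" for j
  proof (induction j)
    case (Suc j)
    then show ?case using neg by (metis add_Suc_right le_add1)
  qed (use assms(2) in simp)
  then show False using K[of "k1 + K"] by simp
qed

text \<open>
  The argument of Bugeaud and Schleischitz: compare a prime factor \<open>Q\<close> of some \<open>P k\<close> that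
  inherits its quality of approximation with a suitable other \<open>P k\<close> coprime to \<open>Q\<close>.
  If \<open>degree Q < n\<close>, take the \<open>P k\<close> of length just below that of \<open>Q\<close>; if \<open>degree Q = n\<close>, take
  the first one with a smaller value at \<open>\<xi>\<close>.
\<close>

lemma uniform_poly_approximation_bound:
  fixes \<xi> :: real and P :: "nat \<Rightarrow> int poly" and A :: "nat \<Rightarrow> real"
  assumes tr: "\<not> algebraic \<xi>" and n: "2 \<le> n"
    and P: "\<And>k. k \<ge> k0 \<Longrightarrow> P k \<noteq> 0 \<and> degree (P k) \<le> n"
    and len: "\<And>k. k \<ge> k0 \<Longrightarrow> plen (of_int_poly (P k)) \<le> exp (h * A k)"
    and val: "\<And>k. k \<ge> k0 \<Longrightarrow> \<bar>poly (of_int_poly (P k)) \<xi>\<bar> \<le> exp (- u * A k)"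
    and step: "\<And>k. k \<ge> k0 \<Longrightarrow> A (Suc k) \<le> \<sigma> * A k"
    and lim: "filterlim A at_top sequentially"
    and pos: "0 < h" "0 < u" "1 \<le> \<sigma>"
  shows "u \<le> h * max (real (2 * n - 2) * \<sigma>) (real n * \<sigma> + real (n - 1))"
proof (rule ccontr)
  assume "\<not> ?thesis"
  then have "h * max (real (2 * n - 2) * \<sigma>) (real n * \<sigma> + real (n - 1)) < u" by simp
  moreover have "h * (real (2 * n - 2) * \<sigma>) \<le> h * max (real (2 * n - 2) * \<sigma>) (real n * \<sigma> + real (n - 1))"
    "h * (real n * \<sigma> + real (n - 1)) \<le> h * max (real (2 * n - 2) * \<sigma>) (real n * \<sigma> + real (n - 1))"
    using pos by (intro mult_left_mono; simp)+
  ultimately have c1: "h * (real (2 * n - 2) * \<sigma>) < u" and c2: "h * (real n * \<sigma> + real (n - 1)) < u"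
    by linarith+
  \<comment> \<open>\<open>w\<close> is the exponent of \<open>P k\<close> against its own length
    bound, \<open>W\<close> the exponent against the length bound of its successor.\<close>
  define w where "w = u / h"
  define W where "W = u / (h * \<sigma>)"
  have wpos: "0 < w" "0 < W" using pos by (auto simp: w_def W_def)
  have W_big: "real (2 * n - 2) < W" using c1 pos by (simp add: W_def field_simps)
  have "W \<le> w" using pos by (simp add: w_def W_def field_simps)
  have e1: "real n / W + real (n - 1) / w < 1"
    using c2 pos by (simp add: W_def w_def field_simps)
  \<comment> \<open>In degree n the two summands of the resultant estimate carry the two mirrored
    sums \<open>e1\<close> and \<open>e2\<close>. The second is the smaller one, because
    \<open>W \<le> w\<close>.\<close>
  have e2: "real (n - 1) / W + real n / w < 1"
  proof -
    have "1 / w \<le> 1 / W" using \<open>W \<le> w\<close> wpos by (intro divide_left_mono) auto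
    moreover have "real n / W = real (n - 1) / W + 1 / W" "real n / w = real (n - 1) / w + 1 / w"
      using n by (auto simp: add_divide_distrib[symmetric])
    ultimately show ?thesis using e1 by linarith
  qed
  \<comment> \<open>The prime factor only inherits exponents \<open>v\<close> below
    \<open>w\<close>; the strict inequalities leave room for one.\<close>
  have "eventually (\<lambda>v. real n / W + real (n - 1) / v < 1) (at_left w)"
    by (rule order_tendstoD(2)[OF _ e1]) (use wpos in \<open>auto intro!: tendsto_intros\<close>)
  moreover have "eventually (\<lambda>v. real (n - 1) / W + real n / v < 1) (at_left w)"
    by (rule order_tendstoD(2)[OF _ e2]) (use wpos in \<open>auto intro!: tendsto_intros\<close>)
  moreover have "eventually (\<lambda>v. real (2 * n - 2) < v) (at_left w)"
    using W_big \<open>W \<le> w\<close> by (intro order_tendstoD(1)[OF tendsto_ident_at]) auto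
  moreover have "eventually (\<lambda>v. v < w) (at_left w)" by (simp add: eventually_at_filter)
  ultimately have "eventually (\<lambda>v. real n / W + real (n - 1) / v < 1 \<and> real (n - 1) / W + real n / v < 1
      \<and> real (2 * n - 2) < v \<and> v < w) (at_left w)"
    by eventually_elim auto
  then obtain v where v1: "real n / W + real (n - 1) / v < 1" and v2: "real (n - 1) / W + real n / v < 1"
    and v_big: "real (2 * n - 2) < v" and "v < w"
    by (auto dest!: eventually_happens)
  have v0: "0 < v" using v_big by linarith
  have hv: "h * v < u" using \<open>v < w\<close> pos by (simp add: w_def field_simps)

  obtain C0 where C0: "1 \<le> C0" "\<And>p q. degree p \<le> n \<Longrightarrow> degree q \<le> n \<Longrightarrow> degree (p * q) \<le> n \<Longrightarrow>
      plen p * plen q \<le> C0 * plen (p * q)"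
    by (rule plen_mult_ge[of n]) blast
  obtain C1 where C1: "0 < C1"
    "\<And>P Q :: int poly. prime_elem Q \<Longrightarrow> \<not> Q dvd P \<Longrightarrow> 0 < degree P \<Longrightarrow> degree P \<le> n \<Longrightarrow>
      0 < degree Q \<Longrightarrow> degree Q \<le> n \<Longrightarrow>
      1 \<le> C1 * (plen (of_int_poly P) ^ (degree Q - 1) * plen (of_int_poly Q) ^ degree P * \<bar>poly (of_int_poly P) \<xi>\<bar>
             + plen (of_int_poly P) ^ degree Q * plen (of_int_poly Q) ^ (degree P - 1) * \<bar>poly (of_int_poly Q) \<xi>\<bar>)"
    by (rule resultant_bound[of n \<xi>]) blast

  have "eventually (\<lambda>k. 0 < A k) sequentially" using lim by (simp add: filterlim_at_top_dense)
  then obtain k1' where k1': "\<And>k. k \<ge> k1' \<Longrightarrow> 0 < A k" by (auto simp: eventually_sequentially)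
  define k1 where "k1 = max k0 k1'"
  have Apos: "0 < A k" if "k \<ge> k1" for k using k1' that by (auto simp: k1_def)
  have ge0: "k \<ge> k0" if "k \<ge> k1" for k using that by (simp add: k1_def)
  have degP: "0 < degree (P k)" if k: "k \<ge> k1" for k
  proof (rule ccontr)
    assume "\<not> 0 < degree (P k)"
    then obtain a where a: "P k = [:a:]" by (metis degree_eq_zeroE gr0I)
    then have "a \<noteq> 0" using P[OF ge0[OF k]] by auto
    then have "1 \<le> \<bar>real_of_int a\<bar>" by linarith
    also have "\<dots> \<le> exp (- u * A k)" using val[OF ge0[OF k]] by (simp add: a of_int_hom.map_poly_pCons_hom)
    also have "\<dots> < 1" using pos Apos[OF k] by simp
    finally show False by simp
  qed

  define \<eta> where "\<eta> = min (1 - (real n / W + real (n - 1) / v)) (1 - (real (n - 1) / W + real n / v))"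
  have \<eta>: "0 < \<eta>" using v1 v2 by (simp add: \<eta>_def)

  \<comment> \<open>\<open>t1\<close> and \<open>t2\<close> are the resultant bounds as functions of
    the length \<open>H\<close> of \<open>Q\<close>, for \<open>degree Q < n\<close> and
    \<open>degree Q = n\<close>; both tend to 0.\<close>
  have t1: "((\<lambda>H. C1 * (H powr (real (2 * n - 2) - W) * C0 powr W + H powr (real (2 * n - 2) - v))) \<longlongrightarrow> C1 * (0 * C0 powr W + 0)) at_top"
    using W_big v_big by (intro tendsto_intros tendsto_neg_powr filterlim_ident) auto
  have t2: "((\<lambda>H. C1 * (2 * H powr (- (\<eta> * v)))) \<longlongrightarrow> C1 * (2 * 0)) at_top"
    using \<eta> v0 by (intro tendsto_intros tendsto_neg_powr filterlim_ident) auto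
  have "eventually (\<lambda>H. C1 * (H powr (real (2 * n - 2) - W) * C0 powr W + H powr (real (2 * n - 2) - v)) < 1
      \<and> C1 * (2 * H powr (- (\<eta> * v))) < 1) at_top"
    by (intro eventually_conj order_tendstoD(2)[OF t1] order_tendstoD(2)[OF t2]) auto
  then obtain M0 where M0: "\<And>H. H \<ge> M0 \<Longrightarrow> C1 * (H powr (real (2 * n - 2) - W) * C0 powr W + H powr (real (2 * n - 2) - v)) < 1"
    "\<And>H. H \<ge> M0 \<Longrightarrow> C1 * (2 * H powr (- (\<eta> * v))) < 1"
    by (auto simp: eventually_at_top_linorder)
  \<comment> \<open>Besides making both resultant bounds less than 1, a length above
    \<open>M\<close> ensures that neither crossing has happened at \<open>k1\<close>: the length
    bound of \<open>P k1\<close> is below \<open>H / C0\<close>, and \<open>exp (- u * A k1)\<close>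
    exceeds \<open>\<bar>Q(\<xi>)\<bar>\<close>.\<close>
  define M where "M = max (max M0 1) (max (C0 * exp (h * A k1)) (exp (u * A k1 / v)))"
  obtain Q :: "int poly" where Q: "prime_elem Q" "0 < degree Q" "degree Q \<le> n" "M < plen (of_int_poly Q)"
    "\<bar>poly (of_int_poly Q) \<xi>\<bar> < plen (of_int_poly Q) powr - v"
    using prime_elem_good_approximation[OF tr P len val lim less_imp_le[OF v0] hv, where M = M] by blast
  define H where "H = plen (of_int_poly Q)"
  define d where "d = degree Q"
  have H: "M0 \<le> H" "1 < H" "C0 * exp (h * A k1) < H" "exp (u * A k1 / v) < H"
    using Q(4) by (auto simp: M_def H_def)
  have Qnz: "Q \<noteq> 0" using Q by auto
  show False
  proof (cases "d < n")
    case True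
    have "h * A k1 < ln (H / C0)"
    proof -
      have "exp (h * A k1) < H / C0" using H C0(1) by (simp add: field_simps)
      then show ?thesis using H C0(1) by (subst exp_less_cancel_iff[symmetric]) auto
    qed
    then have "A k1 < ln (H / C0) / h" using pos by (simp add: field_simps)
    moreover have "eventually (\<lambda>k. ln (H / C0) / h \<le> A k) sequentially"
      using lim by (simp add: filterlim_at_top)
    \<comment> \<open>The length bound of \<open>P k\<close> is still below \<open>H / C0\<close>,
      so \<open>Q\<close> is too long to divide it; the bound of the successor has reached
      \<open>H / C0\<close>, so by \<open>step\<close> the number \<open>A k\<close> is large and
      \<open>P k\<close> is small at \<xi>.\<close>
    ultimately obtain k where k: "k1 \<le> k" "A k < ln (H / C0) / h" "ln (H / C0) / h \<le> A (Suc k)"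
      using first_crossing[of "\<lambda>k. ln (H / C0) / h \<le> A k" k1] by (auto simp: not_le)
    define p where "p = degree (P k)"
    have p: "0 < p" "p \<le> n" using degP[OF k(1)] P[OF ge0[OF k(1)]] by (auto simp: p_def)
    define a where "a = plen (of_int_poly (P k))"
    have "exp (h * A k) < H / C0"
    proof -
      have "h * A k < ln (H / C0)" using k(2) pos by (simp add: field_simps)
      then have "exp (h * A k) < exp (ln (H / C0))" by simp
      then show ?thesis using H C0(1) by simp
    qed
    then have a: "a < H / C0" using len[OF ge0[OF k(1)]] by (simp add: a_def)
    have "H / C0 \<le> H" using C0(1) H by (simp add: field_simps)
    then have aH: "a \<le> H" using a by simp
    have a1: "1 \<le> a" unfolding a_def using plen_ge_1 P[OF ge0[OF k(1)]] by auto
    have nd: "\<not> Q dvd P k"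
    proof
      assume "Q dvd P k"
      then obtain R where R: "P k = Q * R" by auto
      have Rnz: "R \<noteq> 0" using R P[OF ge0[OF k(1)]] by auto
      have deg: "degree (P k) = degree Q + degree R" using Rnz Qnz by (simp add: R degree_mult_eq)
      have "H * plen (of_int_poly R) \<le> C0 * a"
        unfolding H_def a_def R of_int_poly_hom.hom_mult
        using deg p by (intro C0(2)) (simp_all add: p_def R flip: of_int_poly_hom.hom_mult)
      moreover have "H * 1 \<le> H * plen (of_int_poly R)"
        using plen_ge_1[OF Rnz] H by (intro mult_left_mono) auto
      moreover have "C0 * a < H" using a C0(1) by (simp add: field_simps)
      ultimately show False by simp
    qed
    have Ak: "ln (H / C0) / (h * \<sigma>) \<le> A k"
      using order_trans[OF k(3) step[OF ge0[OF k(1)]]] pos by (simp add: field_simps)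
    have "\<bar>poly (of_int_poly (P k)) \<xi>\<bar> \<le> exp (- u * A k)" by (rule val[OF ge0[OF k(1)]])
    also have "\<dots> \<le> exp (- W * ln (H / C0))"
    proof -
      have "W * ln (H / C0) = u * (ln (H / C0) / (h * \<sigma>))" by (simp add: W_def)
      also have "\<dots> \<le> u * A k" using Ak pos by (intro mult_left_mono) auto
      finally show ?thesis by simp
    qed
    also have "\<dots> = H powr - W * C0 powr W"
      using H C0(1) by (simp add: powr_def ln_div exp_add[symmetric] algebra_simps)
    finally have Pxi: "\<bar>poly (of_int_poly (P k)) \<xi>\<bar> \<le> H powr - W * C0 powr W" .
    \<comment> \<open>Since \<open>d \<le> n - 1\<close> and \<open>p \<le> n\<close>, both exponent
      sums \<open>(d - 1) + p\<close> and \<open>d + (p - 1)\<close> are at most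
      \<open>2 * n - 2\<close>.\<close>
    have pw: "a ^ i * H ^ j \<le> H powr real (2 * n - 2)" if "i + j \<le> 2 * n - 2" for i j
    proof -
      have "a ^ i * H ^ j \<le> H ^ i * H ^ j" using aH a1 H by (intro mult_right_mono power_mono) auto
      also have "\<dots> = H ^ (i + j)" by (simp add: power_add)
      also have "\<dots> \<le> H ^ (2 * n - 2)" using H that by (intro power_increasing) auto
      also have "\<dots> = H powr real (2 * n - 2)" using H by (simp add: powr_realpow)
      finally show ?thesis .
    qed
    have "1 \<le> C1 * (a ^ (d - 1) * H ^ p * \<bar>poly (of_int_poly (P k)) \<xi>\<bar> + a ^ d * H ^ (p - 1) * \<bar>poly (of_int_poly Q) \<xi>\<bar>)"
      unfolding a_def H_def d_def p_def
      using C1(2)[OF Q(1) nd degP[OF k(1)] conjunct2[OF P[OF ge0[OF k(1)]]] Q(2,3)] .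
    also have "\<dots> \<le> C1 * (H powr real (2 * n - 2) * (H powr - W * C0 powr W) + H powr real (2 * n - 2) * H powr - v)"
    proof (intro mult_left_mono add_mono)
      show "a ^ (d - 1) * H ^ p * \<bar>poly (of_int_poly (P k)) \<xi>\<bar> \<le> H powr real (2 * n - 2) * (H powr - W * C0 powr W)"
        using True p Q(2) a1 H by (intro mult_mono pw Pxi) (auto simp: d_def)
      show "a ^ d * H ^ (p - 1) * \<bar>poly (of_int_poly Q) \<xi>\<bar> \<le> H powr real (2 * n - 2) * H powr - v"
        using True p Q(2,5) a1 H by (intro mult_mono pw) (auto simp: d_def H_def)
    qed (use C1 in auto)
    also have "\<dots> = C1 * (H powr (real (2 * n - 2) - W) * C0 powr W + H powr (real (2 * n - 2) - v))"
      by (simp add: powr_add[symmetric] mult.assoc[symmetric])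
    also have "\<dots> < 1" by (rule M0(1)[OF H(1)])
    finally show False by simp
  next
    case False
    then have dn: "d = n" using Q(3) by (simp add: d_def)
    have Qxi: "poly (of_int_poly Q) \<xi> \<noteq> 0"
      by (rule int_poly_nonroot[OF tr Qnz])
    define B where "B = - ln \<bar>poly (of_int_poly Q) \<xi>\<bar>"
    have expB: "\<bar>poly (of_int_poly Q) \<xi>\<bar> = exp (- B)" using Qxi by (simp add: B_def)
    have vB: "v * ln H < B"
    proof -
      have "exp (- B) < exp (- v * ln H)" using Q(5) H expB by (simp add: H_def powr_def)
      then show ?thesis by simp
    qed
    have Hexp: "H \<le> exp (B / v)"
    proof -
      have "ln H \<le> B / v" using vB v0 by (simp add: field_simps)
      then have "exp (ln H) \<le> exp (B / v)" by simp
      then show ?thesis using H by simp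
    qed
    have "A k1 < B / u"
    proof -
      have "u * A k1 / v < ln H" using H(2,4) by (subst exp_less_cancel_iff[symmetric]) simp
      then have "u * A k1 < v * ln H" using v0 by (simp add: field_simps)
      then show ?thesis using vB pos by (simp add: field_simps)
    qed
    moreover have "eventually (\<lambda>k. B / u < A k) sequentially"
      using lim by (simp add: filterlim_at_top_dense)
    ultimately obtain k where k: "k1 \<le> k" "A k \<le> B / u" "B / u < A (Suc k)"
      using first_crossing[of "\<lambda>k. B / u < A k" k1] by (auto simp: not_less)
    \<comment> \<open>Now the polynomial after the crossing is taken: its value is below
      \<open>\<bar>Q(\<xi>)\<bar>\<close>, and its length is controlled through its predecessor by
      \<open>step\<close>.\<close>
    define k' where "k' = Suc k"
    have k': "k' \<ge> k1" using k by (simp add: k'_def)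
    define p where "p = degree (P k')"
    have p: "0 < p" "p \<le> n" using degP[OF k'] P[OF ge0[OF k']] by (auto simp: p_def)
    define a where "a = plen (of_int_poly (P k'))"
    have a1: "1 \<le> a" unfolding a_def using plen_ge_1 P[OF ge0[OF k']] by auto
    have Pxi: "\<bar>poly (of_int_poly (P k')) \<xi>\<bar> < exp (- B)"
    proof -
      have "B < u * A k'" using k(3) pos by (simp add: k'_def field_simps)
      then show ?thesis using val[OF ge0[OF k']] by (smt (verit) exp_less_cancel_iff minus_mult_left)
    qed
    have "A k' \<le> \<sigma> * (B / u)"
      using step[OF ge0[OF k(1)]] k(2) pos unfolding k'_def by (smt (verit) mult_left_mono)
    then have "h * A k' \<le> B / W" using pos by (simp add: W_def field_simps)
    then have aexp: "a \<le> exp (B / W)" using len[OF ge0[OF k']] unfolding a_def by (meson exp_le_cancel_iff order_trans)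
    \<comment> \<open>As \<open>Q\<close> has full degree n, a multiple of it of degree at most n is
      an integer multiple, whose value at \<xi> cannot be smaller than that of
      \<open>Q\<close>.\<close>
    have nd: "\<not> Q dvd P k'"
    proof
      assume "Q dvd P k'"
      then obtain R where R: "P k' = Q * R" by auto
      have Rnz: "R \<noteq> 0" using R P[OF ge0[OF k']] by auto
      have "degree (P k') = degree Q + degree R" using Rnz Qnz by (simp add: R degree_mult_eq)
      then have "degree R = 0" using dn p by (simp add: d_def p_def)
      then obtain r where r: "R = [:r:]" by (rule degree_eq_zeroE)
      then have "r \<noteq> 0" using Rnz by auto
      then have "1 \<le> \<bar>real_of_int r\<bar>" by linarith
      then have "exp (- B) * 1 \<le> exp (- B) * \<bar>real_of_int r\<bar>" by (intro mult_left_mono) auto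
      also have "\<dots> = \<bar>poly (of_int_poly (P k')) \<xi>\<bar>"
        unfolding R of_int_poly_hom.hom_mult r poly_mult abs_mult expB
        by (simp add: of_int_hom.map_poly_pCons_hom)
      finally show False using Pxi by simp
    qed
    have B0: "0 < B" using vB v0 H(2) by (smt (verit) ln_gt_zero mult_pos_pos)
    \<comment> \<open>Both lengths are measured by the common scale \<open>B\<close>, the negative
      logarithm of \<open>\<bar>Q(\<xi>)\<bar>\<close>.\<close>
    have pw: "a ^ i * H ^ j \<le> exp (B * (real i / W + real j / v))" for i j
    proof -
      have "a ^ i * H ^ j \<le> exp (B / W) ^ i * exp (B / v) ^ j"
        using aexp Hexp a1 H by (intro mult_mono power_mono) auto
      also have "\<dots> = exp (B * (real i / W + real j / v))"
        by (simp flip: exp_of_nat_mult exp_add) (simp add: algebra_simps)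
      finally show ?thesis .
    qed
    have mon: "exp (B * (real i / W + real j / v)) * exp (- B) \<le> exp (- \<eta> * B)"
      if "real i / W + real j / v \<le> 1 - \<eta>" for i j
    proof -
      have "B * (real i / W + real j / v) \<le> B * (1 - \<eta>)" using that B0 by (intro mult_left_mono) auto
      then show ?thesis by (simp flip: exp_add) (simp add: algebra_simps)
    qed
    have "1 \<le> C1 * (a ^ (d - 1) * H ^ p * \<bar>poly (of_int_poly (P k')) \<xi>\<bar> + a ^ d * H ^ (p - 1) * \<bar>poly (of_int_poly Q) \<xi>\<bar>)"
      unfolding a_def H_def d_def p_def
      using C1(2)[OF Q(1) nd degP[OF k'] conjunct2[OF P[OF ge0[OF k']]] Q(2,3)] .
    also have "\<dots> \<le> C1 * (exp (- \<eta> * B) + exp (- \<eta> * B))"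
    proof (intro mult_left_mono add_mono)
      have le: "real (n - 1) / W + real p / v \<le> 1 - \<eta>"
      proof -
        have "real p / v \<le> real n / v" using p v0 by (intro divide_right_mono) auto
        then show ?thesis by (simp add: \<eta>_def)
      qed
      have "a ^ (d - 1) * H ^ p * \<bar>poly (of_int_poly (P k')) \<xi>\<bar>
          \<le> exp (B * (real (d - 1) / W + real p / v)) * exp (- B)"
        using Pxi a1 H by (intro mult_mono pw) auto
      also have "\<dots> \<le> exp (- \<eta> * B)" using le dn by (intro mon) auto
      finally show "a ^ (d - 1) * H ^ p * \<bar>poly (of_int_poly (P k')) \<xi>\<bar> \<le> exp (- \<eta> * B)" .
    next
      have le: "real n / W + real (p - 1) / v \<le> 1 - \<eta>"
      proof -
        have "real (p - 1) / v \<le> real (n - 1) / v" using p v0 by (intro divide_right_mono) auto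
        then show ?thesis by (simp add: \<eta>_def)
      qed
      have "a ^ d * H ^ (p - 1) * \<bar>poly (of_int_poly Q) \<xi>\<bar>
          \<le> exp (B * (real d / W + real (p - 1) / v)) * exp (- B)"
        using expB a1 H by (intro mult_mono pw) auto
      also have "\<dots> \<le> exp (- \<eta> * B)" using le dn by (intro mon) auto
      finally show "a ^ d * H ^ (p - 1) * \<bar>poly (of_int_poly Q) \<xi>\<bar> \<le> exp (- \<eta> * B)" .
    qed (use C1 in auto)
    also have "\<dots> \<le> C1 * (2 * H powr (- (\<eta> * v)))"
    proof -
      have "exp (- \<eta> * B) \<le> H powr (- (\<eta> * v))"
        using vB \<eta> H by (simp add: powr_def mult.assoc)
      then show ?thesis using C1(1) by (intro mult_left_mono) auto
    qed
    also have "\<dots> < 1" by (rule M0(2)[OF H(1)])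
    finally show False by simp
  qed
qed

section \<open>Exterior products of minimal points\<close>

text \<open>Coordinates of the exterior product of a multivector with a vector: the coordinate at
  \<open>I\<close> is a minor expanded along the new vector, and the sign counts the indices that
  \<open>i\<close> has to pass. Iterating from \<open>\<lambda>_. 1\<close> gives all minors, so
  linear independence becomes nonvanishing of some coordinate.\<close>

definition wedge :: "(nat set \<Rightarrow> int) \<Rightarrow> (nat \<Rightarrow> int) \<Rightarrow> nat set \<Rightarrow> int" where
  "wedge \<omega> v I = (\<Sum>i\<in>I. (-1) ^ card {l\<in>I. i < l} * v i * \<omega> (I - {i}))"

text \<open>The terms in which the indices i and l are removed in opposite orders cancel: removing
  the larger one first lowers by one the number of indices above the smaller.\<close>

lemma wedge_self:
  assumes "finite I"
  shows "wedge (wedge \<omega> v) v I = 0"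
proof -
  define c where "c J i = card {l\<in>J. i < l}" for J and i :: nat
  define f where "f i l = (-1) ^ (c I i + c (I - {i}) l) * v i * v l * \<omega> (I - {i} - {l})" for i l
  have eq: "wedge (wedge \<omega> v) v I = (\<Sum>i\<in>I. \<Sum>l\<in>I-{i}. f i l)"
    unfolding wedge_def f_def c_def sum_distrib_left by (simp add: power_add mult_ac)
  have anti: "f l i = - f i l" if "i \<in> I" "l \<in> I" "i < l" for i l
  proof -
    have "{m\<in>I-{l}. i < m} = {m\<in>I. i < m} - {l}" by auto
    moreover have "l \<in> {m\<in>I. i < m}" using that by auto
    moreover have "finite {m\<in>I. i < m}" using assms by simp
    ultimately have 1: "Suc (c (I - {l}) i) = c I i" unfolding c_def
      by (simp only: card_Suc_Diff1)
    have 2: "c (I - {i}) l = c I l" unfolding c_def using that by (intro arg_cong[of _ _ card]) auto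
    have "c I i + c (I - {i}) l = Suc (c I l + c (I - {l}) i)" using 1 2 by simp
    then have "(-1::int) ^ (c I i + c (I - {i}) l) = - ((-1) ^ (c I l + c (I - {l}) i))"
      by simp
    moreover have "I - {i} - {l} = I - {l} - {i}" by auto
    ultimately show ?thesis by (simp add: f_def)
  qed
  have anti': "f l i = - f i l" if "i \<in> I" "l \<in> I - {i}" for i l
  proof (cases "i < l")
    case True
    then show ?thesis using anti[of i l] that by blast
  next
    case False
    then have "f i l = - f l i" using anti[of l i] that by force
    then show ?thesis by linarith
  qed
  have inner: "(\<Sum>l\<in>I-{i}. g l) = (\<Sum>l\<in>I. if l = i then 0 else g l)" for i and g :: "nat \<Rightarrow> int"
    by (rule sum.mono_neutral_cong_left) (use assms in auto)
  have swap: "(\<Sum>i\<in>I. \<Sum>l\<in>I-{i}. f i l) = (\<Sum>l\<in>I. \<Sum>i\<in>I-{l}. f i l)"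
    unfolding inner by (subst sum.swap) (intro sum.cong refl if_cong, auto)
  have "(\<Sum>l\<in>I. \<Sum>i\<in>I-{l}. f i l) = (\<Sum>l\<in>I. \<Sum>i\<in>I-{l}. - f l i)"
    by (intro sum.cong refl) (simp add: anti'[symmetric])
  then show ?thesis unfolding eq using swap by (simp add: sum_negf)
qed

lemma wedge_lincomb:
  "wedge \<omega> (\<lambda>i. a * v i - b * w i) I = a * wedge \<omega> v I - b * wedge \<omega> w I"
  unfolding wedge_def sum_distrib_left sum_subtractf[symmetric]
  by (intro sum.cong) (auto simp: algebra_simps)

lemma wedge_bound:
  fixes B V :: real
  assumes "finite I" "\<And>i. i \<in> I \<Longrightarrow> \<bar>of_int (v i)\<bar> \<le> V" "\<And>i. i \<in> I \<Longrightarrow> \<bar>of_int (\<omega> (I - {i}))\<bar> \<le> B" "0 \<le> V"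
  shows "\<bar>of_int (wedge \<omega> v I)\<bar> \<le> real (card I) * (V * B)"
proof -
  have "\<bar>real_of_int (wedge \<omega> v I)\<bar> \<le> (\<Sum>i\<in>I. \<bar>real_of_int ((-1) ^ card {l\<in>I. i < l} * v i * \<omega> (I - {i}))\<bar>)"
    unfolding wedge_def of_int_sum by (rule sum_abs)
  also have "\<dots> \<le> (\<Sum>i\<in>I. V * B)"
  proof (rule sum_mono)
    fix i assume "i \<in> I"
    then have "\<bar>real_of_int (v i)\<bar> * \<bar>real_of_int (\<omega> (I - {i}))\<bar> \<le> V * B"
      using assms by (intro mult_mono) auto
    then show "\<bar>real_of_int ((-1) ^ card {l\<in>I. i < l} * v i * \<omega> (I - {i}))\<bar> \<le> V * B"
      by (simp add: abs_mult power_abs)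
  qed
  finally show ?thesis by simp
qed

text \<open>The form in which transcendence enters the geometry of the approximating points.\<close>

lemma powers_linearly_independent:
  fixes \<xi> :: real and a :: "nat \<Rightarrow> int"
  assumes "\<not> algebraic \<xi>" "finite I" "(\<Sum>i\<in>I. of_int (a i) * \<xi> ^ i) = 0" "i \<in> I"
  shows "a i = 0"
proof (rule ccontr)
  assume "a i \<noteq> 0"
  define p :: "real poly" where "p = (\<Sum>i\<in>I. monom (of_int (a i)) i)"
  have c: "coeff p j = (if j \<in> I then of_int (a j) else 0)" for j
    using assms(2) by (simp add: p_def coeff_sum)
  have "poly p \<xi> = 0" using assms(3) by (simp add: p_def poly_sum poly_monom)
  moreover have "p \<noteq> 0" using c[of i] \<open>a i \<noteq> 0\<close> assms(4) by auto
  ultimately show False using assms(1) algebraicI[of p \<xi>] by (auto simp: c)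
qed

text \<open>\<open>x m\<close> is the m-th minimal point and \<open>Y m\<close> its exact error.
  That the points beat all smaller denominators enters later, through the upper bound on
  \<open>Y m\<close> by the next height.\<close>

locale minimal_points =
  fixes \<xi> :: real and n :: nat and x :: "nat \<Rightarrow> nat \<Rightarrow> int" and Y :: "nat \<Rightarrow> real"
  assumes transcendental: "\<not> algebraic \<xi>"
    and q_pos: "0 < x m 0"
    and q_less: "x m 0 < x (Suc m) 0"
    and Y_pos: "0 < Y m"
    and Y_less: "Y (Suc m) < Y m"
    and Y_lim: "Y \<longlonglongrightarrow> 0"
    and err: "i \<le> n \<Longrightarrow> \<bar>of_int (x m 0) * \<xi> ^ i - of_int (x m i)\<bar> \<le> Y m"
    and err_attained: "\<exists>i\<le>n. \<bar>of_int (x m 0) * \<xi> ^ i - of_int (x m i)\<bar> = Y m"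
begin

definition L :: "nat \<Rightarrow> real" where
  "L m = ln (of_int (x m 0))"

text \<open>The index sets of the coordinates of j-vectors in dimension n+1.\<close>

definition grade :: "nat \<Rightarrow> nat set set" where
  "grade j = {I. I \<subseteq> {0..n} \<and> card I = j}"

lemma grade_diff: "I \<in> grade (Suc j) \<Longrightarrow> i \<in> I \<Longrightarrow> I - {i} \<in> grade j"
  by (auto simp: grade_def intro: finite_subset)

lemma grade_finite: "I \<in> grade j \<Longrightarrow> finite I"
  by (auto simp: grade_def intro: finite_subset)

lemma q_strict_mono: "strict_mono (\<lambda>m. x m 0)"
  using q_less by (simp add: strict_mono_Suc_iff)

lemma q_ge: "int m \<le> x m 0"
proof (induction m)
  case (Suc m)
  then show ?case using q_less[of m] by simp
qed (use q_pos[of 0] in simp)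

lemma exp_L: "exp (L m) = of_int (x m 0)"
  using q_pos by (simp add: L_def)

lemma L_strict_mono: "strict_mono L"
  using q_strict_mono q_pos by (simp add: L_def strict_mono_def)

lemma L_mono: "m \<le> m' \<Longrightarrow> L m \<le> L m'"
  using L_strict_mono strict_mono_less_eq by blast

lemma L_nonneg: "0 \<le> L m"
  using q_pos[of m] by (simp add: L_def)

lemma L_at_top: "filterlim L at_top sequentially"
proof (rule filterlim_at_top_mono)
  show "filterlim (\<lambda>m. ln (real m)) at_top sequentially"
    by (rule filterlim_compose[OF ln_at_top filterlim_real_sequentially])
  show "eventually (\<lambda>m. ln (real m) \<le> L m) sequentially"
    using eventually_gt_at_top[of 0]
  proof eventually_elim
    case (elim m)
    have "real m \<le> of_int (x m 0)" using q_ge[of m] by linarith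
    then show ?case unfolding L_def using elim by simp
  qed
qed

lemma Y_decreasing: "m \<le> m' \<Longrightarrow> Y m' \<le> Y m"
  by (rule lift_Suc_antimono_le) (use Y_less in \<open>auto intro: less_imp_le\<close>)

lemma det_bound:
  assumes "i \<le> n"
  shows "\<bar>of_int (x m 0 * x (Suc m) i - x (Suc m) 0 * x m i)\<bar> \<le> 2 * of_int (x (Suc m) 0) * Y m"
proof -
  define q q' :: real where "q = of_int (x m 0)" and "q' = of_int (x (Suc m) 0)"
  have q: "0 < q" "q \<le> q'" using q_pos[of m] q_less[of m] by (auto simp: q_def q'_def)
  have e: "\<bar>q * \<xi> ^ i - of_int (x m i)\<bar> \<le> Y m" "\<bar>q' * \<xi> ^ i - of_int (x (Suc m) i)\<bar> \<le> Y (Suc m)"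
    using err[OF assms] by (simp_all add: q_def q'_def)
  have "of_int (x m 0 * x (Suc m) i - x (Suc m) 0 * x m i)
      = q' * (q * \<xi> ^ i - of_int (x m i)) - q * (q' * \<xi> ^ i - of_int (x (Suc m) i))"
    by (simp add: q_def q'_def algebra_simps)
  also have "\<bar>\<dots>\<bar> \<le> q' * \<bar>q * \<xi> ^ i - of_int (x m i)\<bar> + q * \<bar>q' * \<xi> ^ i - of_int (x (Suc m) i)\<bar>"
    using q by (intro order_trans[OF abs_triangle_ineq4]) (simp add: abs_mult)
  also have "\<dots> \<le> q' * Y m + q' * Y m"
    using e q Y_less[of m] by (intro add_mono mult_mono) auto
  finally show ?thesis by (simp add: q'_def algebra_simps)
qed

text \<open>As \<omega> annihilates \<open>x m\<close>, the vector \<open>x (Suc m)\<close> may be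
  replaced by its difference to the multiple of \<open>x m\<close> with the same first coordinate.
  All coordinates of this difference are of order \<open>q' * Y m / q\<close>, for first coordinates
  q and q', instead of q'. Clearing the denominator q keeps the computation integral.\<close>

lemma wedge_step_bound:
  fixes B :: real
  assumes I: "I \<in> grade (Suc j)" and z: "wedge \<omega> (x m) I = 0"
    and B: "\<And>J. J \<in> grade j \<Longrightarrow> \<bar>of_int (\<omega> J)\<bar> \<le> B"
  shows "\<bar>of_int (wedge \<omega> (x (Suc m)) I)\<bar> \<le> B * (2 * real (Suc n) * of_int (x (Suc m) 0) * Y m / of_int (x m 0))"
proof -
  define q q' :: real where "q = of_int (x m 0)" and "q' = of_int (x (Suc m) 0)"
  have q: "0 < q" "q \<le> q'" using q_pos[of m] q_less[of m] by (auto simp: q_def q'_def)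
  have B0: "0 \<le> B"
  proof -
    obtain i where "i \<in> I" using I by (auto simp: grade_def card_Suc_eq)
    then show ?thesis using B[OF grade_diff[OF I]] by (meson abs_ge_zero order_trans)
  qed
  have "q * of_int (wedge \<omega> (x (Suc m)) I) = of_int (wedge \<omega> (\<lambda>i. x m 0 * x (Suc m) i - x (Suc m) 0 * x m i) I)"
    unfolding wedge_lincomb using z by (simp add: q_def)
  then have "q * \<bar>of_int (wedge \<omega> (x (Suc m)) I)\<bar> = \<bar>of_int (wedge \<omega> (\<lambda>i. x m 0 * x (Suc m) i - x (Suc m) 0 * x m i) I)\<bar>"
    using q by (metis abs_mult abs_of_pos)
  also have "\<dots> \<le> real (card I) * ((2 * q' * Y m) * B)"
  proof (rule wedge_bound)
    fix i assume i: "i \<in> I"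
    then have "i \<le> n" using I by (auto simp: grade_def)
    then show "\<bar>of_int (x m 0 * x (Suc m) i - x (Suc m) 0 * x m i)\<bar> \<le> 2 * q' * Y m"
      unfolding q'_def by (rule det_bound)
    show "\<bar>of_int (\<omega> (I - {i}))\<bar> \<le> B" using B[OF grade_diff[OF I i]] .
  qed (use I grade_finite q Y_pos[of m] in auto)
  also have "\<dots> \<le> real (Suc n) * ((2 * q' * Y m) * B)"
  proof (intro mult_right_mono)
    have "card I \<le> card {0..n}" using I by (intro card_mono) (auto simp: grade_def)
    then show "real (card I) \<le> real (Suc n)" by simp
  qed (use q Y_pos[of m] B0 in auto)
  finally have "\<bar>of_int (wedge \<omega> (x (Suc m)) I)\<bar> \<le> real (Suc n) * ((2 * q' * Y m) * B) / q"
    using q by (simp add: field_simps)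
  then show ?thesis by (simp add: q_def q'_def algebra_simps)
qed

text \<open>One coordinate of the product is an integral linear form in \<open>x m\<close>, with
  coefficient \<open>\<omega> J\<close> up to sign at an index outside \<open>J\<close>. If it
  vanished for all large m, division by the first coordinate would give in the limit a linear
  relation between powers of \<xi>.\<close>

lemma wedge_eventually_nonzero:
  assumes "J \<in> grade j" "\<omega> J \<noteq> 0" "j \<le> n"
  shows "\<exists>m\<ge>M. \<exists>I\<in>grade (Suc j). wedge \<omega> (x m) I \<noteq> 0"
proof (rule ccontr)
  assume "\<not> ?thesis"
  then have zero: "\<And>m I. m \<ge> M \<Longrightarrow> I \<in> grade (Suc j) \<Longrightarrow> wedge \<omega> (x m) I = 0" by blast
  have "\<not> {0..n} \<subseteq> J"
  proof
    assume "{0..n} \<subseteq> J"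
    then have "card {0..n} \<le> card J" using grade_finite[OF assms(1)] by (intro card_mono)
    then show False using assms by (simp add: grade_def)
  qed
  then obtain i0 where "i0 \<in> {0..n}" "i0 \<notin> J" by blast
  then have i0: "i0 \<le> n" "i0 \<notin> J" by auto
  define I where "I = insert i0 J"
  have I: "I \<in> grade (Suc j)" using assms(1) i0 grade_finite[OF assms(1)] by (auto simp: grade_def I_def)
  have finI: "finite I" using grade_finite[OF I] .
  define a where "a i = (-1) ^ card {l\<in>I. i < l} * \<omega> (I - {i})" for i
  have wd: "wedge \<omega> v I = (\<Sum>i\<in>I. a i * v i)" for v
    unfolding wedge_def a_def by (intro sum.cong) auto
  define S where "S = (\<Sum>i\<in>I. of_int (a i) * \<xi> ^ i)"
  define K where "K = (\<Sum>i\<in>I. \<bar>real_of_int (a i)\<bar>)"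
  have "\<bar>S\<bar> \<le> K * Y m" if m: "m \<ge> M" for m
  proof -
    have "of_int (x m 0) * S = (\<Sum>i\<in>I. of_int (a i) * (of_int (x m 0) * \<xi> ^ i - of_int (x m i))) + of_int (wedge \<omega> (x m) I)"
      unfolding wd S_def by (simp add: sum_distrib_left sum.distrib[symmetric] algebra_simps)
    also have "\<dots> = (\<Sum>i\<in>I. of_int (a i) * (of_int (x m 0) * \<xi> ^ i - of_int (x m i)))"
      using zero[OF m I] by simp
    also have "\<bar>\<dots>\<bar> \<le> (\<Sum>i\<in>I. \<bar>of_int (a i)\<bar> * Y m)"
    proof (rule order_trans[OF sum_abs], rule sum_mono)
      fix i assume "i \<in> I"
      then have "i \<le> n" using I by (auto simp: grade_def)
      then show "\<bar>of_int (a i) * (of_int (x m 0) * \<xi> ^ i - of_int (x m i))\<bar> \<le> \<bar>of_int (a i)\<bar> * Y m"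
        using err by (simp add: abs_mult mult_left_mono)
    qed
    finally have "\<bar>of_int (x m 0) * S\<bar> \<le> K * Y m" by (simp add: K_def sum_distrib_right)
    moreover have "1 * \<bar>S\<bar> \<le> \<bar>of_int (x m 0)\<bar> * \<bar>S\<bar>"
      using q_pos[of m] by (intro mult_right_mono) auto
    ultimately show ?thesis by (simp add: abs_mult)
  qed
  then have "eventually (\<lambda>m. \<bar>S\<bar> \<le> K * Y m) sequentially" by (auto simp: eventually_sequentially)
  moreover have "(\<lambda>m. K * Y m) \<longlonglongrightarrow> K * 0" by (intro tendsto_intros Y_lim)
  ultimately have "\<bar>S\<bar> \<le> K * 0" by (intro tendsto_lowerbound) auto
  then have "S = 0" by simp
  then have "a i0 = 0"
    using powers_linearly_independent[OF transcendental finI] by (auto simp: S_def I_def)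
  moreover have "I - {i0} = J" using i0 by (auto simp: I_def)
  ultimately show False using assms(2) by (simp add: a_def)
qed

text \<open>One greedy step. Taking the first index at which the product is nonzero guarantees that
  its immediate predecessor is still annihilated, so the gain for consecutive points
  applies.\<close>

lemma wedge_step:
  assumes J: "J \<in> grade j" "\<omega> J \<noteq> 0" "j \<le> n"
    and z: "\<And>I. I \<in> grade (Suc j) \<Longrightarrow> wedge \<omega> (x M) I = 0"
    and D: "\<And>J. J \<in> grade j \<Longrightarrow> \<bar>of_int (\<omega> J)\<bar> \<le> exp D"
  obtains m where "M \<le> m" "\<And>I. I \<in> grade (Suc j) \<Longrightarrow> wedge \<omega> (x m) I = 0"
    "\<exists>I\<in>grade (Suc j). wedge \<omega> (x (Suc m)) I \<noteq> 0"
    "\<And>I. I \<in> grade (Suc j) \<Longrightarrow> \<bar>of_int (wedge \<omega> (x (Suc m)) I)\<bar>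
       \<le> exp (D + ln (2 * real (Suc n)) + L (Suc m) - L m + ln (Y m))"
proof -
  define R where "R m \<longleftrightarrow> m \<ge> M \<and> (\<exists>I\<in>grade (Suc j). wedge \<omega> (x m) I \<noteq> 0)" for m
  define m' where "m' = (LEAST m. R m)"
  have "\<exists>m. R m" using wedge_eventually_nonzero[of J j \<omega> M] J by (auto simp: R_def)
  then have Rm: "R m'" unfolding m'_def by (rule LeastI_ex)
  then have "m' \<noteq> M" using z by (auto simp: R_def)
  with Rm have "M < m'" by (auto simp: R_def)
  define m where "m = m' - 1"
  have m: "Suc m = m'" "M \<le> m" using \<open>M < m'\<close> by (auto simp: m_def)
  have "\<not> R m" using not_less_Least[of m R] m unfolding m'_def by auto
  then have mz: "wedge \<omega> (x m) I = 0" if "I \<in> grade (Suc j)" for I using m that by (auto simp: R_def)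
  show ?thesis
  proof (rule that[OF m(2) mz])
    show "\<exists>I\<in>grade (Suc j). wedge \<omega> (x (Suc m)) I \<noteq> 0" using Rm m by (simp add: R_def)
    fix I assume I: "I \<in> grade (Suc j)"
    have "\<bar>of_int (wedge \<omega> (x (Suc m)) I)\<bar> \<le> exp D * (2 * real (Suc n) * of_int (x (Suc m) 0) * Y m / of_int (x m 0))"
      by (rule wedge_step_bound[OF I mz[OF I] D])
    also have "\<dots> = exp (D + ln (2 * real (Suc n)) + L (Suc m) - L m + ln (Y m))"
      using Y_pos[of m] by (simp add: exp_add exp_diff exp_L del: of_nat_Suc)
    finally show "\<bar>of_int (wedge \<omega> (x (Suc m)) I)\<bar> \<le> exp (D + ln (2 * real (Suc n)) + L (Suc m) - L m + ln (Y m))" .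
  qed
qed

text \<open>At a coordinate where the error of \<open>x k\<close> is attained, a vanishing minor
  makes the errors proportional to the first coordinates. The later point has the larger first
  coordinate and would then have the larger error.\<close>

lemma consecutive_independent:
  "\<exists>I\<in>grade 2. wedge (wedge (\<lambda>_. 1) (x k)) (x (Suc k)) I \<noteq> 0"
proof (rule ccontr)
  assume neg: "\<not> ?thesis"
  obtain i where i: "i \<le> n" "\<bar>of_int (x k 0) * \<xi> ^ i - of_int (x k i)\<bar> = Y k" using err_attained by blast
  have "i \<noteq> 0" using i Y_pos[of k] by (intro notI) simp
  define I where "I = {0, i}"
  have "I \<in> grade 2" using i \<open>i \<noteq> 0\<close> by (auto simp: I_def grade_def)
  then have "wedge (wedge (\<lambda>_. 1) (x k)) (x (Suc k)) I = 0" using neg by auto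
  moreover have "wedge (wedge (\<lambda>_. 1) (x k)) (x (Suc k)) I = x (Suc k) i * x k 0 - x (Suc k) 0 * x k i"
  proof -
    have two: "wedge \<omega> v I = (-1) ^ card {l\<in>I. 0 < l} * v 0 * \<omega> (I - {0}) + (-1) ^ card {l\<in>I. i < l} * v i * \<omega> (I - {i})" for \<omega> v
    proof -
      define f where "f = (\<lambda>j. (-1) ^ card {l\<in>I. j < l} * v j * \<omega> (I - {j}))"
      have "sum f I = f 0 + f i" using \<open>i \<noteq> 0\<close> by (simp add: I_def)
      then show ?thesis by (simp add: wedge_def f_def)
    qed
    have one: "wedge (\<lambda>_. 1) v {j} = v j" for v j
    proof -
      have c: "card {l\<in>{j}. j < l} = 0" by (subst card_eq_0_iff) auto
      have "wedge (\<lambda>_. 1) v {j} = (-1) ^ card {l\<in>{j}. j < l} * v j" by (simp add: wedge_def)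
      then show ?thesis unfolding c by simp
    qed
    have s: "{l\<in>I. 0 < l} = {i}" "{l\<in>I. i < l} = {}" "I - {0} = {i}" "I - {i} = {0}"
      using \<open>i \<noteq> 0\<close> by (auto simp: I_def)
    have c: "card {l\<in>I. 0 < l} = 1" "card {l\<in>I. i < l} = 0" unfolding s by simp_all
    show ?thesis unfolding two c s(3,4) by (simp add: one)
  qed
  ultimately have eq: "real_of_int (x (Suc k) i) * of_int (x k 0) = of_int (x (Suc k) 0) * of_int (x k i)"
    by (simp flip: of_int_mult)
  define q q' :: real where "q = of_int (x k 0)" and "q' = of_int (x (Suc k) 0)"
  have q: "0 < q" "q < q'" using q_pos[of k] q_less[of k] by (auto simp: q_def q'_def)
  have "q * (q' * \<xi> ^ i - of_int (x (Suc k) i)) = q' * (q * \<xi> ^ i - of_int (x k i))"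
    using eq by (simp add: q_def q'_def algebra_simps)
  then have "q * \<bar>q' * \<xi> ^ i - of_int (x (Suc k) i)\<bar> = q' * \<bar>q * \<xi> ^ i - of_int (x k i)\<bar>"
    using q by (metis abs_mult abs_of_pos order.strict_trans)
  then have "q' * Y k = q * \<bar>q' * \<xi> ^ i - of_int (x (Suc k) i)\<bar>" using i by (simp add: q_def)
  also have "\<dots> \<le> q * Y (Suc k)"
    using err[OF i(1), of "Suc k"] q by (intro mult_left_mono) (auto simp: q'_def)
  also have "\<dots> < q' * Y k" using q Y_less[of k] Y_pos[of "Suc k"] by (intro mult_strict_mono) auto
  finally show False by simp
qed

end

section \<open>The Marnat--Moshchevitin inequality and near equality\<close>

definition geo :: "real \<Rightarrow> nat \<Rightarrow> real" where
  "geo r j = (\<Sum>i<j. r ^ i)"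

lemma geo_0 [simp]: "geo r 0 = 0"
  by (simp add: geo_def)

lemma geo_Suc: "geo r (Suc j) = 1 + r * geo r j"
  unfolding geo_def by (subst sum.lessThan_Suc_shift) (simp add: sum_distrib_left)

lemma geo_Suc': "geo r (Suc j) = geo r j + r ^ j"
  by (simp add: geo_def)

lemma geo_mono: "0 \<le> r \<Longrightarrow> i \<le> j \<Longrightarrow> geo r i \<le> geo r j"
  unfolding geo_def by (rule sum_mono2) auto

text \<open>Here \<alpha> lies below the uniform and \<beta> above the ordinary exponent. The height
  in \<open>Y_upper\<close> is that of the next point, because no smaller denominator improves on
  \<open>Y m\<close>. The two bounds together limit the growth of the heights by the factor
  \<beta>/\<alpha>.\<close>

locale regular_points = minimal_points +
  fixes \<alpha> \<beta> :: real and m0 :: nat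
  assumes \<alpha>_pos: "0 < \<alpha>" and \<beta>_pos: "0 < \<beta>"
    and Y_upper: "m0 \<le> m \<Longrightarrow> ln (Y m) \<le> - \<alpha> * L (Suc m)"
    and Y_lower: "m0 \<le> m \<Longrightarrow> - \<beta> * L m \<le> ln (Y m)"
begin

definition r :: real where "r = \<alpha> / \<beta>"

text \<open>Partial Marnat-Moshchevitin sums. The exterior product of j+1 chain points is bounded by
  the last height to the power \<open>1 - c j\<close>, up to constants and losses.\<close>

definition c :: "nat \<Rightarrow> real" where "c j = \<alpha> * geo r j"

text \<open>Logarithm of a constant good for every step: it dominates the factor
  \<open>2 * Suc n\<close> of a wedge step and the ratio of the coordinates of \<open>x k\<close> to
  the first one.\<close>

definition \<kappa> :: real where
  "\<kappa> = ln (2 * real (Suc n)) + max 0 (ln (max 1 \<bar>\<xi>\<bar> ^ n + Y 0))"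

lemma r_pos: "0 < r"
  using \<alpha>_pos \<beta>_pos by (simp add: r_def)

lemma c_0 [simp]: "c 0 = 0"
  by (simp add: c_def)

lemma c_1: "c (Suc 0) = \<alpha>"
  by (simp add: c_def geo_Suc)

lemma c_Suc: "c (Suc j) = \<alpha> + r * c j"
  by (simp add: c_def geo_Suc algebra_simps)

lemma c_Suc': "c (Suc j) = c j + \<alpha> * r ^ j"
  by (simp add: c_def geo_Suc' algebra_simps)

lemma c_mono: "i \<le> j \<Longrightarrow> c i \<le> c j"
  using geo_mono[of r i j] r_pos \<alpha>_pos by (simp add: c_def)

lemma c_nonneg: "0 \<le> c j"
  using c_mono[of 0 j] by simp

lemma L_step: "m0 \<le> m \<Longrightarrow> r * L (Suc m) \<le> L m"
proof -
  assume "m0 \<le> m"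
  then have "\<alpha> * L (Suc m) \<le> \<beta> * L m" using Y_upper[of m] Y_lower[of m] by linarith
  then show ?thesis using \<beta>_pos by (simp add: r_def divide_le_eq mult.commute)
qed

lemma r_less_1: "r < 1"
proof (rule ccontr)
  assume "\<not> r < 1"
  then have "1 * L (Suc m0) \<le> r * L (Suc m0)" by (intro mult_right_mono L_nonneg) simp
  also have "\<dots> \<le> L m0" by (rule L_step) simp
  also have "\<dots> < L (Suc m0)" using L_strict_mono by (simp add: strict_mono_def)
  finally show False by simp
qed

lemma ln_le_\<kappa>: "ln (2 * real (Suc n)) \<le> \<kappa>"
  by (simp add: \<kappa>_def)

lemma wedge_start_bound:
  assumes "J \<in> grade 1"
  shows "\<bar>of_int (wedge (\<lambda>_. 1) (x k) J)\<bar> \<le> exp (L k + \<kappa>)"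
proof -
  define Z where "Z = max 1 \<bar>\<xi>\<bar> ^ n + Y 0"
  obtain i where i: "J = {i}" "i \<le> n" using assms by (auto simp: grade_def card_1_singleton_iff)
  have "\<bar>real_of_int (wedge (\<lambda>_. 1) (x k) J)\<bar> \<le> real (card J) * (\<bar>of_int (x k i)\<bar> * 1)"
    by (rule wedge_bound) (auto simp: i)
  then have "\<bar>real_of_int (wedge (\<lambda>_. 1) (x k) J)\<bar> \<le> \<bar>of_int (x k i)\<bar>" by (simp add: i)
  also have "\<dots> \<le> of_int (x k 0) * Z"
  proof -
    have q: "1 \<le> real_of_int (x k 0)" using q_pos[of k] by simp
    have "\<bar>\<xi>\<bar> ^ i \<le> max 1 \<bar>\<xi>\<bar> ^ i" by (intro power_mono) auto
    also have "\<dots> \<le> max 1 \<bar>\<xi>\<bar> ^ n" using i by (intro power_increasing) auto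
    finally have xi: "\<bar>\<xi>\<bar> ^ i \<le> max 1 \<bar>\<xi>\<bar> ^ n" .
    have "\<bar>real_of_int (x k i)\<bar> \<le> \<bar>of_int (x k 0) * \<xi> ^ i\<bar> + Y k" using err[OF i(2), of k] by linarith
    also have "\<dots> \<le> of_int (x k 0) * max 1 \<bar>\<xi>\<bar> ^ n + of_int (x k 0) * Y 0"
    proof (intro add_mono)
      show "\<bar>of_int (x k 0) * \<xi> ^ i\<bar> \<le> of_int (x k 0) * max 1 \<bar>\<xi>\<bar> ^ n"
        using q xi by (simp add: abs_mult power_abs)
      have "Y k \<le> 1 * Y 0" using Y_decreasing[of 0 k] by simp
      also have "\<dots> \<le> of_int (x k 0) * Y 0" using q Y_pos[of 0] by (intro mult_right_mono) auto
      finally show "Y k \<le> of_int (x k 0) * Y 0" .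
    qed
    finally show ?thesis by (simp add: Z_def algebra_simps)
  qed
  also have "\<dots> = exp (L k + ln Z)"
    using Y_pos[of 0] by (simp add: exp_add exp_L Z_def add_pos_pos)
  also have "\<dots> \<le> exp (L k + \<kappa>)"
  proof -
    have "0 \<le> ln (2 * real (Suc n))" by (rule ln_ge_zero) simp
    then have "ln Z \<le> \<kappa>" unfolding \<kappa>_def Z_def by linarith
    then show ?thesis by simp
  qed
  finally show ?thesis .
qed

text \<open>
  The state of the greedy construction that starts with \<open>x k\<close> and has collected \<open>Suc j\<close> points,
  the last one being \<open>x M\<close>; \<open>s\<close> accumulates the losses against the regular behaviour.
\<close>

definition chain :: "real \<Rightarrow> nat \<Rightarrow> nat \<Rightarrow> (nat set \<Rightarrow> int) \<Rightarrow> nat \<Rightarrow> real \<Rightarrow> bool" where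
  "chain \<mu> k j \<omega> M s \<longleftrightarrow> k < M \<and> 0 \<le> s \<and>
     (\<exists>J\<in>grade (Suc j). \<omega> J \<noteq> 0) \<and>
     (\<forall>I\<in>grade (Suc (Suc j)). wedge \<omega> (x M) I = 0) \<and>
     (\<forall>J\<in>grade (Suc j). \<bar>of_int (\<omega> J)\<bar> \<le> exp ((1 - c j) * L M - s + real (Suc j) * \<kappa>)) \<and>
     \<mu> * \<bar>L (Suc k) - r ^ (j - 1) * L M\<bar> \<le> s"

text \<open>Two nonnegative defects, \<open>L m - r * L (Suc m)\<close> and
  \<open>L m - L M\<close>, bound how far the new height deviates from a geometric progression. They
  enter the loss with weights \<open>c j\<close> and \<open>1 - c j\<close>, both at least \<mu>, so
  the accumulated loss controls the deviation.\<close>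

lemma chain_step_numeric:
  assumes "m0 \<le> M" "M \<le> m" "0 \<le> \<mu>" "\<mu> \<le> c j" "\<mu> \<le> 1 - c j" "0 < j"
    and "\<mu> * \<bar>t - r ^ (j - 1) * L M\<bar> \<le> s"
  shows "\<mu> * \<bar>t - r ^ j * L (Suc m)\<bar> \<le> s + c j * (L m - r * L (Suc m)) + (1 - c j) * (L m - L M)"
proof -
  define u v where "u = L m - r * L (Suc m)" and "v = L m - L M"
  have uv: "0 \<le> u" "0 \<le> v" using L_step[of m] L_mono[of M m] assms by (auto simp: u_def v_def)
  have "\<bar>r ^ (j - 1) * (L M - r * L (Suc m))\<bar> \<le> 1 * \<bar>u - v\<bar>"
    unfolding abs_mult u_def v_def using r_pos r_less_1 by (intro mult_mono) (auto simp: power_le_one)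
  also have "\<dots> \<le> u + v" using uv by simp
  moreover have "r ^ j = r ^ (j - 1) * r" using \<open>0 < j\<close> by (cases j) auto
  ultimately have "\<bar>r ^ (j - 1) * L M - r ^ j * L (Suc m)\<bar> \<le> u + v" by (simp add: algebra_simps)
  then have "\<bar>t - r ^ j * L (Suc m)\<bar> \<le> \<bar>t - r ^ (j - 1) * L M\<bar> + (u + v)" by linarith
  from mult_left_mono[OF this assms(3)]
  have "\<mu> * \<bar>t - r ^ j * L (Suc m)\<bar> \<le> \<mu> * \<bar>t - r ^ (j - 1) * L M\<bar> + (\<mu> * u + \<mu> * v)"
    by (simp add: distrib_left)
  also have "\<dots> \<le> s + (c j * u + (1 - c j) * v)"
    using assms uv by (intro add_mono mult_right_mono) auto
  finally show ?thesis by (simp add: u_def v_def)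
qed

text \<open>With \<open>c (Suc j) = \<alpha> + r * c j\<close>, the exponent after one step,
  \<open>(1 - c j) * L M + (1 - \<alpha>) * L (Suc m) - L m\<close>, equals
  \<open>(1 - c (Suc j)) * L (Suc m)\<close> minus exactly the two weighted defects. The chain
  starts with the independent pair \<open>x k\<close>, \<open>x (Suc k)\<close> and no loss.\<close>

lemma chain_exists:
  assumes "m0 \<le> k" "1 \<le> j" "j \<le> n" "0 \<le> \<mu>"
    and \<mu>: "\<And>i. 1 \<le> i \<Longrightarrow> i < j \<Longrightarrow> \<mu> \<le> c i \<and> \<mu> \<le> 1 - c i"
  shows "\<exists>\<omega> M s. chain \<mu> k j \<omega> M s"
  using assms(2,3) \<mu>
proof (induction j rule: dec_induct)
  case base
  define \<omega> where "\<omega> = wedge (\<lambda>_. 1) (x k)"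
  obtain I where I: "I \<in> grade 2" "wedge \<omega> (x (Suc k)) I \<noteq> 0"
    using consecutive_independent[of k] by (auto simp: \<omega>_def)
  have z: "wedge \<omega> (x k) I = 0" if "I \<in> grade (Suc 1)" for I
    unfolding \<omega>_def using grade_finite[OF that] by (rule wedge_self)
  have b: "\<bar>of_int (wedge \<omega> (x (Suc k)) I)\<bar> \<le> exp ((1 - c 1) * L (Suc k) - 0 + real (Suc 1) * \<kappa>)"
    if I: "I \<in> grade (Suc 1)" for I
  proof -
    have "\<bar>of_int (wedge \<omega> (x (Suc k)) I)\<bar> \<le> exp (L k + \<kappa>) * (2 * real (Suc n) * of_int (x (Suc k) 0) * Y k / of_int (x k 0))"
      by (rule wedge_step_bound[OF I z[OF I]]) (use wedge_start_bound in \<open>simp add: \<omega>_def\<close>)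
    also have "\<dots> = exp (L k + \<kappa> + ln (2 * real (Suc n)) + L (Suc k) - L k + ln (Y k))"
      using Y_pos[of k] q_pos[of k] by (simp add: exp_add exp_diff exp_L del: of_nat_Suc)
    also have "\<dots> \<le> exp ((1 - c 1) * L (Suc k) - 0 + real (Suc 1) * \<kappa>)"
    proof -
      have "ln (2 * real (Suc n)) \<le> \<kappa>" by (simp add: \<kappa>_def)
      then show ?thesis using Y_upper[OF assms(1)] c_1 by (simp add: algebra_simps)
    qed
    finally show ?thesis .
  qed
  have "chain \<mu> k 1 (wedge \<omega> (x (Suc k))) (Suc k) 0"
    unfolding chain_def
  proof (intro conjI ballI)
    show "\<exists>J\<in>grade (Suc 1). wedge \<omega> (x (Suc k)) J \<noteq> 0" using I by (auto simp: numeral_2_eq_2)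
    show "wedge (wedge \<omega> (x (Suc k))) (x (Suc k)) I = 0" if "I \<in> grade (Suc (Suc 1))" for I
      using grade_finite[OF that] by (rule wedge_self)
  qed (use b in auto)
  then show ?case by auto
next
  case (step j)
  have "j \<le> n" using step.prems(1) by simp
  have "\<mu> \<le> c i \<and> \<mu> \<le> 1 - c i" if "1 \<le> i" "i < j" for i
    by (rule step.prems(2)) (use that in auto)
  from step.IH[OF \<open>j \<le> n\<close> this] obtain \<omega> M s where ch: "chain \<mu> k j \<omega> M s" by blast
  have M: "m0 \<le> M" using ch assms(1) by (simp add: chain_def)
  have \<mu>j: "\<mu> \<le> c j" "\<mu> \<le> 1 - c j" using step.prems(2)[of j] step.hyps by auto
  define D where "D = (1 - c j) * L M - s + real (Suc j) * \<kappa>"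
  obtain J where J: "J \<in> grade (Suc j)" "\<omega> J \<noteq> 0" using ch by (auto simp: chain_def)
  obtain m where m: "M \<le> m" "\<And>I. I \<in> grade (Suc (Suc j)) \<Longrightarrow> wedge \<omega> (x m) I = 0"
    "\<exists>I\<in>grade (Suc (Suc j)). wedge \<omega> (x (Suc m)) I \<noteq> 0"
    "\<And>I. I \<in> grade (Suc (Suc j)) \<Longrightarrow> \<bar>of_int (wedge \<omega> (x (Suc m)) I)\<bar>
       \<le> exp (D + ln (2 * real (Suc n)) + L (Suc m) - L m + ln (Y m))"
    by (rule wedge_step[of J "Suc j" \<omega> M D]) (use J ch step.prems(1) in \<open>auto simp: chain_def D_def\<close>)
  define s' where "s' = s + c j * (L m - r * L (Suc m)) + (1 - c j) * (L m - L M)"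
  have Lm: "r * L (Suc m) \<le> L m" "L M \<le> L m" using L_step[of m] L_mono[of M m] m M by auto
  have "chain \<mu> k (Suc j) (wedge \<omega> (x (Suc m))) (Suc m) s'"
    unfolding chain_def
  proof (intro conjI ballI)
    show "k < Suc m" using ch m by (simp add: chain_def)
    show "0 \<le> s'" unfolding s'_def using ch Lm c_nonneg[of j] \<mu>j assms(4)
      by (intro add_nonneg_nonneg mult_nonneg_nonneg) (auto simp: chain_def)
    show "\<exists>J\<in>grade (Suc (Suc j)). wedge \<omega> (x (Suc m)) J \<noteq> 0" by (rule m(3))
    show "wedge (wedge \<omega> (x (Suc m))) (x (Suc m)) I = 0" if "I \<in> grade (Suc (Suc (Suc j)))" for I
      using grade_finite[OF that] by (rule wedge_self)
    show "\<mu> * \<bar>L (Suc k) - r ^ (Suc j - 1) * L (Suc m)\<bar> \<le> s'"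
      unfolding s'_def diff_Suc_1
      by (rule chain_step_numeric) (use M m assms(4) \<mu>j step.hyps ch in \<open>auto simp: chain_def\<close>)
    fix J assume J: "J \<in> grade (Suc (Suc j))"
    have "D + ln (2 * real (Suc n)) + L (Suc m) - L m + ln (Y m)
        \<le> (1 - c (Suc j)) * L (Suc m) - s' + real (Suc (Suc j)) * \<kappa>"
    proof -
      have "ln (2 * real (Suc n)) \<le> \<kappa>" by (simp add: \<kappa>_def)
      moreover have "ln (Y m) \<le> - \<alpha> * L (Suc m)" using Y_upper[of m] m M by simp
      ultimately show ?thesis unfolding D_def s'_def c_Suc by (simp add: algebra_simps)
    qed
    then show "\<bar>of_int (wedge \<omega> (x (Suc m)) J)\<bar> \<le> exp ((1 - c (Suc j)) * L (Suc m) - s' + real (Suc (Suc j)) * \<kappa>)"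
      using m(4)[OF J] by (meson exp_le_cancel_iff order_trans)
  qed
  then show ?case by auto
qed

text \<open>If \<open>c j\<close> exceeded 1, the exterior product of j+1 chain points would be a
  nonzero integral object of size tending to 0 with the starting height. The induction provides the
  nonnegative weights that the chain needs; distances are irrelevant, so \<mu> = 0 is taken.\<close>

lemma Marnat_Moshchevitin:
  assumes "j \<le> n"
  shows "c j \<le> 1"
  using assms
proof (induction j rule: less_induct)
  case (less j)
  show ?case
  proof (rule ccontr)
    assume c1: "\<not> c j \<le> 1"
    then have j: "1 \<le> j" by (cases j) auto
    have IH: "0 \<le> c i \<and> 0 \<le> 1 - c i" if "1 \<le> i" "i < j" for i
      using less.IH[of i] less.prems that c_nonneg by simp
    define t where "t = real (Suc j) * \<kappa> / (c j - 1)"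
    have "eventually (\<lambda>k. t < L k \<and> m0 \<le> k) sequentially"
      using L_at_top eventually_ge_at_top[of m0] by (intro eventually_conj) (auto simp: filterlim_at_top_dense)
    then obtain k where k: "t < L k" "m0 \<le> k" by (auto dest!: eventually_happens)
    obtain \<omega> M s where ch: "chain 0 k j \<omega> M s"
      using chain_exists[OF k(2) j less.prems order_refl IH] by blast
    then obtain J where J: "J \<in> grade (Suc j)" "\<omega> J \<noteq> 0" by (auto simp: chain_def)
    have "1 \<le> \<bar>real_of_int (\<omega> J)\<bar>" using J by linarith
    also have "\<dots> \<le> exp ((1 - c j) * L M - s + real (Suc j) * \<kappa>)" using ch J by (auto simp: chain_def)
    finally have "0 \<le> (1 - c j) * L M - s + real (Suc j) * \<kappa>" by simp
    then have "(c j - 1) * L M \<le> real (Suc j) * \<kappa>" using ch by (simp add: chain_def algebra_simps)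
    then have "L M \<le> t" using c1 by (simp add: t_def field_simps)
    moreover have "L k \<le> L M" using ch by (intro L_mono) (simp add: chain_def)
    ultimately show False using k by simp
  qed
qed

end

section \<open>Integer polynomials from almost regular chains\<close>

context regular_points
begin

text \<open>Adding an (n+1)-st point to the chain gives a nonzero determinant, hence a lower bound
  against which the total loss must be small: at most 2\<delta> times the last height
  \<open>a\<close>. Since every defect has weight at least \<mu>, the heights involved agree with
  the regular ones up to the relative error 2\<delta>/\<mu>. The last claim ties \<open>a\<close> to
  the starting height, so that polynomials for consecutive k can be compared.\<close>

lemma chain_polynomial:
  assumes n: "2 \<le> n" and k: "m0 \<le> k"
    and \<delta>: "0 < \<delta>" "1 - \<delta> \<le> c n" "(real n + 1) * \<kappa> \<le> \<delta> * L k"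
    and \<mu>: "\<mu> = \<alpha> * r ^ (n - 1)"
  obtains P :: "int poly" and a where "P \<noteq> 0" "degree P \<le> n" "L k \<le> a"
    "plen (of_int_poly P) \<le> exp (((1 - c (n - 1)) * r + 2 * \<delta> / \<mu> + \<delta>) * a)"
    "\<bar>poly (of_int_poly P) \<xi>\<bar> \<le> exp (- (1 - 2 * \<delta>) * a)"
    "\<bar>L (Suc k) - r ^ (n - 1) * a\<bar> \<le> 2 * \<delta> / \<mu> * a"
proof -
  define n' where "n' = n - 1"
  have n': "Suc n' = n" "1 \<le> n'" "n' \<le> n" using n by (auto simp: n'_def)
  define d where "d = c n'"
  have cn: "c n = \<alpha> + r * d" unfolding d_def using c_Suc[of n'] n' by simp
  have cn': "c n = d + \<alpha> * r ^ n'" unfolding d_def using c_Suc'[of n'] n' by simp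
  have cn1: "c n \<le> 1" using Marnat_Moshchevitin by simp
  have \<mu>0: "0 < \<mu>" using \<alpha>_pos r_pos by (simp add: \<mu>)
  have \<mu>\<alpha>: "\<mu> \<le> \<alpha>" using \<alpha>_pos r_pos r_less_1 power_le_one[of r "n - 1"] by (simp add: \<mu>)
  have "\<alpha> \<le> c n" using c_mono[of 1 n] n c_1 by simp
  then have \<mu>1: "\<mu> \<le> 1" using \<mu>\<alpha> cn1 by simp
  \<comment> \<open>The value chosen for \<mu> is the last summand of \<open>c n\<close>. It is the
    smallest summand, and \<open>1 - c i\<close> is at least the next summand of the sum.\<close>
  have \<mu>c: "\<mu> \<le> c i \<and> \<mu> \<le> 1 - c i" if "1 \<le> i" "i \<le> n'" for i
  proof
    show "\<mu> \<le> c i" using \<mu>\<alpha> c_mono[of 1 i] c_1 that by simp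
    have "r ^ (n - 1) \<le> r ^ i" using r_pos r_less_1 that by (intro power_decreasing) (auto simp: n'_def)
    then have "\<mu> \<le> \<alpha> * r ^ i" using \<alpha>_pos by (simp add: \<mu>)
    also have "\<dots> = c (Suc i) - c i" by (simp add: c_Suc')
    also have "\<dots> \<le> 1 - c i" using Marnat_Moshchevitin[of "Suc i"] that n' by simp
    finally show "\<mu> \<le> 1 - c i" .
  qed
  obtain \<omega> M s where ch: "chain \<mu> k n' \<omega> M s"
    using chain_exists[OF k n'(2,3) less_imp_le[OF \<mu>0]] \<mu>c by (metis less_imp_le_nat)
  have M: "k \<le> M" "m0 \<le> M" using ch k by (auto simp: chain_def)
  define D where "D = (1 - d) * L M - s + real n * \<kappa>"
  have \<omega>D: "\<bar>of_int (\<omega> J)\<bar> \<le> exp D" if "J \<in> grade n" for J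
    using ch that n' by (simp add: chain_def D_def d_def)
  obtain J where J: "J \<in> grade n" "\<omega> J \<noteq> 0" using ch n' by (auto simp: chain_def)
  obtain m where m: "M \<le> m" "\<And>I. I \<in> grade (Suc n) \<Longrightarrow> wedge \<omega> (x m) I = 0"
    "\<exists>I\<in>grade (Suc n). wedge \<omega> (x (Suc m)) I \<noteq> 0"
    "\<And>I. I \<in> grade (Suc n) \<Longrightarrow> \<bar>of_int (wedge \<omega> (x (Suc m)) I)\<bar>
       \<le> exp (D + ln (2 * real (Suc n)) + L (Suc m) - L m + ln (Y m))"
    by (rule wedge_step[of J n \<omega> M D]) (use J ch \<omega>D n' in \<open>auto simp: chain_def\<close>)
  define T where "T = {0..n}"
  have T: "I = T" if "I \<in> grade (Suc n)" for I
    using that card_subset_eq[of "{0..n}" I] by (simp add: grade_def T_def)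
  have Tg: "T \<in> grade (Suc n)" by (simp add: grade_def T_def)
  \<comment> \<open>The exterior product of n points, read as the linear form that takes the
    determinant with a further vector; its coefficients become those of \<open>P\<close>.\<close>
  define p where "p i = (-1) ^ card {l\<in>T. i < l} * \<omega> (T - {i})" for i
  define P where "P = (\<Sum>i\<in>T. monom (p i) i)"
  have coeffP: "coeff P i = (if i \<in> T then p i else 0)" for i
    by (simp add: P_def coeff_sum T_def)
  have wd: "wedge \<omega> v T = (\<Sum>i\<in>T. p i * v i)" for v
    unfolding wedge_def p_def by (intro sum.cong) auto
  have degP: "degree P \<le> n" by (rule degree_le) (auto simp: coeffP T_def)
  have "P \<noteq> 0"
  proof
    assume "P = 0"
    then have "p i = 0" if "i \<in> T" for i using coeffP[of i] that by simp
    then have "wedge \<omega> (x (Suc m)) T = 0" by (simp add: wd)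
    then show False using m(3) T by auto
  qed
  have p_le: "\<bar>real_of_int (p i)\<bar> \<le> exp D" if "i \<in> T" for i
    using \<omega>D[OF grade_diff[OF Tg that]] by (simp add: p_def abs_mult power_abs)
  have n_exp: "real n + 1 \<le> exp \<kappa>"
  proof -
    have "real n + 1 \<le> exp (ln (2 * real (Suc n)))" by simp
    also have "\<dots> \<le> exp \<kappa>" using ln_le_\<kappa> by (simp only: exp_le_cancel_iff)
    finally show ?thesis .
  qed
  have plen: "plen (of_int_poly P) \<le> exp (D + \<kappa>)"
  proof -
    have "plen (of_int_poly P) = (\<Sum>i\<le>n. \<bar>real_of_int (p i)\<bar>)"
      by (subst plen_eq[of _ n]) (auto simp: degP coeffP T_def)
    also have "\<dots> \<le> (\<Sum>i\<le>n. exp D)" by (intro sum_mono p_le) (auto simp: T_def)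
    also have "\<dots> \<le> exp \<kappa> * exp D" using mult_right_mono[OF n_exp, of "exp D"] by (simp add: algebra_simps)
    finally show ?thesis by (simp add: exp_add mult.commute)
  qed
  \<comment> \<open>The form vanishes at \<open>x m\<close>, so \<open>q * P(\<xi>)\<close> is its
    value at the error vector, whose coordinates are at most \<open>Y m\<close>.\<close>
  have val: "\<bar>poly (of_int_poly P) \<xi>\<bar> \<le> exp (D + \<kappa> + ln (Y m) - L m)"
  proof -
    define q :: real where "q = of_int (x m 0)"
    have q: "0 < q" using q_pos[of m] by (simp add: q_def)
    have "poly (of_int_poly P) \<xi> = (\<Sum>i\<in>T. of_int (p i) * \<xi> ^ i)"
      by (simp add: P_def of_int_poly_hom.hom_sum poly_sum poly_monom)
    then have "q * poly (of_int_poly P) \<xi>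
        = (\<Sum>i\<in>T. of_int (p i) * (q * \<xi> ^ i - of_int (x m i))) + of_int (wedge \<omega> (x m) T)"
      unfolding wd by (simp add: sum_distrib_left sum.distrib[symmetric] algebra_simps)
    also have "\<dots> = (\<Sum>i\<in>T. of_int (p i) * (q * \<xi> ^ i - of_int (x m i)))" using m(2)[OF Tg] by simp
    also have "\<bar>\<dots>\<bar> \<le> (\<Sum>i\<in>T. exp D * Y m)"
    proof (rule order_trans[OF sum_abs], rule sum_mono)
      fix i assume i: "i \<in> T"
      then show "\<bar>of_int (p i) * (q * \<xi> ^ i - of_int (x m i))\<bar> \<le> exp D * Y m"
        unfolding abs_mult q_def using p_le err by (intro mult_mono) (auto simp: T_def)
    qed
    also have "\<dots> = (real n + 1) * (exp D * Y m)" by (simp add: T_def)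
    also have "\<dots> \<le> exp \<kappa> * (exp D * Y m)" using n_exp Y_pos[of m] by (intro mult_right_mono) auto
    finally have "\<bar>poly (of_int_poly P) \<xi>\<bar> \<le> exp \<kappa> * (exp D * Y m) / q"
      using q by (simp add: abs_mult field_simps)
    also have "\<dots> = exp (D + \<kappa> + ln (Y m) - L m)"
      using Y_pos[of m] by (simp add: exp_add exp_diff exp_L q_def)
    finally show ?thesis .
  qed
  define a b where "a = L (Suc m)" and "b = L m"
  define \<nu> where "\<nu> = 2 * \<delta> / \<mu>"
  have mm0: "m0 \<le> m" using M m by simp
  have Ym: "ln (Y m) \<le> - \<alpha> * a" unfolding a_def using Y_upper[OF mm0] .
  have ab: "r * a \<le> b" "L M \<le> b" "L k \<le> a" "b \<le> a" "0 \<le> a"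
    using L_step[OF mm0] L_mono[of M m] L_mono[of k "Suc m"] L_mono[of m "Suc m"] L_nonneg M m
    by (auto simp: a_def b_def)
  have \<kappa>a: "real n * \<kappa> + \<kappa> \<le> \<delta> * a"
  proof -
    have "(real n + 1) * \<kappa> \<le> \<delta> * a" using \<delta>(1,3) ab(3) by (meson less_imp_le mult_left_mono order_trans)
    then show ?thesis by (simp add: algebra_simps)
  qed
  have "1 \<le> exp (D + ln (2 * real (Suc n)) + L (Suc m) - L m + ln (Y m))"
  proof -
    have "wedge \<omega> (x (Suc m)) T \<noteq> 0" using m(3) T by auto
    then have "1 \<le> \<bar>real_of_int (wedge \<omega> (x (Suc m)) T)\<bar>" by linarith
    also note m(4)[OF Tg]
    finally show ?thesis .
  qed
  then have "0 \<le> D + ln (2 * real (Suc n)) + a - b + ln (Y m)" unfolding a_def b_def one_le_exp_iff by linarith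
  then have nonneg: "0 \<le> (1 - d) * L M - s + \<delta> * a + (1 - \<alpha>) * a - b"
    using ln_le_\<kappa> Ym \<kappa>a unfolding D_def by (simp add: algebra_simps)
  \<comment> \<open>The loss including the last point. The determinant bound says
    \<open>S \<le> \<delta> * a + (1 - c n) * a\<close>; one \<delta> absorbs the constants, the
    other is the distance of \<open>c n\<close> from 1.\<close>
  define S where "S = s + d * (b - r * a) + (1 - d) * (b - L M)"
  have "c n * a \<ge> (1 - \<delta>) * a" using \<delta>(2) ab(5) by (intro mult_right_mono)
  then have S_le: "S \<le> 2 * \<delta> * a"
    using nonneg unfolding S_def cn by (simp add: algebra_simps)
  have dist: "\<mu> * \<bar>L (Suc k) - r ^ n' * a\<bar> \<le> S"
    unfolding S_def a_def b_def d_def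
    by (rule chain_step_numeric) (use M m \<mu>0 \<mu>c[of n'] n' ch in \<open>auto simp: chain_def\<close>)
  have d\<mu>: "\<mu> \<le> d" "\<mu> \<le> 1 - d" using \<mu>c[of n'] n' by (auto simp: d_def)
  have s0: "0 \<le> s" using ch by (simp add: chain_def)
  have nu_b: "b \<le> r * a + \<nu> * a"
  proof -
    have "\<mu> * (b - r * a) \<le> d * (b - r * a)" using d\<mu> ab by (intro mult_right_mono) auto
    also have "\<dots> \<le> S" unfolding S_def using s0 d\<mu> \<mu>0 ab by (simp add: mult_nonneg_nonneg)
    also have "\<dots> \<le> 2 * \<delta> * a" by (rule S_le)
    finally have "b - r * a \<le> 2 * \<delta> * a / \<mu>" using \<mu>0 by (simp add: field_simps)
    then show ?thesis by (simp add: \<nu>_def)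
  qed
  have D_le: "D + \<kappa> \<le> (1 - d) * b + \<delta> * a"
  proof -
    have "(1 - d) * L M \<le> (1 - d) * b" using ab d\<mu> \<mu>0 by (intro mult_left_mono) auto
    then show ?thesis using \<kappa>a s0 unfolding D_def by linarith
  qed
  show ?thesis
  proof (rule that[OF \<open>P \<noteq> 0\<close> degP ab(3)])
    have "D + \<kappa> \<le> (1 - d) * (r * a + \<nu> * a) + \<delta> * a"
    proof -
      have "(1 - d) * b \<le> (1 - d) * (r * a + \<nu> * a)"
        using nu_b d\<mu> \<mu>0 by (intro mult_left_mono) auto
      then show ?thesis using D_le by linarith
    qed
    also have "\<dots> \<le> ((1 - d) * r + \<nu> + \<delta>) * a"
    proof -
      have "0 \<le> \<nu>" using \<delta> \<mu>0 by (simp add: \<nu>_def)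
      then have "(1 - d) * (\<nu> * a) \<le> 1 * (\<nu> * a)" using ab d\<mu> \<mu>0 by (intro mult_right_mono) auto
      then show ?thesis by (simp add: algebra_simps)
    qed
    finally have "D + \<kappa> \<le> ((1 - d) * r + \<nu> + \<delta>) * a" .
    then show "plen (of_int_poly P) \<le> exp (((1 - c (n - 1)) * r + 2 * \<delta> / \<mu> + \<delta>) * a)"
      using plen unfolding d_def \<nu>_def n'_def by (meson exp_le_cancel_iff order_trans)
    have "D + \<kappa> + ln (Y m) - b \<le> \<delta> * a - \<alpha> * a - d * b"
      using D_le Ym by (simp add: algebra_simps)
    also have "\<dots> \<le> \<delta> * a - c n * a"
    proof -
      have "d * (r * a) \<le> d * b" using ab d\<mu> \<mu>0 by (intro mult_left_mono) auto
      then show ?thesis unfolding cn by (simp add: algebra_simps)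
    qed
    also have "\<dots> \<le> - (1 - 2 * \<delta>) * a" using \<open>c n * a \<ge> (1 - \<delta>) * a\<close> by (simp add: algebra_simps)
    finally show "\<bar>poly (of_int_poly P) \<xi>\<bar> \<le> exp (- (1 - 2 * \<delta>) * a)"
      using val unfolding b_def by (meson exp_le_cancel_iff order_trans)
    have "\<mu> * \<bar>L (Suc k) - r ^ n' * a\<bar> \<le> 2 * \<delta> * a" using dist S_le by (rule order_trans)
    then show "\<bar>L (Suc k) - r ^ (n - 1) * a\<bar> \<le> 2 * \<delta> / \<mu> * a"
      using \<mu>0 by (simp add: field_simps n'_def)
  qed
qed

text \<open>\<open>A k\<close> is \<open>L (Suc k) / r ^ (n - 1)\<close> up to the relative error
  given by \<nu>, and consecutive heights grow at most by the factor 1/r; hence the growth factor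
  \<sigma> of \<open>A\<close>, which tends to 1/r with \<delta>. The polynomials of all chains, one
  for each starting index k, form the sequence for the resultant argument.\<close>

lemma near_regular_inequality:
  fixes \<delta> :: real
  defines "\<mu> \<equiv> \<alpha> * r ^ (n - 1)"
  defines "\<nu> \<equiv> 2 * \<delta> / \<mu>"
  defines "\<sigma> \<equiv> (r ^ (n - 1) + \<nu>) / (r * (r ^ (n - 1) - \<nu>))"
  assumes n: "2 \<le> n" and \<delta>: "0 < \<delta>" "\<delta> < 1/2" "1 - \<delta> \<le> c n" and \<nu>: "\<nu> < r ^ (n - 1)"
  shows "1 - 2 * \<delta> \<le> ((1 - c (n - 1)) * r + \<nu> + \<delta>)
           * max (real (2 * n - 2) * \<sigma>) (real n * \<sigma> + real (n - 1))"
proof -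
  have "\<mu> > 0" unfolding \<mu>_def using \<alpha>_pos r_pos by simp
  then have \<nu>0: "0 < \<nu>" using \<delta> by (simp add: \<nu>_def)
  have "eventually (\<lambda>k. (real n + 1) * \<kappa> / \<delta> < L k \<and> m0 \<le> k) sequentially"
    using L_at_top eventually_ge_at_top[of m0] by (intro eventually_conj) (auto simp: filterlim_at_top_dense)
  then obtain k0 where k0: "\<And>k. k0 \<le> k \<Longrightarrow> (real n + 1) * \<kappa> / \<delta> < L k \<and> m0 \<le> k"
    by (auto simp: eventually_sequentially)
  define good where "good k P a \<longleftrightarrow> P \<noteq> 0 \<and> degree P \<le> n \<and> L k \<le> a \<and>
    plen (of_int_poly P) \<le> exp (((1 - c (n - 1)) * r + \<nu> + \<delta>) * a) \<and>
    \<bar>poly (of_int_poly P) \<xi>\<bar> \<le> exp (- (1 - 2 * \<delta>) * a) \<and>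
    \<bar>L (Suc k) - r ^ (n - 1) * a\<bar> \<le> \<nu> * a" for k a and P :: "int poly"
  have "\<exists>P a. good k P a" if k: "k0 \<le> k" for k
  proof -
    have "(real n + 1) * \<kappa> \<le> \<delta> * L k" using k0[OF k] \<delta> by (simp add: field_simps)
    then show ?thesis
      using chain_polynomial[OF n conjunct2[OF k0[OF k]] \<delta>(1,3) _ refl] unfolding good_def \<nu>_def \<mu>_def by metis
  qed
  then obtain P A where PA: "\<And>k. k0 \<le> k \<Longrightarrow> good k (P k) (A k)" by metis
  have r0: "0 < r ^ (n - 1)" using r_pos by simp
  show ?thesis
  proof (rule uniform_poly_approximation_bound[where A = A and P = P, OF transcendental n, of k0])
    show "filterlim A at_top sequentially"
    proof (rule filterlim_at_top_mono[OF L_at_top])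
      show "eventually (\<lambda>k. L k \<le> A k) sequentially"
        using eventually_ge_at_top[of k0] by eventually_elim (use PA in \<open>auto simp: good_def\<close>)
    qed
    have "0 \<le> (1 - c (n - 1)) * r" using Marnat_Moshchevitin[of "n - 1"] r_pos by simp
    then show "0 < (1 - c (n - 1)) * r + \<nu> + \<delta>" using \<nu>0 \<delta> by simp
    show "1 \<le> \<sigma>"
    proof -
      have "r * (r ^ (n - 1) - \<nu>) \<le> 1 * (r ^ (n - 1) - \<nu>)" using r_less_1 \<nu> by (intro mult_right_mono) auto
      then show ?thesis unfolding \<sigma>_def using \<nu> \<nu>0 r_pos by (simp add: field_simps)
    qed
    show "A (Suc k) \<le> \<sigma> * A k" if k: "k0 \<le> k" for k
    proof -
      have g: "good k (P k) (A k)" "good (Suc k) (P (Suc k)) (A (Suc k))" using PA k by auto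
      have 1: "r ^ (n - 1) * A (Suc k) - \<nu> * A (Suc k) \<le> L (Suc (Suc k))"
        and 2: "L (Suc k) \<le> r ^ (n - 1) * A k + \<nu> * A k"
        using g unfolding good_def by (auto simp: abs_le_iff)
      have "r * ((r ^ (n - 1) - \<nu>) * A (Suc k)) \<le> r * L (Suc (Suc k))"
        using 1 r_pos by (intro mult_left_mono) (auto simp: algebra_simps)
      also have "\<dots> \<le> L (Suc k)" using k0[OF k] by (intro L_step) simp
      also have "\<dots> \<le> (r ^ (n - 1) + \<nu>) * A k" using 2 by (simp add: algebra_simps)
      finally show ?thesis unfolding \<sigma>_def using r_pos \<nu> by (simp add: field_simps)
    qed
  qed (use PA \<delta> in \<open>auto simp: good_def\<close>)
qed

end

section \<open>Minimal points from the exponents\<close>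

text \<open>For a fixed first coordinate, rounding is optimal in all other coordinates at once, so
  only denominators remain to be varied.\<close>

definition nearest :: "nat \<Rightarrow> real \<Rightarrow> nat \<Rightarrow> nat \<Rightarrow> int" where
  "nearest n \<xi> q = (\<lambda>i\<in>{0..n}. round (real q * \<xi> ^ i))"

definition best_err :: "nat \<Rightarrow> real \<Rightarrow> nat \<Rightarrow> real" where
  "best_err n \<xi> q = approx_err n (\<lambda>i. \<xi> ^ i) (nearest n \<xi> q)"

lemma nearest_0 [simp]: "nearest n \<xi> q 0 = int q"
  by (simp add: nearest_def)

lemma nearest_in: "nearest n \<xi> q \<in> int_vectors n"
  by (simp add: nearest_def int_vectors_def)

lemma approx_err_ge_coord:
  "i \<in> {1..n} \<Longrightarrow> \<bar>of_int (v 0) * \<xi> i - of_int (v i)\<bar> \<le> approx_err n \<xi> v"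
  unfolding approx_err_def by (intro Max_ge) auto

lemma approx_err_nonneg: "1 \<le> n \<Longrightarrow> 0 \<le> approx_err n \<xi> v"
  using approx_err_ge_coord[of 1 n v \<xi>] by (simp add: order_trans[OF abs_ge_zero])

lemma best_err_le:
  assumes n: "1 \<le> n" and v: "v 0 = int q"
  shows "best_err n \<xi> q \<le> approx_err n (\<lambda>i. \<xi> ^ i) v"
  unfolding best_err_def
proof (subst approx_err_def, rule Max.boundedI)
  fix y assume "y \<in> (\<lambda>i. \<bar>of_int (nearest n \<xi> q 0) * \<xi> ^ i - of_int (nearest n \<xi> q i)\<bar>) ` {1..n}"
  then obtain i where i: "i \<in> {1..n}" "y = \<bar>real q * \<xi> ^ i - of_int (round (real q * \<xi> ^ i))\<bar>"
    by (auto simp: nearest_def)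
  have "y \<le> \<bar>real q * \<xi> ^ i - of_int (v i)\<bar>" unfolding i by (rule round_diff_minimal)
  also have "\<dots> \<le> approx_err n (\<lambda>i. \<xi> ^ i) v"
    using approx_err_ge_coord[OF i(1), of v "\<lambda>i. \<xi> ^ i"] v by simp
  finally show "y \<le> approx_err n (\<lambda>i. \<xi> ^ i) v" .
qed (use n in auto)

lemma best_err_ge:
  assumes "i \<le> n" "1 \<le> n"
  shows "\<bar>real q * \<xi> ^ i - of_int (nearest n \<xi> q i)\<bar> \<le> best_err n \<xi> q"
proof (cases "i = 0")
  case True
  have "0 \<le> best_err n \<xi> q" unfolding best_err_def by (rule approx_err_nonneg[OF assms(2)])
  then show ?thesis using True by simp
next
  case False
  then show ?thesis
    unfolding best_err_def using assms approx_err_ge_coord[of i n "nearest n \<xi> q" "\<lambda>i. \<xi> ^ i"] by simp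
qed

lemma best_err_attained:
  assumes "1 \<le> n"
  shows "\<exists>i\<le>n. \<bar>real q * \<xi> ^ i - of_int (nearest n \<xi> q i)\<bar> = best_err n \<xi> q"
proof -
  have "best_err n \<xi> q \<in> (\<lambda>i. \<bar>of_int (nearest n \<xi> q 0) * \<xi> ^ i - of_int (nearest n \<xi> q i)\<bar>) ` {1..n}"
    unfolding best_err_def approx_err_def using assms by (intro Max_in) auto
  then show ?thesis by auto
qed

lemma transcendental_not_rational:
  fixes \<xi> :: real
  assumes "\<not> algebraic \<xi>" "real_of_int b * \<xi> = of_int a"
  shows "b = 0"
proof -
  define f where "f i = (if i = 0 then - a else b)" for i :: nat
  have "(\<Sum>i\<in>{0, 1}. of_int (f i) * \<xi> ^ i) = 0" using assms(2) by (simp add: f_def)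
  then have "f 1 = 0" by (intro powers_linearly_independent[OF assms(1), of "{0, 1}"]) auto
  then show ?thesis by (simp add: f_def)
qed

lemma best_err_pos:
  fixes \<xi> :: real
  assumes "\<not> algebraic \<xi>" "1 \<le> n" "0 < q"
  shows "0 < best_err n \<xi> q"
proof -
  have "real_of_int (int q) * \<xi> \<noteq> of_int (nearest n \<xi> q 1)"
  proof
    assume "real_of_int (int q) * \<xi> = of_int (nearest n \<xi> q 1)"
    from transcendental_not_rational[OF assms(1) this] show False using assms(3) by simp
  qed
  then have "0 < \<bar>real q * \<xi> ^ 1 - of_int (nearest n \<xi> q 1)\<bar>" by simp
  also have "\<dots> \<le> best_err n \<xi> q" using best_err_ge[of 1 n] assms by blast
  finally show ?thesis .
qed

lemma below_lambda_unif:
  assumes n: "1 \<le> n" and "ereal a < lambda_unif n \<xi>"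
  shows "\<forall>\<^sub>F X in at_top. \<exists>q>0. real q \<le> X \<and> best_err n \<xi> q \<le> X powr - a"
proof -
  obtain w where w: "a < w" "\<forall>\<^sub>F X in at_top. \<exists>v\<in>int_vectors n. 0 < v 0 \<and> of_int (v 0) \<le> X
      \<and> approx_err n (\<lambda>i. \<xi> ^ i) v \<le> X powr (- w)"
    using assms(2) unfolding lambda_unif_def uniform_exponent_def less_Sup_iff by auto
  from w(2) eventually_ge_at_top[of 1] show ?thesis
  proof eventually_elim
    case (elim X)
    then obtain v where v: "0 < v 0" "of_int (v 0) \<le> X" "approx_err n (\<lambda>i. \<xi> ^ i) v \<le> X powr (- w)" by auto
    have "best_err n \<xi> (nat (v 0)) \<le> approx_err n (\<lambda>i. \<xi> ^ i) v" using v by (intro best_err_le n) auto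
    also have "\<dots> \<le> X powr (- w)" by (rule v(3))
    also have "\<dots> \<le> X powr (- a)" using w elim by (intro powr_mono) auto
    finally show ?case using v by (intro exI[of _ "nat (v 0)"]) auto
  qed
qed

text \<open>Infinitely many exceptional q would give infinitely many vectors, as
  \<open>nearest\<close> remembers q in coordinate 0.\<close>

lemma above_lambda_ord:
  assumes "lambda_ord n \<xi> < ereal b"
  shows "\<forall>\<^sub>F q in sequentially. real q powr - b < best_err n \<xi> q"
proof -
  define V where "V = {v \<in> int_vectors n. 0 < v 0 \<and> approx_err n (\<lambda>i. \<xi> ^ i) v \<le> of_int (v 0) powr (- b)}"
  have "finite V"
  proof (rule ccontr)
    assume "infinite V"
    then have "ereal b \<le> lambda_ord n \<xi>"
      unfolding lambda_ord_def ordinary_exponent_def V_def by (intro Sup_upper) auto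
    then show False using assms by simp
  qed
  define S where "S = {q. 0 < q \<and> best_err n \<xi> q \<le> real q powr - b}"
  have "nearest n \<xi> ` S \<subseteq> V" by (auto simp: S_def V_def nearest_in best_err_def)
  then have "finite (nearest n \<xi> ` S)" using \<open>finite V\<close> finite_subset by blast
  moreover have "inj_on (nearest n \<xi>) S" by (rule inj_onI) (metis nearest_0 of_nat_eq_iff)
  ultimately have "finite S" by (rule finite_imageD)
  then obtain N where N: "\<And>q. q \<in> S \<Longrightarrow> q \<le> N" using finite_nat_set_iff_bounded_le by auto
  show ?thesis
    using eventually_gt_at_top[of N]
  proof eventually_elim
    case (elim q)
    then have "q \<notin> S" using N by force
    then show ?case using elim by (auto simp: S_def)
  qed
qed

text \<open>Each record is the least positive p that beats the previous record, which yields
  minimality against all smaller p by construction; that the records increase has to be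
  derived.\<close>

lemma record_sequence:
  fixes E :: "nat \<Rightarrow> real"
  assumes pos: "\<And>q. 0 < q \<Longrightarrow> 0 < E q" and small: "\<And>e. 0 < e \<Longrightarrow> \<exists>q>0. E q < e"
  obtains Q :: "nat \<Rightarrow> nat" where "\<And>m. 0 < Q m" "\<And>m. Q m < Q (Suc m)" "\<And>m. E (Q (Suc m)) < E (Q m)"
    "\<And>m p. 0 < p \<Longrightarrow> p < Q (Suc m) \<Longrightarrow> E (Q m) \<le> E p" "(\<lambda>m. E (Q m)) \<longlonglongrightarrow> 0"
proof -
  define R where "R q p \<longleftrightarrow> 0 < p \<and> E p < E q" for q p :: nat
  define Q where "Q = rec_nat 1 (\<lambda>_ q. LEAST p. R q p)"
  have Q0: "Q 0 = 1" and QS: "Q (Suc m) = (LEAST p. R (Q m) p)" for m by (simp_all add: Q_def)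
  have ex: "\<exists>p. R q p" if "0 < q" for q using small[OF pos[OF that]] by (auto simp: R_def)
  have Qpos: "0 < Q m" for m
  proof (induction m)
    case (Suc m)
    have "R (Q m) (Q (Suc m))" unfolding QS by (rule LeastI_ex[OF ex[OF Suc]])
    then show ?case by (simp add: R_def)
  qed (simp add: Q0)
  have RQ: "R (Q m) (Q (Suc m))" for m unfolding QS using LeastI_ex[OF ex[OF Qpos]] .
  have dec: "E (Q (Suc m)) < E (Q m)" for m using RQ by (simp add: R_def)
  have min: "E (Q m) \<le> E p" if "0 < p" "p < Q (Suc m)" for m p
  proof -
    have "\<not> R (Q m) p" using that(2) by (intro not_less_Least) (simp add: QS)
    then show ?thesis using that(1) by (simp add: R_def)
  qed
  \<comment> \<open>Whatever beats \<open>Q m\<close> also beats the record before it, and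
    \<open>Q m\<close> was the least to do so.\<close>
  have inc: "Q m < Q (Suc m)" for m
  proof (cases m)
    case 0
    have "Q (Suc 0) \<noteq> 1" using dec[of 0] Q0 by auto
    then show ?thesis using Qpos[of "Suc 0"] by (simp add: 0 Q0)
  next
    case (Suc k)
    have "\<not> Q (Suc m) < Q (Suc k)"
      using min[of "Q (Suc m)" k] Qpos[of "Suc m"] dec[of k] dec[of m] Suc by auto
    moreover have "Q (Suc m) \<noteq> Q m" using dec[of m] by auto
    ultimately show ?thesis using Suc by simp
  qed
  have ge: "m < Q m" for m
  proof (induction m)
    case (Suc m)
    then show ?case using inc[of m] by simp
  qed (simp add: Q0)
  have lim: "(\<lambda>m. E (Q m)) \<longlonglongrightarrow> 0"
  proof (rule LIMSEQ_I)
    fix e :: real assume "0 < e"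
    then obtain q where q: "0 < q" "E q < e" using small by blast
    have "norm (E (Q m) - 0) < e" if m: "q \<le> m" for m
    proof -
      have "E (Q m) \<le> E q" using ge[of "Suc m"] m q by (intro min) auto
      then show ?thesis using q pos[OF Qpos[of m]] by simp
    qed
    then show "\<exists>no. \<forall>m\<ge>no. norm (E (Q m) - 0) < e" by blast
  qed
  show ?thesis by (rule that[OF Qpos inc dec min lim])
qed

lemma regular_points_exist:
  fixes \<xi> :: real
  assumes tr: "\<not> algebraic \<xi>" and n: "1 \<le> n"
    and a: "0 < a" "ereal a < lambda_unif n \<xi>" and b: "0 < b" "lambda_ord n \<xi> < ereal b"
  shows "\<exists>x Y m0. regular_points \<xi> n x Y a b m0"
proof -
  let ?E = "best_err n \<xi>"
  obtain X0 where X0: "\<And>X. X \<ge> X0 \<Longrightarrow> \<exists>q>0. real q \<le> X \<and> ?E q \<le> X powr - a"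
    using below_lambda_unif[OF n a(2)] by (auto simp: eventually_at_top_linorder)
  have small: "\<exists>q>0. ?E q < e" if "0 < e" for e
  proof -
    have "((\<lambda>X. X powr - a) \<longlongrightarrow> 0) at_top" using a(1) by (intro tendsto_neg_powr filterlim_ident) auto
    then have "eventually (\<lambda>X. X powr - a < e) at_top" using that by (rule order_tendstoD)
    then have "eventually (\<lambda>X. X powr - a < e \<and> X \<ge> X0) at_top"
      using eventually_ge_at_top[of X0] by (rule eventually_conj)
    then obtain X where "X powr - a < e" "X \<ge> X0" by (auto dest!: eventually_happens)
    then show ?thesis using X0[of X] by force
  qed
  obtain Q where Q: "\<And>m. 0 < Q m" "\<And>m. Q m < Q (Suc m)" "\<And>m. ?E (Q (Suc m)) < ?E (Q m)"
    "\<And>m p. 0 < p \<Longrightarrow> p < Q (Suc m) \<Longrightarrow> ?E (Q m) \<le> ?E p" "(\<lambda>m. ?E (Q m)) \<longlonglongrightarrow> 0"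
    using record_sequence[of ?E] best_err_pos[OF tr n] small by metis
  define x where "x m = nearest n \<xi> (Q m)" for m
  define Y where "Y = (\<lambda>m. ?E (Q m))"
  interpret minimal_points \<xi> n x Y
  proof
    show "\<exists>i\<le>n. \<bar>of_int (x m 0) * \<xi> ^ i - of_int (x m i)\<bar> = Y m" for m
      using best_err_attained[OF n, of "Q m" \<xi>] by (simp add: x_def Y_def)
    show "\<bar>of_int (x m 0) * \<xi> ^ i - of_int (x m i)\<bar> \<le> Y m" if "i \<le> n" for m i
      using best_err_ge[OF that n, of "Q m" \<xi>] by (simp add: x_def Y_def)
  qed (use Q tr best_err_pos[OF tr n] in \<open>simp_all add: x_def Y_def\<close>)
  have Qm: "m \<le> Q m" for m using q_ge[of m] by (simp add: x_def)
  obtain N where N: "\<And>q. q \<ge> N \<Longrightarrow> real q powr - b < ?E q"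
    using above_lambda_ord[OF b(2)] by (auto simp: eventually_sequentially)
  define m0 where "m0 = max N (nat \<lceil>X0\<rceil>)"
  have "regular_points \<xi> n x Y a b m0"
  proof
    fix m assume m: "m0 \<le> m"
    have "real (Q m) powr - b < Y m" unfolding Y_def using Qm[of m] m by (intro N) (simp add: m0_def)
    then have "ln (real (Q m) powr - b) < ln (Y m)" using Q(1)[of m] Y_pos[of m] by (subst ln_less_cancel_iff) auto
    then show "- b * L m \<le> ln (Y m)" using Q(1)[of m] by (simp add: L_def x_def ln_powr)
    define t where "t = real (Q (Suc m))"
    have t: "0 < t" "X0 < t"
    proof -
      show "0 < t" using Q(1) by (simp add: t_def)
      have "X0 \<le> real m" using m by (simp add: m0_def)
      also have "real m < t" using Qm[of "Suc m"] by (simp add: t_def)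
      finally show "X0 < t" .
    qed
    \<comment> \<open>Minimality of \<open>Q m\<close> concerns denominators strictly below
      \<open>Q (Suc m)\<close>, so the uniform bound is used at X < t and X tends to t from the
      left.\<close>
    have "eventually (\<lambda>X. X0 < X) (at_left t)" using t by (intro order_tendstoD[OF tendsto_ident_at])
    moreover have "eventually (\<lambda>X. X < t) (at_left t)" by (simp add: eventually_at_filter)
    ultimately have "eventually (\<lambda>X. Y m \<le> X powr - a) (at_left t)"
    proof eventually_elim
      case (elim X)
      then obtain q where q: "0 < q" "real q \<le> X" "?E q \<le> X powr - a" using X0[of X] by auto
      have "Y m \<le> ?E q" unfolding Y_def using q elim by (intro Q(4)) (auto simp: t_def)
      then show ?case using q by simp
    qed
    moreover have "((\<lambda>X. X powr - a) \<longlongrightarrow> t powr - a) (at_left t)" using t by (intro tendsto_intros) auto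
    ultimately have "Y m \<le> t powr - a" by (intro tendsto_lowerbound[where F = "at_left t"]) auto
    then have "ln (Y m) \<le> ln (t powr - a)" using Y_pos[of m] t by (subst ln_le_cancel_iff) auto
    then show "ln (Y m) \<le> - a * L (Suc m)" using t by (simp add: L_def x_def t_def ln_powr)
  qed (use a b in auto)
  then show ?thesis by blast
qed

section \<open>Ordinary exponent above 1: approximations in geometric progression\<close>

lemma infinitely_many_good_denominators:
  assumes n: "1 \<le> n" and "ereal b < lambda_ord n \<xi>" and b: "0 \<le> b"
  shows "\<exists>q>N. best_err n \<xi> q \<le> real q powr - b"
proof (rule ccontr)
  assume neg: "\<not> ?thesis"
  obtain w where w: "b < w" "infinite {v \<in> int_vectors n. 0 < v 0 \<and> approx_err n (\<lambda>i. \<xi> ^ i) v \<le> of_int (v 0) powr (- w)}"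
    using assms(2) unfolding lambda_ord_def ordinary_exponent_def less_Sup_iff by auto
  define X where "X = max 1 \<bar>\<xi>\<bar> ^ n"
  \<comment> \<open>Vectors with denominator at most \<open>N\<close> and error at most 1 have all
    coordinates within this bound, so there are finitely many; infinitely many vectors therefore
    need arbitrarily large denominators.\<close>
  define K where "K = \<lceil>real N * X + 1\<rceil>"
  have "{v \<in> int_vectors n. 0 < v 0 \<and> approx_err n (\<lambda>i. \<xi> ^ i) v \<le> of_int (v 0) powr (- w)}
      \<subseteq> {0..n} \<rightarrow>\<^sub>E {-K..K}"
  proof
    fix v assume "v \<in> {v \<in> int_vectors n. 0 < v 0 \<and> approx_err n (\<lambda>i. \<xi> ^ i) v \<le> of_int (v 0) powr (- w)}"
    then have v: "v \<in> {0..n} \<rightarrow>\<^sub>E UNIV" "0 < v 0" "approx_err n (\<lambda>i. \<xi> ^ i) v \<le> of_int (v 0) powr (- w)"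
      by (auto simp: int_vectors_def)
    have v1: "1 \<le> real_of_int (v 0)" using v by simp
    have "best_err n \<xi> (nat (v 0)) \<le> approx_err n (\<lambda>i. \<xi> ^ i) v" using v by (intro best_err_le n) auto
    also have "\<dots> \<le> of_int (v 0) powr (- w)" by (rule v(3))
    also have "\<dots> \<le> of_int (v 0) powr (- b)" using w v1 by (intro powr_mono) auto
    finally have "best_err n \<xi> (nat (v 0)) \<le> real (nat (v 0)) powr - b" using v by simp
    then have vN: "real_of_int (v 0) \<le> real N" using neg v by (metis leI nat_le_iff of_int_le_iff of_int_of_nat_eq)
    have err1: "approx_err n (\<lambda>i. \<xi> ^ i) v \<le> 1"
      using v(3) v1 w b powr_mono[of "-w" 0 "of_int (v 0)"] by auto
    have X1: "1 \<le> X" unfolding X_def by (intro one_le_power) auto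
    have "\<bar>v i\<bar> \<le> K" if i: "i \<in> {0..n}" for i
    proof -
      have "\<bar>real_of_int (v i)\<bar> \<le> real N * X + 1"
      proof (cases "i = 0")
        case True
        have "real N * 1 \<le> real N * X" using X1 by (intro mult_left_mono) auto
        then have "real_of_int (v 0) \<le> real N * X + 1" using vN by linarith
        then show ?thesis using True v1 by simp
      next
        case False
        have "\<bar>\<xi>\<bar> ^ i \<le> max 1 \<bar>\<xi>\<bar> ^ i" by (intro power_mono) auto
        also have "\<dots> \<le> X" unfolding X_def using i by (intro power_increasing) auto
        finally have "of_int (v 0) * \<bar>\<xi>\<bar> ^ i \<le> real N * X" using vN v1 by (intro mult_mono) auto
        moreover have "\<bar>of_int (v 0) * \<xi> ^ i - of_int (v i)\<bar> \<le> 1"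
          using approx_err_ge_coord[of i n v "\<lambda>i. \<xi> ^ i"] err1 False i by simp
        moreover have "\<bar>of_int (v 0) * \<xi> ^ i\<bar> = of_int (v 0) * \<bar>\<xi>\<bar> ^ i" using v1 by (simp add: abs_mult power_abs)
        ultimately show ?thesis by linarith
      qed
      then show ?thesis unfolding K_def by linarith
    qed
    then show "v \<in> {0..n} \<rightarrow>\<^sub>E {-K..K}" using v(1) by (auto simp: PiE_iff abs_le_iff) (smt (verit))
  qed
  then show False using w(2) finite_PiE[of "{0..n}" "\<lambda>_. {-K..K}"] finite_subset by auto
qed

text \<open>Iterating the recurrence gives \<open>v n * b ^ n = v 0 * a ^ n\<close>, and
  \<open>b ^ n\<close> is coprime to \<open>a ^ n\<close>.\<close>

lemma geometric_progression_dvd: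
  fixes v :: "nat \<Rightarrow> int"
  assumes "coprime a b" "\<And>i. i < n \<Longrightarrow> v (Suc i) * b = v i * a"
  shows "b ^ n dvd v 0"
proof -
  have "v i * b ^ i = v 0 * a ^ i" if "i \<le> n" for i
    using that
  proof (induction i)
    case (Suc i)
    have "v (Suc i) * b ^ Suc i = (v (Suc i) * b) * b ^ i" by simp
    also have "\<dots> = a * (v i * b ^ i)" using assms(2)[of i] Suc.prems by simp
    finally show ?case using Suc by simp
  qed simp
  then have "v 0 * a ^ n = v n * b ^ n" by simp
  then have "b ^ n dvd v 0 * a ^ n" by simp
  moreover have "coprime (b ^ n) (a ^ n)" using assms(1) by (simp add: coprime_commute)
  ultimately show ?thesis by (simp add: coprime_dvd_mult_left_iff)
qed

text \<open>The difference of the two sides is an integer that can be written in the errors alone,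
  with coefficients of order q; an error small against 1/q makes it zero. An ordinary exponent above
  1 provides such errors.\<close>

lemma geometric_progression_of_small_errors:
  fixes \<xi> q \<epsilon> :: real and v :: "nat \<Rightarrow> int"
  assumes q: "1 \<le> q" "of_int (v 0) = q" and n: "1 \<le> n"
    and err: "\<And>i. i \<le> n \<Longrightarrow> \<bar>q * \<xi> ^ i - of_int (v i)\<bar> \<le> \<epsilon>" and "\<epsilon> \<le> 1"
    and small: "(2 + \<bar>\<xi>\<bar> + max 1 \<bar>\<xi>\<bar> ^ n) * (q * \<epsilon>) < 1" and i: "i < n"
  shows "v (Suc i) * v 0 = v i * v 1"
proof -
  define e where "e j = q * \<xi> ^ j - of_int (v j)" for j
  have e: "\<bar>e j\<bar> \<le> \<epsilon>" if "j \<le> n" for j using err that by (simp add: e_def)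
  have \<epsilon>0: "0 \<le> \<epsilon>" using e[of 0] by simp
  have v1: "\<bar>of_int (v 1)\<bar> \<le> q * (\<bar>\<xi>\<bar> + 1)"
  proof -
    have "\<bar>of_int (v 1)\<bar> = \<bar>q * \<xi> - e 1\<bar>" by (simp add: e_def)
    also have "\<dots> \<le> \<bar>q * \<xi>\<bar> + \<bar>e 1\<bar>" by (rule abs_triangle_ineq4)
    also have "\<bar>e 1\<bar> \<le> q" using e[of 1] n q \<open>\<epsilon> \<le> 1\<close> by linarith
    finally show ?thesis using q by (simp add: abs_mult algebra_simps)
  qed
  have xi: "\<bar>\<xi>\<bar> ^ i \<le> max 1 \<bar>\<xi>\<bar> ^ n"
  proof -
    have "\<bar>\<xi>\<bar> ^ i \<le> max 1 \<bar>\<xi>\<bar> ^ i" by (intro power_mono) auto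
    also have "\<dots> \<le> max 1 \<bar>\<xi>\<bar> ^ n" using i by (intro power_increasing) auto
    finally show ?thesis .
  qed
  have b1: "\<bar>of_int (v 1) * e i\<bar> \<le> (q * (\<bar>\<xi>\<bar> + 1)) * \<epsilon>"
    unfolding abs_mult using v1 e[of i] i q by (intro mult_mono) auto
  have b2: "\<bar>q * e (Suc i)\<bar> \<le> q * \<epsilon>"
    unfolding abs_mult using e[of "Suc i"] i q by (intro mult_mono) auto
  have b3: "\<bar>q * \<xi> ^ i * e 1\<bar> \<le> q * max 1 \<bar>\<xi>\<bar> ^ n * \<epsilon>"
    unfolding abs_mult power_abs using e[of 1] xi n q by (intro mult_mono) auto
  have "of_int (v i * v 1 - v (Suc i) * v 0) = q * e (Suc i) - of_int (v 1) * e i - q * \<xi> ^ i * e 1"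
    unfolding of_int_diff of_int_mult q(2) by (simp add: e_def algebra_simps)
  then have "\<bar>of_int (v i * v 1 - v (Suc i) * v 0)\<bar> \<le> q * \<epsilon> + (q * (\<bar>\<xi>\<bar> + 1)) * \<epsilon> + q * max 1 \<bar>\<xi>\<bar> ^ n * \<epsilon>"
    using b1 b2 b3 by linarith
  also have "\<dots> = (2 + \<bar>\<xi>\<bar> + max 1 \<bar>\<xi>\<bar> ^ n) * (q * \<epsilon>)" by (simp add: algebra_simps)
  also have "\<dots> < 1" by (rule small)
  finally have "\<bar>v i * v 1 - v (Suc i) * v 0\<bar> < 1" by linarith
  then show ?thesis by linarith
qed

text \<open>Used in contrapositive form: a very small \<open>\<bar>b * \<xi> - a\<bar>\<close>
  forces a large \<open>b\<close>.\<close>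

lemma round_err_bounded_below:
  fixes \<xi> :: real
  assumes "\<not> algebraic \<xi>"
  obtains \<eta> where "0 < \<eta>" "\<And>a b :: int. 0 < b \<Longrightarrow> b \<le> B \<Longrightarrow> \<eta> \<le> \<bar>of_int b * \<xi> - of_int a\<bar>"
proof -
  define S where "S = insert 1 ((\<lambda>b. \<bar>of_int b * \<xi> - of_int (round (of_int b * \<xi>))\<bar>) ` {1..B})"
  have fin: "finite S" by (simp add: S_def)
  have pos: "0 < s" if s: "s \<in> S" for s
  proof (cases "s = 1")
    case False
    then obtain b where b: "b \<in> {1..B}" "s = \<bar>of_int b * \<xi> - of_int (round (of_int b * \<xi>))\<bar>"
      using s by (auto simp: S_def)
    have "of_int b * \<xi> \<noteq> of_int (round (of_int b * \<xi>))"
    proof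
      assume "of_int b * \<xi> = of_int (round (of_int b * \<xi>))"
      from transcendental_not_rational[OF assms this] show False using b by simp
    qed
    then show ?thesis by (simp add: b)
  qed simp
  have "Min S \<in> S" using fin by (intro Min_in) (simp_all add: S_def)
  then have "0 < Min S" by (rule pos)
  moreover have "Min S \<le> \<bar>of_int b * \<xi> - of_int a\<bar>" if b: "0 < b" "b \<le> B" for a b :: int
  proof -
    have "Min S \<le> \<bar>of_int b * \<xi> - of_int (round (of_int b * \<xi>))\<bar>"
      using fin b by (intro Min_le) (auto simp: S_def)
    also have "\<dots> \<le> \<bar>of_int b * \<xi> - of_int a\<bar>" by (rule round_diff_minimal)
    finally show ?thesis .
  qed
  ultimately show ?thesis using that by blast
qed

text \<open>
  If \<open>\<lambda>\<^sub>n(\<xi>) > 1\<close>, then good approximations are geometric progressions with ratio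
  \<open>a/b\<close>, so their first coordinate is divisible by \<open>b\<^sup>n\<close>; a point with first coordinate
  below \<open>b\<^sup>n\<close> is no such progression, which forces its error to be at least of order \<open>1/b\<close>.
\<close>

lemma lambda_unif_le_of_lambda_ord_gt_1:
  fixes \<xi> :: real
  assumes tr: "\<not> algebraic \<xi>" and n: "2 \<le> n" and ord: "1 < lambda_ord n \<xi>"
  shows "lambda_unif n \<xi> \<le> ereal (1 / real n)"
proof (rule ccontr)
  assume "\<not> ?thesis"
  then obtain \<alpha> where \<alpha>: "1 / real n < \<alpha>" "ereal \<alpha> < lambda_unif n \<xi>"
    using ereal_dense2[of "ereal (1 / real n)" "lambda_unif n \<xi>"] by (auto simp: not_le)
  have n1: "1 \<le> n" using n by simp
  have "0 < 1 / real n" using n by simp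
  with \<alpha>(1) have \<alpha>0: "0 < \<alpha>" by linarith
  have n\<alpha>: "1 < real n * \<alpha>" using \<alpha>(1) n by (simp add: field_simps)
  obtain w where w: "1 < w" "ereal w < lambda_ord n \<xi>"
    using ereal_dense2[OF ord] by (auto simp: one_ereal_def)
  define X where "X = max 1 \<bar>\<xi>\<bar> ^ n"
  have xi_le: "\<bar>\<xi>\<bar> ^ i \<le> X" if "i \<le> n" for i
  proof -
    have "\<bar>\<xi>\<bar> ^ i \<le> max 1 \<bar>\<xi>\<bar> ^ i" by (intro power_mono) auto
    also have "\<dots> \<le> X" unfolding X_def using that by (intro power_increasing) auto
    finally show ?thesis .
  qed
  define C where "C = 2 + \<bar>\<xi>\<bar> + X"
  have X1: "1 \<le> X" unfolding X_def by (intro one_le_power) auto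
  obtain X0 where X0: "\<And>Z. Z \<ge> X0 \<Longrightarrow> \<exists>q>0. real q \<le> Z \<and> best_err n \<xi> q \<le> Z powr - \<alpha>"
    using below_lambda_unif[OF n1 \<alpha>(2)] by (auto simp: eventually_at_top_linorder)
  \<comment> \<open>The eventual upper bound for a nonzero integer minor, as a function of
    \<open>b\<close>. It tends to 0 because the uniform exponent is assumed above 1/n.\<close>
  have "((\<lambda>b. C * (2 powr \<alpha> * b powr (1 - real n * \<alpha>)) + X * b powr (-1)) \<longlongrightarrow> C * (2 powr \<alpha> * 0) + X * 0) at_top"
    using n\<alpha> by (intro tendsto_intros tendsto_neg_powr filterlim_ident) auto
  then have "eventually (\<lambda>b. C * (2 powr \<alpha> * b powr (1 - real n * \<alpha>)) + X * b powr (-1) < 1) at_top"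
    by (rule order_tendstoD) simp
  then have "eventually (\<lambda>b. C * (2 powr \<alpha> * b powr (1 - real n * \<alpha>)) + X * b powr (-1) < 1 \<and> 2 * \<bar>X0\<bar> + 1 \<le> b) at_top"
    using eventually_ge_at_top[of "2 * \<bar>X0\<bar> + 1"] by (rule eventually_conj)
  then obtain B0 where B0: "\<And>b. b \<ge> B0 \<Longrightarrow> C * (2 powr \<alpha> * b powr (1 - real n * \<alpha>)) + X * b powr (-1) < 1 \<and> 2 * \<bar>X0\<bar> + 1 \<le> b"
    by (auto simp: eventually_at_top_linorder)
  define B where "B = \<lceil>B0\<rceil>"
  obtain \<eta> where \<eta>: "0 < \<eta>" "\<And>a b :: int. 0 < b \<Longrightarrow> b \<le> B \<Longrightarrow> \<eta> \<le> \<bar>of_int b * \<xi> - of_int a\<bar>"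
    using round_err_bounded_below[OF tr] by blast
  have "((\<lambda>z. C * z powr (1 - w)) \<longlongrightarrow> C * 0) at_top"
    using w by (intro tendsto_intros tendsto_neg_powr filterlim_ident) auto
  then have "eventually (\<lambda>z. C * z powr (1 - w) < 1) at_top" by (rule order_tendstoD) simp
  moreover have "((\<lambda>z::real. z powr - w) \<longlongrightarrow> 0) at_top"
    using w by (intro tendsto_neg_powr filterlim_ident) auto
  then have "eventually (\<lambda>z::real. z powr - w < \<eta>) at_top" using \<eta>(1) by (rule order_tendstoD)
  ultimately have "eventually (\<lambda>z. C * z powr (1 - w) < 1 \<and> z powr - w < \<eta> \<and> 1 \<le> z) at_top"
    using eventually_ge_at_top[of 1] by eventually_elim auto
  then obtain N where N: "\<And>z. z \<ge> N \<Longrightarrow> C * z powr (1 - w) < 1 \<and> z powr - w < \<eta> \<and> 1 \<le> z"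
    by (auto simp: eventually_at_top_linorder)
  obtain q where q: "nat \<lceil>N\<rceil> < q" "best_err n \<xi> q \<le> real q powr - w"
    using infinitely_many_good_denominators[OF n1 w(2), of "nat \<lceil>N\<rceil>"] w(1) by auto
  have qN: "N \<le> real q" using q(1) by linarith
  define \<epsilon> where "\<epsilon> = real q powr - w"
  have q1: "1 \<le> real q" and \<epsilon>\<eta>: "\<epsilon> < \<eta>" and Cq: "C * real q powr (1 - w) < 1"
    using N[OF qN] by (auto simp: \<epsilon>_def)
  have q\<epsilon>: "real q powr (1 - w) = real q * \<epsilon>" using q1 by (simp add: \<epsilon>_def powr_add[of _ 1 "-w", simplified])
  have \<epsilon>1: "\<epsilon> \<le> 1" using powr_mono[of "-w" 0 "real q"] w q1 by (auto simp: \<epsilon>_def split: if_splits)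
  define v where "v = nearest n \<xi> q"
  have v0: "v 0 = int q" by (simp add: v_def)
  have err: "\<bar>real q * \<xi> ^ i - of_int (v i)\<bar> \<le> \<epsilon>" if "i \<le> n" for i
    using best_err_ge[OF that n1, of q \<xi>] q(2) by (simp add: v_def \<epsilon>_def)
  have minor: "v (Suc i) * v 0 = v i * v 1" if "i < n" for i
    by (rule geometric_progression_of_small_errors[OF q1 _ n1 err \<epsilon>1 _ that])
      (use Cq q\<epsilon> in \<open>auto simp: v0 C_def X_def\<close>)
  define g where "g = gcd (v 0) (v 1)"
  have "0 < v 0" using q1 v0 by simp
  then have g0: "0 < g" by (simp add: g_def)
  then have "gcd (v 0) (v 1) \<noteq> 0" by (simp add: g_def)
  from gcd_coprime_exists[OF this] obtain b a where ab: "v 0 = b * g" "v 1 = a * g" "coprime b a"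
    unfolding g_def by blast
  have bpos: "0 < b" using \<open>0 < v 0\<close> g0 by (simp add: ab(1) zero_less_mult_iff)
  have b1: "1 \<le> real_of_int b" using bpos by simp
  have qbg: "real q = of_int b * of_int g" using arg_cong[OF ab(1), of real_of_int] v0 by simp
  have step_v: "v (Suc i) * b = v i * a" if "i < n" for i
  proof -
    have "(v (Suc i) * b) * g = (v i * a) * g" using minor[OF that] unfolding ab by (simp add: mult_ac)
    then show ?thesis using g0 by simp
  qed
  have "b ^ n dvd v 0"
    using geometric_progression_dvd[of a b n v] step_v ab(3) by (simp add: coprime_commute)
  then have "b ^ n \<le> int q" using v0 q1 by (intro zdvd_imp_le) auto
  then have "real_of_int (b ^ n) \<le> real_of_int (int q)" by (simp only: of_int_le_iff)
  then have bq: "real_of_int b ^ n \<le> real q" by simp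
  have b_self: "real_of_int b \<le> real_of_int b ^ n" using b1 n1 by (intro self_le_power) auto
  have b_dist: "\<bar>of_int b * \<xi> - of_int a\<bar> \<le> of_int b / real q * \<epsilon>"
  proof -
    have "of_int g * (of_int b * \<xi> - of_int a) = real q * \<xi> ^ 1 - of_int (v 1)"
      unfolding ab(2) qbg by (simp add: algebra_simps)
    moreover have "of_int g * \<bar>of_int b * \<xi> - of_int a\<bar> = \<bar>of_int g * (of_int b * \<xi> - of_int a)\<bar>"
      using g0 by (simp add: abs_mult)
    ultimately have "of_int g * \<bar>of_int b * \<xi> - of_int a\<bar> = \<bar>real q * \<xi> ^ 1 - of_int (v 1)\<bar>" by simp
    also have "\<dots> \<le> \<epsilon>" by (rule err[OF n1])
    finally have "\<bar>of_int b * \<xi> - of_int a\<bar> \<le> \<epsilon> / of_int g" using g0 by (simp add: field_simps)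
    also have "\<dots> = of_int b / real q * \<epsilon>" using bpos by (simp add: qbg)
    finally show ?thesis .
  qed
  \<comment> \<open>The error \<epsilon> was chosen below the least distance that occurs for
    denominators up to \<open>B\<close>.\<close>
  have "B < b"
  proof (rule ccontr)
    assume "\<not> B < b"
    then have "\<eta> \<le> \<bar>of_int b * \<xi> - of_int a\<bar>" using \<eta>(2) bpos by simp
    also have "\<dots> \<le> of_int b / real q * \<epsilon>" by (rule b_dist)
    also have "\<dots> \<le> 1 * \<epsilon>"
    proof (intro mult_right_mono)
      have "real_of_int b \<le> real q" using bq b_self by linarith
      then show "of_int b / real q \<le> 1" using q1 by simp
    qed (simp add: \<epsilon>_def)
    finally show False using \<epsilon>\<eta> by simp
  qed
  then have bB: "B0 \<le> of_int b" unfolding B_def by linarith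
  \<comment> \<open>Half of \<open>b ^ n\<close>: denominators up to \<open>Z\<close> are not
    divisible by \<open>b ^ n\<close>, and \<open>b * Z powr - \<alpha>\<close> is still of order
    \<open>b powr (1 - n * \<alpha>)\<close>.\<close>
  define Z where "Z = real_of_int b ^ n / 2"
  have "2 * \<bar>X0\<bar> + 1 \<le> real_of_int b" using B0[OF bB] by blast
  then have ZX0: "X0 \<le> Z" "0 < Z" using b1 b_self unfolding Z_def by linarith+
  obtain p where p: "0 < p" "real p \<le> Z" "best_err n \<xi> p \<le> Z powr - \<alpha>" using X0[OF ZX0(1)] by blast
  define u where "u = nearest n \<xi> p"
  have u0: "u 0 = int p" by (simp add: u_def)
  have erru: "\<bar>real p * \<xi> ^ i - of_int (u i)\<bar> \<le> Z powr - \<alpha>" if "i \<le> n" for i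
    using best_err_ge[OF that n1, of p \<xi>] p(3) by (simp add: u_def)
  have "\<exists>i<n. u (Suc i) * b \<noteq> u i * a"
  proof (rule ccontr)
    assume "\<not> ?thesis"
    then have "b ^ n dvd u 0" using geometric_progression_dvd[of a b n u] ab(3) by (simp add: coprime_commute)
    then have "b ^ n \<le> int p" using u0 p by (intro zdvd_imp_le) auto
    then have "real_of_int (b ^ n) \<le> real p" by linarith
    then show False using p(2) ZX0(2) by (simp add: Z_def)
  qed
  then obtain i where i: "i < n" "u (Suc i) * b - u i * a \<noteq> 0" by auto
  define e where "e j = real p * \<xi> ^ j - of_int (u j)" for j
  have e: "\<bar>e j\<bar> \<le> Z powr - \<alpha>" if "j \<le> n" for j using erru that by (simp add: e_def)
  have a_le: "\<bar>of_int a\<bar> \<le> of_int b * (\<bar>\<xi>\<bar> + 1)"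
  proof -
    have "\<bar>of_int b * \<xi> - of_int a\<bar> \<le> of_int b"
    proof (rule order_trans[OF b_dist])
      have "of_int b / real q * \<epsilon> \<le> of_int b / 1 * 1" using q1 \<epsilon>1 b1 by (intro mult_mono divide_left_mono) (auto simp: \<epsilon>_def)
      then show "of_int b / real q * \<epsilon> \<le> of_int b" by simp
    qed
    moreover have "\<bar>of_int b * \<xi>\<bar> = of_int b * \<bar>\<xi>\<bar>" using b1 by (simp add: abs_mult)
    ultimately show ?thesis by (simp add: distrib_left)
  qed
  have "1 \<le> \<bar>u (Suc i) * b - u i * a\<bar>" using i(2) by linarith
  then have "1 \<le> \<bar>real_of_int (u (Suc i) * b - u i * a)\<bar>" by linarith
  \<comment> \<open>The minor splits into two terms with the errors of \<open>u\<close>, small by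
    the uniform exponent, and one with \<open>b * \<xi> - a\<close>, small because a/b comes from
    the much better point \<open>v\<close>.\<close>
  also have "real_of_int (u (Suc i) * b - u i * a) = of_int a * e i - of_int b * e (Suc i) + real p * \<xi> ^ i * (of_int b * \<xi> - of_int a)"
    by (simp add: e_def algebra_simps)
  also have "\<bar>\<dots>\<bar> \<le> \<bar>of_int a * e i\<bar> + \<bar>of_int b * e (Suc i)\<bar> + \<bar>real p * \<xi> ^ i * (of_int b * \<xi> - of_int a)\<bar>" by linarith
  also have "\<dots> \<le> (of_int b * (\<bar>\<xi>\<bar> + 1)) * Z powr - \<alpha> + of_int b * Z powr - \<alpha> + X * of_int b powr (-1)"
  proof (intro add_mono)
    show "\<bar>of_int a * e i\<bar> \<le> (of_int b * (\<bar>\<xi>\<bar> + 1)) * Z powr - \<alpha>"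
      unfolding abs_mult using a_le e[of i] i b1 by (intro mult_mono) auto
    show "\<bar>of_int b * e (Suc i)\<bar> \<le> of_int b * Z powr - \<alpha>"
      unfolding abs_mult using e[of "Suc i"] i b1 by (intro mult_mono) auto
    have qpos: "0 < real q" using q1 by simp
    have "\<bar>real p * \<xi> ^ i * (of_int b * \<xi> - of_int a)\<bar> \<le> real q * X * (of_int b / real q * \<epsilon>)"
      unfolding abs_mult power_abs
    proof (intro mult_mono b_dist xi_le)
      show "\<bar>real p\<bar> \<le> real q" using bq p(2) ZX0 by (simp add: Z_def)
    qed (use i X1 in auto)
    also have "\<dots> = X * (of_int b * \<epsilon>)" using qpos by simp
    also have "\<dots> \<le> X * of_int b powr (-1)"
    proof (intro mult_left_mono)
      \<comment> \<open>Here \<open>2 \<le> n\<close> enters: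
        \<open>q \<ge> b ^ n \<ge> b * b\<close>, so that
        \<open>b * \<epsilon> \<le> b / q \<le> 1 / b\<close>.\<close>
      have "real_of_int b * of_int b \<le> real_of_int b ^ n"
        using power_increasing[of 2 n "real_of_int b"] n b1 by (simp add: power2_eq_square)
      also have "\<dots> \<le> real q" by (rule bq)
      finally have bb: "real_of_int b * of_int b \<le> real q" .
      have "\<epsilon> \<le> real q powr - 1" unfolding \<epsilon>_def using w q1 by (intro powr_mono) auto
      also have "\<dots> = 1 / real q" using qpos by (simp add: powr_minus_divide)
      also have "\<dots> \<le> 1 / (of_int b * of_int b)" using bb b1 qpos by (intro divide_left_mono mult_pos_pos) auto
      finally have "of_int b * \<epsilon> \<le> of_int b * (1 / (of_int b * of_int b))" using b1 by (intro mult_left_mono) auto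
      then show "of_int b * \<epsilon> \<le> of_int b powr (-1)" using b1 by (simp add: powr_minus_divide)
    qed (use X1 in auto)
    finally show "\<bar>real p * \<xi> ^ i * (of_int b * \<xi> - of_int a)\<bar> \<le> X * of_int b powr (-1)" .
  qed
  also have "\<dots> = (2 + \<bar>\<xi>\<bar>) * (of_int b * Z powr - \<alpha>) + X * of_int b powr (-1)" by (simp add: algebra_simps)
  also have "\<dots> \<le> C * (of_int b * Z powr - \<alpha>) + X * of_int b powr (-1)"
    using X1 b1 by (intro add_right_mono mult_right_mono) (auto simp: C_def)
  also have "of_int b * Z powr - \<alpha> = 2 powr \<alpha> * of_int b powr (1 - real n * \<alpha>)"
  proof -
    have "Z powr - \<alpha> = (of_int b powr real n) powr - \<alpha> * 2 powr \<alpha>"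
      using b1 by (simp add: Z_def powr_divide powr_minus_divide powr_realpow)
    then show ?thesis using b1 by (simp add: powr_powr powr_add[of _ 1 "- (real n * \<alpha>)", simplified])
  qed
  also have "C * (2 powr \<alpha> * of_int b powr (1 - real n * \<alpha>)) + X * of_int b powr (-1) < 1"
    using B0[OF bB] by simp
  finally show False by simp
qed

section \<open>Explicit bounds\<close>

lemma geo_pos: "0 \<le> r \<Longrightarrow> 0 < n \<Longrightarrow> 0 < geo r n"
  using geo_mono[of r 1 n] by (simp add: geo_Suc)

lemma geo_le: "0 \<le> r \<Longrightarrow> r \<le> 1 \<Longrightarrow> geo r n \<le> real n"
  unfolding geo_def using sum_mono[of "{..<n}" "\<lambda>i. r ^ i" "\<lambda>_. 1"] by (simp add: power_le_one)

lemma geo_strict_mono: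
  assumes "0 \<le> r" "r < t" "2 \<le> n"
  shows "geo r n < geo t n"
  unfolding geo_def
proof (rule sum_strict_mono_ex1)
  show "\<forall>i\<in>{..<n}. r ^ i \<le> t ^ i" using assms by (auto intro: power_mono)
  show "\<exists>i\<in>{..<n}. r ^ i < t ^ i" using assms by (intro bexI[of _ 1]) auto
qed simp

lemma geo_closed: "(1 - r) * geo r n = 1 - r ^ n"
proof (induction n)
  case (Suc n)
  then show ?case by (simp add: geo_Suc' distrib_left) (simp add: algebra_simps)
qed simp

text \<open>Says that \<open>r ^ (n - 1) / geo r n\<close> is increasing, which can be checked term
  by term. It allows the resultant condition to be tested only at the largest admissible r.\<close>

lemma geo_div_power_antimono:
  assumes "0 < r" "r \<le> t"
  shows "geo t n * r ^ (n - 1) \<le> geo r n * t ^ (n - 1)"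
  unfolding geo_def sum_distrib_right
proof (rule sum_mono)
  fix i assume "i \<in> {..<n}"
  then have e: "n - 1 = i + (n - 1 - i)" by simp
  have "t ^ i * r ^ (n - 1) = t ^ i * r ^ i * r ^ (n - 1 - i)" by (subst e) (simp add: power_add)
  also have "\<dots> \<le> t ^ i * r ^ i * t ^ (n - 1 - i)" using assms by (intro mult_left_mono power_mono) auto
  also have "\<dots> = r ^ i * t ^ (n - 1)" by (subst (2) e) (simp add: power_add)
  finally show "t ^ i * r ^ (n - 1) \<le> r ^ i * t ^ (n - 1)" .
qed

text \<open>
  The bound of Bugeaud and Schleischitz for the uniform exponent of polynomial approximation,
  where \<open>r\<close> stands for the ratio of the uniform to the ordinary exponent.
\<close>

definition polybound :: "nat \<Rightarrow> real \<Rightarrow> real" where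
  "polybound n r = max (real (2 * n - 2)) (real n + real (n - 1) * r)"

text \<open>The outcome for arbitrary \<open>a\<close> and \<open>b\<close> strictly enclosing the
  exponents, with the minimal points eliminated.\<close>

lemma near_equality_bound:
  fixes \<xi> a b \<delta> :: real
  assumes tr: "\<not> algebraic \<xi>" and n: "2 \<le> n"
    and a: "0 < a" "ereal a < lambda_unif n \<xi>" and b: "0 < b" "lambda_ord n \<xi> < ereal b"
  shows "a < b" "a * geo (a / b) n \<le> 1"
    "0 < \<delta> \<Longrightarrow> \<delta> < 1/2 \<Longrightarrow> 1 - \<delta> \<le> a * geo (a / b) n \<Longrightarrow>
      \<nu> = 2 * \<delta> / (a * (a / b) ^ (n - 1)) \<Longrightarrow> \<nu> < (a / b) ^ (n - 1) \<Longrightarrow>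
      \<sigma> = ((a / b) ^ (n - 1) + \<nu>) / ((a / b) * ((a / b) ^ (n - 1) - \<nu>)) \<Longrightarrow>
      1 - 2 * \<delta> \<le> ((1 - a * geo (a / b) (n - 1)) * (a / b) + \<nu> + \<delta>)
        * max (real (2 * n - 2) * \<sigma>) (real n * \<sigma> + real (n - 1))"
proof -
  obtain x Y m0 where "regular_points \<xi> n x Y a b m0"
    using regular_points_exist[OF tr _ a b] n by auto
  then interpret regular_points \<xi> n x Y a b m0 .
  show "a < b" using r_less_1 b by (simp add: r_def)
  show "a * geo (a / b) n \<le> 1" using Marnat_Moshchevitin[of n] by (simp add: c_def r_def)
  show "1 - 2 * \<delta> \<le> ((1 - a * geo (a / b) (n - 1)) * (a / b) + \<nu> + \<delta>)
        * max (real (2 * n - 2) * \<sigma>) (real n * \<sigma> + real (n - 1))"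
    if "0 < \<delta>" "\<delta> < 1/2" "1 - \<delta> \<le> a * geo (a / b) n"
      "\<nu> = 2 * \<delta> / (a * (a / b) ^ (n - 1))" "\<nu> < (a / b) ^ (n - 1)"
      "\<sigma> = ((a / b) ^ (n - 1) + \<nu>) / ((a / b) * ((a / b) ^ (n - 1) - \<nu>))"
    using near_regular_inequality[OF n that(1,2)] that(3-) by (simp add: c_def r_def)
qed

text \<open>From \<open>a > T\<close> and \<open>a * geo r n \<le> 1\<close> follows r \<le> r0.
  Near equality \<open>a\<close> is almost \<open>1 / geo r n\<close>, which turns the length
  exponent into about \<open>r ^ n / geo r n\<close>; multiplied by \<open>polybound n r / r\<close>
  it is increasing in r and so bounded by its value at r0. All error terms are expressed by
  \<open>T\<close> and \<rho>, hence independent of a, b and \<xi>: \<open>b \<le> 2\<close> gives r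
  \<ge> T/2, and \<rho> is the resulting lower bound for \<open>r ^ (n - 1)\<close>.\<close>

lemma near_equality_inequality:
  fixes \<xi> a b \<delta> \<rho> T r0 :: real
  assumes tr: "\<not> algebraic \<xi>" and n: "2 \<le> n"
    and r0: "0 < r0" "r0 < 1" and T: "T = 1 / geo r0 n" and \<rho>: "\<rho> = (T / 2) ^ (n - 1)"
    and a: "T < a" "ereal a < lambda_unif n \<xi>" and b: "0 < b" "b \<le> 2" "lambda_ord n \<xi> < ereal b"
    and \<delta>: "0 < \<delta>" "\<delta> < 1/2" "1 - \<delta> \<le> a * geo (a / b) n" and small: "2 * \<delta> / (T * \<rho>) < \<rho>"
  shows "1 - 2 * \<delta> \<le> (\<rho> + 2 * \<delta> / (T * \<rho>)) / (\<rho> - 2 * \<delta> / (T * \<rho>))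
      * (polybound n r0 * r0 ^ (n - 1) / geo r0 n + (2 * \<delta> / (T * \<rho>) + 2 * \<delta>) * (4 * real n / T))"
proof -
  define r where "r = a / b"
  have g0: "0 < geo r0 n" using r0 n by (intro geo_pos) auto
  have T0: "0 < T" using g0 by (simp add: T)
  have a0: "0 < a" using a T0 by linarith
  note ne = near_equality_bound[OF tr n a0 a(2) b(1,3)]
  have r: "0 < r" "r < 1" using a0 b ne(1) by (auto simp: r_def)
  have ag: "a * geo r n \<le> 1" using ne(2) by (simp add: r_def)
  have gr: "0 < geo r n" using r n by (intro geo_pos) auto
  have r_ge: "T / 2 \<le> r"
  proof -
    have "T / 2 \<le> a / 2" using a by simp
    also have "\<dots> \<le> a / b" using a0 b by (intro divide_left_mono) auto
    finally show ?thesis by (simp add: r_def)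
  qed
  have r_le: "r \<le> r0"
  proof (rule ccontr)
    assume "\<not> r \<le> r0"
    then have "geo r0 n < geo r n" using r0 n by (intro geo_strict_mono) auto
    then have "T * geo r0 n < a * geo r n" using a T0 g0 by (intro mult_strict_mono) auto
    then show False using ag g0 by (simp add: T)
  qed
  define \<rho>' where "\<rho>' = r ^ (n - 1)"
  have \<rho>0: "0 < \<rho>" using T0 by (simp add: \<rho>)
  have \<rho>': "\<rho> \<le> \<rho>'" unfolding \<rho> \<rho>'_def using r_ge T0 by (intro power_mono) auto
  define \<nu> where "\<nu> = 2 * \<delta> / (a * \<rho>')"
  define \<nu>' where "\<nu>' = 2 * \<delta> / (T * \<rho>)"
  have \<nu>: "0 < \<nu>" "\<nu> \<le> \<nu>'"
  proof -
    show "0 < \<nu>" using \<delta> a0 \<rho>0 \<rho>' by (simp add: \<nu>_def)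
    have "T * \<rho> \<le> a * \<rho>'" using a T0 \<rho>0 \<rho>' by (intro mult_mono) auto
    then show "\<nu> \<le> \<nu>'" unfolding \<nu>_def \<nu>'_def using \<delta> T0 \<rho>0 a0 \<rho>'
      by (intro divide_left_mono mult_pos_pos) auto
  qed
  have \<nu>'\<rho>: "\<nu>' < \<rho>" using small by (simp add: \<nu>'_def)
  have \<nu>\<rho>: "\<nu> < \<rho>'" using \<nu> \<nu>'\<rho> \<rho>' by linarith
  define \<sigma> where "\<sigma> = (\<rho>' + \<nu>) / (r * (\<rho>' - \<nu>))"
  define z where "z = (\<rho> + \<nu>') / (\<rho> - \<nu>')"
  have z1: "1 \<le> z" unfolding z_def using \<nu> \<nu>'\<rho> by simp
  have \<sigma>: "\<sigma> \<le> z / r"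
  proof -
    have "(\<rho>' + \<nu>) * (\<rho> - \<nu>') \<le> (\<rho> + \<nu>') * (\<rho>' - \<nu>)"
    proof -
      have "\<rho> * \<nu> \<le> \<rho>' * \<nu>'" using \<nu> \<rho>' \<rho>0 by (intro mult_mono) auto
      then show ?thesis by (simp add: algebra_simps)
    qed
    then have "(\<rho>' + \<nu>) / (\<rho>' - \<nu>) \<le> z" unfolding z_def using \<nu>\<rho> \<nu>'\<rho> by (simp add: frac_le_eq divide_le_0_iff field_simps)
    then have "(\<rho>' + \<nu>) / (\<rho>' - \<nu>) / r \<le> z / r" using r by (intro divide_right_mono) auto
    then show ?thesis by (simp add: \<sigma>_def mult.commute)
  qed
  have \<sigma>0: "0 \<le> \<sigma>"
    unfolding \<sigma>_def using r \<nu> \<nu>\<rho> \<rho>0 \<rho>' by (intro divide_nonneg_nonneg mult_nonneg_nonneg) auto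
  define N where "N = polybound n r0"
  define h where "h = (1 - a * geo r (n - 1)) * r + \<nu> + \<delta>"
  \<comment> \<open>For \<sigma> = 1/r the maximum would be \<open>polybound n r / r\<close>; the
    factor \<open>z\<close> accounts for the excess of \<sigma>, and \<open>polybound\<close> is
    monotone in r.\<close>
  have mx: "max (real (2 * n - 2) * \<sigma>) (real n * \<sigma> + real (n - 1)) \<le> z * (N / r)"
  proof (rule max.boundedI)
    have "real (2 * n - 2) * \<sigma> \<le> N * (z / r)"
      using \<sigma> \<sigma>0 unfolding N_def polybound_def by (intro mult_mono) auto
    then show "real (2 * n - 2) * \<sigma> \<le> z * (N / r)" by (simp add: mult.commute)
    have "real n * \<sigma> + real (n - 1) \<le> real n * (z / r) + z * real (n - 1)"
      using \<sigma> z1 mult_right_mono[OF z1, of "real (n - 1)"] by (intro add_mono mult_left_mono) auto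
    also have "\<dots> = z * ((real n + real (n - 1) * r) / r)" using r by (simp add: field_simps)
    also have "\<dots> \<le> z * (N / r)"
    proof (intro mult_left_mono divide_right_mono)
      have "real (n - 1) * r \<le> real (n - 1) * r0" using r_le by (intro mult_left_mono) auto
      then show "real n + real (n - 1) * r \<le> N" unfolding N_def polybound_def by linarith
    qed (use r z1 in auto)
    finally show "real n * \<sigma> + real (n - 1) \<le> z * (N / r)" .
  qed
  have N0: "0 \<le> N" "N \<le> 2 * real n"
  proof -
    show "0 \<le> N" by (simp add: N_def polybound_def le_max_iff_disj)
    have "real (n - 1) * r0 \<le> real (n - 1) * 1" using r0 by (intro mult_left_mono) auto
    then have "real n + real (n - 1) * r0 \<le> 2 * real n" using n by linarith
    then show "N \<le> 2 * real n" unfolding N_def polybound_def by (intro max.boundedI) auto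
  qed
  \<comment> \<open>By the recursion for \<open>geo\<close>,
    \<open>(1 - a * geo r (n - 1)) * r\<close> equals \<open>r - a * geo r n + a\<close>; the closed
    form of the geometric sum then produces \<open>r ^ n / geo r n\<close>.\<close>
  have h_le: "h \<le> r * (r ^ (n - 1) / geo r n) + (\<nu>' + 2 * \<delta>)"
  proof -
    have Sn: "Suc (n - 1) = n" using n by simp
    have "a * geo r n = a + r * (a * geo r (n - 1))" using geo_Suc[of r "n - 1"] Sn by (simp add: algebra_simps)
    then have "(1 - a * geo r (n - 1)) * r = r - a * geo r n + a" by (simp add: algebra_simps)
    also have "\<dots> \<le> r - 1 + \<delta> + a" using \<delta>(3) by (simp add: r_def)
    also have "\<dots> \<le> r - 1 + \<delta> + 1 / geo r n" using ag gr by (simp add: field_simps)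
    also have "\<dots> = r ^ n / geo r n + \<delta>" using geo_closed[of r n] gr by (simp add: field_simps)
    also have "r ^ n = r * r ^ (n - 1)" using n by (cases n) auto
    finally show ?thesis using \<nu> by (simp add: h_def)
  qed
  have ratio: "r ^ (n - 1) / geo r n \<le> r0 ^ (n - 1) / geo r0 n"
    using geo_div_power_antimono[OF r(1) r_le, of n] gr g0 by (simp add: field_simps)
  have h0: "0 \<le> h"
  proof -
    have "a * geo r (n - 1) \<le> a * geo r n" using a0 r by (intro mult_left_mono geo_mono) auto
    then have "0 \<le> (1 - a * geo r (n - 1)) * r" using ag r by (intro mult_nonneg_nonneg) auto
    then show ?thesis using \<nu> \<delta> by (simp add: h_def)
  qed
  have "1 - 2 * \<delta> \<le> h * max (real (2 * n - 2) * \<sigma>) (real n * \<sigma> + real (n - 1))"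
    using ne(3)[OF \<delta>, of \<nu> \<sigma>] \<nu>\<rho> by (simp add: h_def \<nu>_def \<sigma>_def r_def \<rho>'_def)
  also have "\<dots> \<le> h * (z * (N / r))" using mx h0 by (rule mult_left_mono)
  also have "\<dots> \<le> (r * (r0 ^ (n - 1) / geo r0 n) + (\<nu>' + 2 * \<delta>)) * (z * (N / r))"
  proof (rule mult_right_mono)
    have "r * (r ^ (n - 1) / geo r n) \<le> r * (r0 ^ (n - 1) / geo r0 n)" using ratio r by (intro mult_left_mono) auto
    then show "h \<le> r * (r0 ^ (n - 1) / geo r0 n) + (\<nu>' + 2 * \<delta>)" using h_le by linarith
  qed (use z1 N0 r in auto)
  also have "\<dots> = z * (N * r0 ^ (n - 1) / geo r0 n + (\<nu>' + 2 * \<delta>) * (N / r))"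
    using r by (simp add: field_simps)
  also have "\<dots> \<le> z * (N * r0 ^ (n - 1) / geo r0 n + (\<nu>' + 2 * \<delta>) * (4 * real n / T))"
  proof (intro mult_left_mono add_left_mono)
    have "N / r \<le> 2 * real n / (T / 2)" using N0 r_ge T0 by (intro frac_le) auto
    then show "N / r \<le> 4 * real n / T" by simp
  qed (use z1 \<nu> \<delta> in auto)
  finally show ?thesis by (simp add: z_def N_def \<nu>'_def)
qed

lemma MM_sum_real:
  assumes "0 < b"
  shows "MM_sum n (ereal a) (ereal b) = ereal (a * geo (a / b) n)"
proof -
  have "MM_sum n (ereal a) (ereal b) = (\<Sum>k = 1..n. ereal (a ^ k / b ^ (k - 1)))"
    unfolding MM_sum_def using assms by (intro sum.cong) auto
  also have "\<dots> = ereal (\<Sum>k = 1..n. a ^ k / b ^ (k - 1))" by simp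
  also have "(\<Sum>k = 1..n. a ^ k / b ^ (k - 1)) = (\<Sum>i<n. a * (a / b) ^ i)"
    by (simp add: sum.atLeast1_atMost_eq power_divide)
  finally show ?thesis by (simp add: geo_def sum_distrib_left)
qed

text \<open>The hypothesis on r0 says that the limiting inequality for \<delta> = 0 fails strictly,
  so by continuity it fails for some \<delta> > 0, fixed before \<xi> is given. Hence the uniform
  exponent cannot exceed \<open>1 / geo r0 n\<close>.\<close>

lemma near_equality_lambda_unif_le:
  fixes r0 :: real
  assumes n: "2 \<le> n" and r0: "0 < r0" "r0 < 1" and gap: "polybound n r0 * r0 ^ (n - 1) < geo r0 n"
  obtains \<delta> :: real where "0 < \<delta>"
    "\<And>\<xi>. \<not> algebraic \<xi> \<Longrightarrow> MM_defect n (lambda_unif n \<xi>) (lambda_ord n \<xi>) < ereal \<delta> \<Longrightarrow>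
      lambda_unif n \<xi> \<le> ereal (1 / geo r0 n)"
proof -
  define T where "T = 1 / geo r0 n"
  define \<rho> where "\<rho> = (T / 2) ^ (n - 1)"
  have g0: "0 < geo r0 n" using r0 n by (intro geo_pos) auto
  have T0: "0 < T" using g0 by (simp add: T_def)
  have \<rho>0: "0 < \<rho>" using T0 by (simp add: \<rho>_def)
  define F where "F \<delta> = (\<rho> + 2 * \<delta> / (T * \<rho>)) / (\<rho> - 2 * \<delta> / (T * \<rho>))
      * (polybound n r0 * r0 ^ (n - 1) / geo r0 n + (2 * \<delta> / (T * \<rho>) + 2 * \<delta>) * (4 * real n / T)) + 2 * \<delta>" for \<delta>
  have "(F \<longlongrightarrow> (\<rho> + 2 * 0 / (T * \<rho>)) / (\<rho> - 2 * 0 / (T * \<rho>))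
      * (polybound n r0 * r0 ^ (n - 1) / geo r0 n + (2 * 0 / (T * \<rho>) + 2 * 0) * (4 * real n / T)) + 2 * 0) (at_right 0)"
    unfolding F_def using \<rho>0 T0 g0 by (intro tendsto_intros) auto
  then have "(F \<longlongrightarrow> polybound n r0 * r0 ^ (n - 1) / geo r0 n) (at_right 0)" using \<rho>0 by simp
  moreover have "polybound n r0 * r0 ^ (n - 1) / geo r0 n < 1" using gap g0 by simp
  ultimately have "eventually (\<lambda>\<delta>. F \<delta> < 1) (at_right 0)" by (rule order_tendstoD)
  moreover have "((\<lambda>\<delta>. 2 * \<delta> / (T * \<rho>)) \<longlongrightarrow> 2 * 0 / (T * \<rho>)) (at_right 0)"
    using \<rho>0 T0 by (intro tendsto_intros) auto
  then have "eventually (\<lambda>\<delta>. 2 * \<delta> / (T * \<rho>) < \<rho>) (at_right 0)" using \<rho>0 by (intro order_tendstoD) auto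
  moreover have "eventually (\<lambda>\<delta>::real. \<delta> < 1/2) (at_right 0)"
    by (rule order_tendstoD[OF tendsto_ident_at]) simp
  moreover have "eventually (\<lambda>\<delta>::real. 0 < \<delta>) (at_right 0)" by (simp add: eventually_at_filter)
  ultimately have "eventually (\<lambda>\<delta>. F \<delta> < 1 \<and> 2 * \<delta> / (T * \<rho>) < \<rho> \<and> \<delta> < 1/2 \<and> 0 < \<delta>) (at_right 0)"
    by eventually_elim auto
  then obtain \<delta> where \<delta>: "F \<delta> < 1" "2 * \<delta> / (T * \<rho>) < \<rho>" "\<delta> < 1/2" "0 < \<delta>"
    by (auto dest!: eventually_happens)
  have "lambda_unif n \<xi> \<le> ereal T"
    if tr: "\<not> algebraic \<xi>" and def: "MM_defect n (lambda_unif n \<xi>) (lambda_ord n \<xi>) < ereal \<delta>" for \<xi>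
  proof (rule ccontr)
    assume "\<not> lambda_unif n \<xi> \<le> ereal T"
    then have gt: "ereal T < lambda_unif n \<xi>" by simp
    \<comment> \<open>An exponent above \<open>T\<close> also exceeds 1/n, which excludes an
      ordinary exponent above 1.\<close>
    have "1 / real n \<le> T" unfolding T_def using geo_le[of r0 n] r0 g0 by (intro divide_left_mono) auto
    then have "\<not> lambda_unif n \<xi> \<le> ereal (1 / real n)" using gt by (metis ereal_less_eq(3) not_le order_trans)
    then have ord1: "lambda_ord n \<xi> \<le> 1" using lambda_unif_le_of_lambda_ord_gt_1[OF tr n] by (meson not_le)
    have unif_le_ord: "lambda_unif n \<xi> \<le> lambda_ord n \<xi>"
    proof (rule ccontr)
      assume "\<not> ?thesis"
      \<comment> \<open>A number c strictly between the exponents could serve as both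
        \<open>a\<close> and \<open>b\<close>, against \<open>a < b\<close>.\<close>
      then have "max (ereal T) (lambda_ord n \<xi>) < lambda_unif n \<xi>" using gt by simp
      from ereal_dense2[OF this] obtain c where c: "max (ereal T) (lambda_ord n \<xi>) < ereal c" "ereal c < lambda_unif n \<xi>"
        by blast
      then have "0 < c" using T0 by simp
      then show False using near_equality_bound(1)[OF tr n _ c(2), of c] c by simp
    qed
    obtain a where a: "lambda_unif n \<xi> = ereal a" "T < a"
      using gt unif_le_ord ord1 by (cases "lambda_unif n \<xi>") auto
    obtain b where b: "lambda_ord n \<xi> = ereal b" "a \<le> b" "b \<le> 1"
      using unif_le_ord ord1 a by (cases "lambda_ord n \<xi>") auto
    have ab0: "0 < a" "0 < b" using a b T0 by linarith+
    have "1 - a * geo (a / b) n < \<delta>"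
      using def unfolding MM_defect_def a(1) b(1) MM_sum_real[OF ab0(2)] by (simp add: one_ereal_def)
    \<comment> \<open>Lowering the uniform and raising the ordinary exponent by a small relative
      amount t gives admissible \<open>a\<close> and \<open>b\<close>; the strict bound on the
      defect survives, and \<open>b (1 + t)\<close> stays at most 2.\<close>
    then have start: "1 - \<delta> < (a * (1 - 0)) * geo ((a * (1 - 0)) / (b * (1 + 0))) n" by simp
    have "((\<lambda>t. (a * (1 - t)) * geo ((a * (1 - t)) / (b * (1 + t))) n) \<longlongrightarrow>
        (a * (1 - 0)) * geo ((a * (1 - 0)) / (b * (1 + 0))) n) (at_right 0)"
      unfolding geo_def using ab0 by (intro tendsto_intros) auto
    then have "eventually (\<lambda>t. 1 - \<delta> < (a * (1 - t)) * geo ((a * (1 - t)) / (b * (1 + t))) n) (at_right 0)"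
      using start by (rule order_tendstoD)
    moreover have "((\<lambda>t. a * (1 - t)) \<longlongrightarrow> a * (1 - 0)) (at_right 0)" by (intro tendsto_intros)
    then have "eventually (\<lambda>t. T < a * (1 - t)) (at_right 0)" using a by (intro order_tendstoD) auto
    moreover have "eventually (\<lambda>t::real. t < 1) (at_right 0)" by (rule order_tendstoD[OF tendsto_ident_at]) simp
    moreover have "eventually (\<lambda>t::real. 0 < t) (at_right 0)" by (simp add: eventually_at_filter)
    ultimately have "eventually (\<lambda>t. 1 - \<delta> < (a * (1 - t)) * geo ((a * (1 - t)) / (b * (1 + t))) n
        \<and> T < a * (1 - t) \<and> t < 1 \<and> 0 < t) (at_right 0)"
      by eventually_elim auto
    then obtain t where t: "1 - \<delta> < (a * (1 - t)) * geo ((a * (1 - t)) / (b * (1 + t))) n"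
      "T < a * (1 - t)" "t < 1" "0 < t" by (auto dest!: eventually_happens)
    have t1: "ereal (a * (1 - t)) < lambda_unif n \<xi>" using t ab0 by (simp add: a(1))
    have t2: "0 < b * (1 + t)" using ab0 t by simp
    have t3: "b * (1 + t) \<le> 2" using mult_mono[of b 1 "1 + t" 2] b ab0 t by simp
    have t4: "lambda_ord n \<xi> < ereal (b * (1 + t))" using ab0 t by (simp add: b(1))
    have "1 \<le> F \<delta>"
      using near_equality_inequality[OF tr n r0 T_def \<rho>_def t(2) t1 t2 t3 t4 \<delta>(4,3) less_imp_le[OF t(1)] \<delta>(2)]
      by (simp add: F_def)
    then show False using \<delta>(1) by simp
  qed
  then show ?thesis using that[OF \<delta>(4)] by (simp add: T_def)
qed

section \<open>Numerical location of Theta and the ratio attached to it\<close>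

lemma exp_taylor_bounds:
  fixes x :: real
  assumes "0 \<le> x" "x \<le> 3/2"
  shows "(\<Sum>k<14. x ^ k / fact k) \<le> exp x" "exp x \<le> (\<Sum>k<14. x ^ k / fact k) + 9 * x ^ 14 / fact 14"
proof -
  obtain t where t: "\<bar>t\<bar> \<le> \<bar>x\<bar>" "exp x = (\<Sum>k<14. x ^ k / fact k) + exp t / fact 14 * x ^ 14"
    using Maclaurin_exp_le[of x 14] by auto
  show "(\<Sum>k<14. x ^ k / fact k) \<le> exp x" using t(2) assms by simp
  \<comment> \<open>The crude bound e < 3 or equal suffices for the remainder, which is divided by
    14!.\<close>
  have "exp t \<le> exp (1 + 1)" using t(1) assms by simp
  also have "\<dots> = exp 1 * exp (1::real)" by (rule exp_add)
  also have "\<dots> \<le> 3 * 3" by (intro mult_mono exp_le) auto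
  finally have "exp t * (x ^ 14 / fact 14) \<le> 9 * (x ^ 14 / fact 14)"
    using assms by (intro mult_right_mono) auto
  then show "exp x \<le> (\<Sum>k<14. x ^ k / fact k) + 9 * x ^ 14 / fact 14" using t(2) by simp
qed

text \<open>The defining equation in terms of \<tau> = \<open>Theta - 1/2\<close>: it makes
  \<open>exp (- \<tau>)\<close> the rational expression 1 / (2\<tau> + 1).\<close>

lemma exp_Theta: "exp (Theta - 1/2) = 2 * Theta"
proof -
  have "sqrt (exp 1) = exp (1/2)"
    by (rule real_sqrt_unique) (simp_all flip: exp_of_nat_mult)
  then have "exp Theta = 2 * exp (1/2) * Theta" using Theta_eq Theta_gt_1 by (simp add: field_simps)
  then show ?thesis by (simp add: exp_diff)
qed

text \<open>Beyond 1 the quotient \<open>exp t / t\<close> increases strictly, so one evaluation of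
  the exponential decides on which side of \<open>Theta\<close> a number lies.\<close>

lemma exp_half_div_less_iff:
  fixes t :: real
  assumes "1 \<le> t"
  shows "exp (t - 1/2) < 2 * t \<longleftrightarrow> t < Theta"
proof -
  have e: "exp (s - 1/2) / s = exp s / s / exp (1/2)" for s :: real by (simp add: exp_diff)
  have "exp (t - 1/2) < 2 * t \<longleftrightarrow> exp (t - 1/2) / t < exp (Theta - 1/2) / Theta"
    unfolding exp_Theta using assms Theta_gt_1 by (simp add: field_simps)
  also have "\<dots> \<longleftrightarrow> exp t / t < exp Theta / Theta" unfolding e
    by (auto simp only: divide_less_cancel exp_gt_zero not_exp_less_zero exp_not_eq_zero)
  also have "\<dots> \<longleftrightarrow> t < Theta"
    using exp_div_strict_mono[of t Theta] exp_div_strict_mono[of Theta t] assms Theta_gt_1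
    by (cases t Theta rule: linorder_cases) auto
  finally show ?thesis .
qed

lemma Theta_bounds: "1.7564 \<le> Theta" "Theta < 1.7565"
proof -
  have "exp (1.7564 - 1/2) \<le> (\<Sum>k<14. 1.2564 ^ k / fact k) + 9 * 1.2564 ^ 14 / (fact 14 :: real)"
    using exp_taylor_bounds(2)[of "1.2564"] by simp
  also have "\<dots> < 2 * 1.7564" by (simp add: fact_numeral eval_nat_numeral fact_reduce field_simps)
  finally show "1.7564 \<le> Theta" using exp_half_div_less_iff[of "1.7564"] by simp
  have "2 * 1.7565 < (\<Sum>k<14. 1.2565 ^ k / fact k :: real)" by (simp add: eval_nat_numeral fact_reduce field_simps)
  also have "\<dots> \<le> exp (1.7565 - 1/2)" using exp_taylor_bounds(1)[of "1.2565"] by simp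
  finally have gt: "2 * 1.7565 < exp (1.7565 - 1/2 :: real)" .
  then have "\<not> 1.7565 < Theta" using exp_half_div_less_iff[of "1.7565"] by simp
  moreover have "Theta \<noteq> 1.7565"
  proof
    assume "Theta = 1.7565"
    then show False using gt unfolding exp_Theta[unfolded \<open>Theta = 1.7565\<close>] by simp
  qed
  ultimately show "Theta < 1.7565" by simp
qed

text \<open>The quadratic term matters: with \<open>1 - x \<le> exp (- x)\<close> alone, the
  estimate at the extremal ratio would miss at order x. The derivative of the difference of
  logarithms is t^2 / (1 - t).\<close>

lemma one_minus_le_exp_quadratic:
  fixes x :: real
  assumes "0 \<le> x" "x < 1"
  shows "1 - x \<le> exp (- x - x\<^sup>2 / 2)"
proof -
  define f where "f t = - t - t\<^sup>2 / 2 - ln (1 - t)" for t :: real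
  have "f 0 \<le> f x"
  proof (rule DERIV_nonneg_imp_nondecreasing[OF assms(1)])
    fix t assume t: "0 \<le> t" "t \<le> x"
    have "(f has_real_derivative - 1 - t + 1 / (1 - t)) (at t)"
      unfolding f_def using t assms by (auto intro!: derivative_eq_intros simp: field_simps)
    moreover have "- 1 - t + 1 / (1 - t) = t\<^sup>2 / (1 - t)"
      using t assms by (simp add: field_simps power2_eq_square)
    moreover have "0 \<le> t\<^sup>2 / (1 - t)" using t assms by simp
    ultimately show "\<exists>y. (f has_real_derivative y) (at t) \<and> 0 \<le> y" by metis
  qed
  then have "ln (1 - x) \<le> - x - x\<^sup>2 / 2" by (simp add: f_def)
  then have "exp (ln (1 - x)) \<le> exp (- x - x\<^sup>2 / 2)" by simp
  then show ?thesis using assms by simp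
qed

text \<open>For r0 = 1 - \<tau>/n with \<tau> = \<open>Theta - 1/2\<close>, \<open>r0 ^ n\<close> is
  close to 1 / (2\<tau> + 1), and by the choice of \<open>Theta\<close> the main terms of the last
  inequality cancel. What remains has order x = \<tau>/n; there the quadratic gain in
  \<open>r0 ^ n\<close> outweighs the other terms for all n \<ge> 4.\<close>

lemma Theta_ratio:
  fixes n :: nat
  assumes n: "4 \<le> n"
  defines "r0 \<equiv> 1 - (Theta - 1/2) / real n"
  shows "0 < r0" "r0 < 1" "1 / geo r0 n \<le> Theta / real n" "polybound n r0 * r0 ^ (n - 1) < geo r0 n"
proof -
  define \<tau> where "\<tau> = Theta - 1/2"
  define N :: real where "N = real n"
  define x where "x = \<tau> / N"
  have N: "4 \<le> N" using n by (simp add: N_def)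
  have \<tau>: "1.2564 \<le> \<tau>" "\<tau> < 1.2565" using Theta_bounds by (auto simp: \<tau>_def)
  have x: "0 < x" "x \<le> 0.3142" unfolding x_def using N \<tau> by (auto simp: field_simps)
  have xN: "x * N = \<tau>" using N by (simp add: x_def)
  have r0: "r0 = 1 - x" by (simp add: r0_def x_def \<tau>_def N_def)
  show "0 < r0" "r0 < 1" using x by (auto simp: r0)
  define y where "y = r0 ^ n"
  have y0: "0 < y" using x by (simp add: y_def r0)
  have y_exp: "y \<le> exp (- \<tau>) / (1 + \<tau> * x / 2)"
  proof -
    have "y \<le> exp (- x - x\<^sup>2 / 2) ^ n"
      unfolding y_def r0 using one_minus_le_exp_quadratic[of x] x by (intro power_mono) auto
    also have "\<dots> = exp (- \<tau> - \<tau> * x / 2)"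
      unfolding exp_of_nat_mult[symmetric] xN[symmetric] N_def by (simp add: power2_eq_square algebra_simps)
    also have "\<dots> = exp (- \<tau>) / exp (\<tau> * x / 2)" by (simp add: exp_diff)
    also have "\<dots> \<le> exp (- \<tau>) / (1 + \<tau> * x / 2)"
    proof (intro divide_left_mono mult_pos_pos)
      show "1 + \<tau> * x / 2 \<le> exp (\<tau> * x / 2)" by (rule exp_ge_add_one_self)
      show "0 < 1 + \<tau> * x / 2" using \<tau> x by (intro add_pos_nonneg) auto
    qed auto
    finally show ?thesis .
  qed
  have et: "exp (- \<tau>) = 1 / (2 * \<tau> + 1)"
    using exp_Theta unfolding \<tau>_def exp_minus inverse_eq_divide by simp
  have D: "0 < 1 + \<tau> * x / 2" "1 \<le> 1 + \<tau> * x / 2" using \<tau> x by (auto intro!: add_pos_nonneg)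
  have y_le: "y * ((2 * \<tau> + 1) * (1 + \<tau> * x / 2)) \<le> 1"
  proof -
    have "0 < (2 * \<tau> + 1) * (1 + \<tau> * x / 2)" using D \<tau> by (intro mult_pos_pos) auto
    moreover have "y \<le> 1 / ((2 * \<tau> + 1) * (1 + \<tau> * x / 2))" using y_exp unfolding et by simp
    ultimately show ?thesis by (simp only: pos_le_divide_eq)
  qed
  have geo: "x * geo r0 n = 1 - y" using geo_closed[of r0 n] by (simp add: r0 y_def)
  have g0: "0 < geo r0 n" using \<open>0 < r0\<close> n by (intro geo_pos) auto
  show "1 / geo r0 n \<le> Theta / real n"
  proof -
    have "y * (2 * \<tau> + 1) * 1 \<le> y * (2 * \<tau> + 1) * (1 + \<tau> * x / 2)"
      using D y0 \<tau> by (intro mult_left_mono) auto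
    then have "y * (2 * \<tau> + 1) \<le> 1" using y_le by (simp add: mult.assoc)
    then have "\<tau> \<le> (\<tau> + 1/2) * (1 - y)" by (simp add: algebra_simps)
    then have "x * N \<le> (\<tau> + 1/2) * (x * geo r0 n)" by (simp add: geo xN)
    then have "N \<le> (\<tau> + 1/2) * geo r0 n" using x by (simp add: mult.left_commute)
    then show ?thesis using g0 N by (simp add: N_def \<tau>_def field_simps)
  qed
  show "polybound n r0 * r0 ^ (n - 1) < geo r0 n"
  proof -
    define Z where "Z = (2 * \<tau> + 1) * (1 + \<tau> * x / 2)"
    \<comment> \<open>The goal multiplied by \<open>r0 * x\<close>, where
      \<open>x * geo r0 n = 1 - y\<close>; inserting \<open>y \<le> 1 / Z\<close> leaves a condition
      without powers.\<close>
    have main: "p * y * x < r0 * (1 - y)" if p: "p * x + r0 < r0 * Z" for p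
    proof -
      have "y * (p * x + r0) < y * (r0 * Z)" using p y0 by (intro mult_strict_left_mono)
      also have "\<dots> \<le> r0 * 1" using y_le \<open>0 < r0\<close> unfolding Z_def[symmetric]
        by (subst mult.left_commute) (intro mult_left_mono, auto)
      finally show ?thesis by (simp add: algebra_simps)
    qed
    \<comment> \<open>The numbers are the lower bounds 1 - 0.3142 for r0, 1.2564 for \<tau> and 2 *
      1.2564 + 1; their product exceeds 3.\<close>
    have gain: "3/2 * x \<le> r0 * ((2 * \<tau> + 1) * (\<tau> * x / 2))"
    proof -
      have "0.6858 * (3.5128 * 1.2564) \<le> r0 * ((2 * \<tau> + 1) * \<tau>)"
        using \<tau> x by (intro mult_mono) (auto simp: r0)
      then have "3 \<le> r0 * ((2 * \<tau> + 1) * \<tau>)" by simp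
      then have "3 * (x / 2) \<le> r0 * ((2 * \<tau> + 1) * \<tau>) * (x / 2)" using x by (intro mult_right_mono) auto
      then show ?thesis by (simp add: mult_ac)
    qed
    have "p * y * x < r0 * (1 - y)" if p: "p = 2 * N - 2 \<or> p = N + (N - 1) * r0" for p
    proof (rule main)
      have e: "r0 * (2 * \<tau> + 1) = 2 * \<tau> + 1 - 2 * (x * \<tau>) - x" by (simp add: r0 algebra_simps)
      have x\<tau>: "x * \<tau> \<le> x * (13/10)" "x * x \<le> x * (1/3)" using \<tau> x by (intro mult_left_mono; simp)+
      have "p * x + r0 < r0 * (2 * \<tau> + 1) + 3/2 * x"
        using p
      proof
        assume p: "p = 2 * N - 2"
        have "p * x = 2 * (x * N) - 2 * x" by (simp add: p algebra_simps)
        then have "p * x = 2 * \<tau> - 2 * x" by (simp only: xN)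
        then show ?thesis unfolding e using x\<tau> x r0 by linarith
      next
        assume p: "p = N + (N - 1) * r0"
        have "p * x = 2 * (x * N) - x * (x * N) - x + x * x" by (simp add: p r0 algebra_simps)
        then have "p * x = 2 * \<tau> - x * \<tau> - x + x * x" by (simp only: xN)
        then show ?thesis unfolding e using x\<tau> x r0 by linarith
      qed
      also have "\<dots> \<le> r0 * Z" using gain by (simp add: Z_def algebra_simps)
      finally show "p * x + r0 < r0 * Z" .
    qed
    moreover have "polybound n r0 = 2 * N - 2 \<or> polybound n r0 = N + (N - 1) * r0"
      using n by (auto simp: polybound_def N_def max_def of_nat_diff)
    ultimately have "polybound n r0 * y * x < r0 * (1 - y)" by blast
    then have "polybound n r0 * y < r0 * geo r0 n"
      using x by (simp flip: geo)
    moreover have "y = r0 * r0 ^ (n - 1)" using n by (cases n) (auto simp: y_def)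
    ultimately have "r0 * (polybound n r0 * r0 ^ (n - 1)) < r0 * geo r0 n" by (simp add: mult_ac)
    then show ?thesis using \<open>0 < r0\<close> by simp
  qed
qed

lemma equality_lambda_unif_le:
  fixes \<xi> :: real
  assumes "2 \<le> n" "0 < r0" "r0 < 1" "polybound n r0 * r0 ^ (n - 1) < geo r0 n"
    and "\<not> algebraic \<xi>" "MM_sum n (lambda_unif n \<xi>) (lambda_ord n \<xi>) = 1"
  shows "lambda_unif n \<xi> \<le> ereal (1 / geo r0 n)"
proof -
  obtain \<delta> :: real where "0 < \<delta>"
    "\<And>\<xi>. \<not> algebraic \<xi> \<Longrightarrow> MM_defect n (lambda_unif n \<xi>) (lambda_ord n \<xi>) < ereal \<delta> \<Longrightarrow>
      lambda_unif n \<xi> \<le> ereal (1 / geo r0 n)"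
    using near_equality_lambda_unif_le[OF assms(1-4)] by blast
  then show ?thesis using assms(5,6) by (simp add: MM_defect_def one_ereal_def)
qed

theorem theorem2p3:
  shows
  "(\<forall>\<xi>::real. \<not> algebraic \<xi> \<longrightarrow>
      (MM_sum 4 (lambda_unif 4 \<xi>) (lambda_ord 4 \<xi>) = 1 \<longrightarrow> lambda_unif 4 \<xi> < ereal 0.3588) \<and>
      (MM_sum 6 (lambda_unif 6 \<xi>) (lambda_ord 6 \<xi>) = 1 \<longrightarrow> lambda_unif 6 \<xi> < ereal 0.2540) \<and>
      (MM_sum 8 (lambda_unif 8 \<xi>) (lambda_ord 8 \<xi>) = 1 \<longrightarrow> lambda_unif 8 \<xi> < ereal 0.1968))
   \<and> (1.7564 \<le> Theta \<and> Theta < 1.7565)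
   \<and> (\<exists>e :: nat \<Rightarrow> real. e \<longlonglongrightarrow> 0 \<and>
        (\<forall>n \<ge> 4. even n \<longrightarrow> (\<forall>\<xi>::real. \<not> algebraic \<xi> \<longrightarrow>
           MM_sum n (lambda_unif n \<xi>) (lambda_ord n \<xi>) = 1 \<longrightarrow>
           lambda_unif n \<xi> \<le> ereal ((Theta + e n) / real n))))
   \<and> (\<exists>n0 :: nat. \<forall>n \<ge> n0. 4 \<le> n \<longrightarrow> even n \<longrightarrow>
        (\<forall>\<epsilon>::real. \<epsilon> > 0 \<longrightarrow> (\<exists>\<delta>::real. \<delta> > 0 \<and>
          (\<forall>(\<xi>::real) \<alpha> \<beta>. \<not> algebraic \<xi> \<longrightarrow>
             \<alpha> = lambda_unif n \<xi> \<longrightarrow> \<beta> = lambda_ord n \<xi> \<longrightarrow>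
             \<alpha> \<in> {ereal (1 / real n)..1} \<longrightarrow> \<beta> \<in> {ereal (1 / real n)..\<infinity>} \<longrightarrow>
             MM_defect n \<alpha> \<beta> < ereal \<delta> \<longrightarrow>
             lambda_unif n \<xi> \<le> ereal ((Theta + \<epsilon>) / real n)))))"
proof (intro conjI)
  show "1.7564 \<le> Theta" "Theta < 1.7565" by (rule Theta_bounds)+
next
  have small: "lambda_unif n \<xi> < ereal c"
    if "\<not> algebraic \<xi>" "MM_sum n (lambda_unif n \<xi>) (lambda_ord n \<xi>) = 1" "2 \<le> n" "0 < r0" "r0 < 1"
      "polybound n r0 * r0 ^ (n - 1) < geo r0 n" "1 / geo r0 n < c" for n \<xi> r0 c
    using equality_lambda_unif_le[OF that(3-6,1,2)] that(7)
    by (meson ereal_less(2) le_less_trans less_ereal.simps(1))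
  show "\<forall>\<xi>::real. \<not> algebraic \<xi> \<longrightarrow>
      (MM_sum 4 (lambda_unif 4 \<xi>) (lambda_ord 4 \<xi>) = 1 \<longrightarrow> lambda_unif 4 \<xi> < ereal 0.3588) \<and>
      (MM_sum 6 (lambda_unif 6 \<xi>) (lambda_ord 6 \<xi>) = 1 \<longrightarrow> lambda_unif 6 \<xi> < ereal 0.2540) \<and>
      (MM_sum 8 (lambda_unif 8 \<xi>) (lambda_ord 8 \<xi>) = 1 \<longrightarrow> lambda_unif 8 \<xi> < ereal 0.1968)"
  proof (intro allI impI conjI)
    fix \<xi> :: real assume tr: "\<not> algebraic \<xi>"
    show "lambda_unif 4 \<xi> < ereal 0.3588" if "MM_sum 4 (lambda_unif 4 \<xi>) (lambda_ord 4 \<xi>) = 1"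
      \<comment> \<open>This ratio and the two below lie just under the root of
        \<open>polybound n r * r ^ (n - 1) = geo r n\<close>, where the method is sharp; in all
        three cases the maximum in \<open>polybound\<close> is
        \<open>n + (n - 1) * r\<close>.\<close>
      by (rule small[OF tr that, of "0.76247"]) (simp_all add: polybound_def geo_def eval_nat_numeral)
    show "lambda_unif 6 \<xi> < ereal 0.2540" if "MM_sum 6 (lambda_unif 6 \<xi>) (lambda_ord 6 \<xi>) = 1"
      by (rule small[OF tr that, of "0.82764"]) (simp_all add: polybound_def geo_def eval_nat_numeral)
    show "lambda_unif 8 \<xi> < ereal 0.1968" if "MM_sum 8 (lambda_unif 8 \<xi>) (lambda_ord 8 \<xi>) = 1"
      by (rule small[OF tr that, of "0.86474"]) (simp_all add: polybound_def geo_def eval_nat_numeral)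
  qed
next
  show "\<exists>e :: nat \<Rightarrow> real. e \<longlonglongrightarrow> 0 \<and>
        (\<forall>n \<ge> 4. even n \<longrightarrow> (\<forall>\<xi>::real. \<not> algebraic \<xi> \<longrightarrow>
           MM_sum n (lambda_unif n \<xi>) (lambda_ord n \<xi>) = 1 \<longrightarrow>
           lambda_unif n \<xi> \<le> ereal ((Theta + e n) / real n)))"
  \<comment> \<open>No error term is required, since the extremal ratio is admissible for every n
    \<ge> 4.\<close>
  proof (rule exI[of _ "\<lambda>_. 0"], intro conjI allI impI)
    fix n :: nat and \<xi> :: real
    assume n: "4 \<le> n" and \<xi>: "\<not> algebraic \<xi>" "MM_sum n (lambda_unif n \<xi>) (lambda_ord n \<xi>) = 1"
    note r = Theta_ratio[OF n]
    have "lambda_unif n \<xi> \<le> ereal (1 / geo (1 - (Theta - 1/2) / real n) n)"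
      using n by (intro equality_lambda_unif_le r \<xi>) simp
    also have "\<dots> \<le> ereal ((Theta + 0) / real n)" using r(3) by simp
    finally show "lambda_unif n \<xi> \<le> ereal ((Theta + 0) / real n)" .
  qed simp
next
  show "\<exists>n0 :: nat. \<forall>n \<ge> n0. 4 \<le> n \<longrightarrow> even n \<longrightarrow>
        (\<forall>\<epsilon>::real. \<epsilon> > 0 \<longrightarrow> (\<exists>\<delta>::real. \<delta> > 0 \<and>
          (\<forall>(\<xi>::real) \<alpha> \<beta>. \<not> algebraic \<xi> \<longrightarrow>
             \<alpha> = lambda_unif n \<xi> \<longrightarrow> \<beta> = lambda_ord n \<xi> \<longrightarrow>
             \<alpha> \<in> {ereal (1 / real n)..1} \<longrightarrow> \<beta> \<in> {ereal (1 / real n)..\<infinity>} \<longrightarrow>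
             MM_defect n \<alpha> \<beta> < ereal \<delta> \<longrightarrow>
             lambda_unif n \<xi> \<le> ereal ((Theta + \<epsilon>) / real n))))"
  \<comment> \<open>For the same reason n0 = 4 works, and \<delta> can be chosen independently of
    \<epsilon>.\<close>
  proof (rule exI[of _ 4], intro allI impI)
    fix n :: nat and \<epsilon> :: real
    assume n: "4 \<le> n" and \<epsilon>: "0 < \<epsilon>"
    note r = Theta_ratio[OF n]
    have "2 \<le> n" using n by simp
    from near_equality_lambda_unif_le[OF this r(1,2,4)] obtain \<delta> :: real where \<delta>: "0 < \<delta>"
      "\<And>\<xi>. \<not> algebraic \<xi> \<Longrightarrow> MM_defect n (lambda_unif n \<xi>) (lambda_ord n \<xi>) < ereal \<delta> \<Longrightarrow>
        lambda_unif n \<xi> \<le> ereal (1 / geo (1 - (Theta - 1/2) / real n) n)"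
      by blast
    have "Theta / real n \<le> (Theta + \<epsilon>) / real n" using \<epsilon> by (intro divide_right_mono) auto
    with r(3) have "ereal (1 / geo (1 - (Theta - 1/2) / real n) n) \<le> ereal ((Theta + \<epsilon>) / real n)" by simp
    then show "\<exists>\<delta>::real. \<delta> > 0 \<and>
          (\<forall>(\<xi>::real) \<alpha> \<beta>. \<not> algebraic \<xi> \<longrightarrow>
             \<alpha> = lambda_unif n \<xi> \<longrightarrow> \<beta> = lambda_ord n \<xi> \<longrightarrow>
             \<alpha> \<in> {ereal (1 / real n)..1} \<longrightarrow> \<beta> \<in> {ereal (1 / real n)..\<infinity>} \<longrightarrow>
             MM_defect n \<alpha> \<beta> < ereal \<delta> \<longrightarrow>
             lambda_unif n \<xi> \<le> ereal ((Theta + \<epsilon>) / real n))"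
      using \<delta> order_trans by blast
  qed
qed

end
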